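(* Let $\vec v\in\mathbb R^3$ be a unit vector and $\lambda\in\mathbb R$. Let $\Pi\subset\mathbb R^3$ be a plane and let $\Gamma\subset\Pi$ be a Jordan curve. Denote by $D\subset\Pi$ the domain bounded by $\Gamma$ and let $\mathrm{ext}(D)=\Pi\setminus\overline D$. If $\Sigma$ is an embedded compact $\lambda$-translating soliton (with density vector $\vec v$) with boundary $\Gamma$ and $\Sigma\cap\mathrm{ext}(D)=\emptyset$, then the interior of $\Sigma$ lies in one side of $\Pi$ (i.e. in one of the two open halfspaces determined by $\Pi$) or $\Sigma$ is contained in the plane $\Pi$.
   Context: All surfaces are smooth, connected and oriented. The mean curvature $H$ is the average of the two principal curvatures with respect to the Gauss map $N$, with sign convention $\Delta\psi=2HN$ for an immersion $\psi:\Sigma\to\mathbb R^3$. A $\lambda$-translating soliton with density vector $\vec v$ is a surface with $H=\lambda+\langle N,\vec v\rangle/2$ everywhere on it. *)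

theory Defs
  imports "HOL-Analysis.Analysis"
begin

text \<open>
  \<open>Ck_on k U f\<close> is meant for open \<open>U\<close>: all iterated directional derivatives of \<open>f\<close> up to order
  \<open>k\<close> exist and are continuous on \<open>U\<close>.
\<close>

primrec Ck_on :: "nat \<Rightarrow> 'a::euclidean_space set \<Rightarrow> ('a \<Rightarrow> 'b::euclidean_space) \<Rightarrow> bool" where
  "Ck_on 0 U f \<longleftrightarrow> continuous_on U f"
| "Ck_on (Suc k) U f \<longleftrightarrow>
     (\<forall>x\<in>U. f differentiable (at x)) \<and>
     (\<forall>v. Ck_on k U (\<lambda>x. frechet_derivative f (at x) v))"

definition smooth_on :: "'a::euclidean_space set \<Rightarrow> ('a \<Rightarrow> 'b::euclidean_space) \<Rightarrow> bool" where
  "smooth_on U f \<longleftrightarrow> (\<forall>k. Ck_on k U f)"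

definition half_plane :: "(real^2) set" where
  "half_plane = {x. x $ 2 \<ge> 0}"

text \<open>
  Local parametrizations of a surface with boundary \<open>S \<subseteq> \<real>\<^sup>3\<close>, modelled on the closed half plane.
  The map is smooth on an open set \<open>V\<close> of the plane, as usual for smoothness up to the boundary of
  the half plane, but only its values on \<open>V \<inter> half_plane\<close> parametrize \<open>S\<close>. The requirement that it is
  a homeomorphism onto a relatively open subset of \<open>S\<close> is what makes the surface embedded.
\<close>

definition local_parametrization ::
    "(real^3) set \<Rightarrow> (real^2) set \<Rightarrow> (real^2 \<Rightarrow> real^3) \<Rightarrow> bool" where
  "local_parametrization S V \<phi> \<longleftrightarrow>
     open V \<and> smooth_on V \<phi> \<and>
     (\<forall>q\<in>V. inj (frechet_derivative \<phi> (at q))) \<and>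
     (\<exists>U g. open U \<and> homeomorphism (V \<inter> half_plane) (S \<inter> U) \<phi> g)"

definition embedded_surface :: "(real^3) set \<Rightarrow> bool" where
  "embedded_surface S \<longleftrightarrow>
     (\<forall>p\<in>S. \<exists>V \<phi>. local_parametrization S V \<phi> \<and> p \<in> \<phi> ` (V \<inter> half_plane))"

definition surface_boundary :: "(real^3) set \<Rightarrow> (real^3) set" where
  "surface_boundary S =
     {p. \<exists>V \<phi> q. local_parametrization S V \<phi> \<and> q \<in> V \<and> q $ 2 = 0 \<and> \<phi> q = p}"

definition surface_interior :: "(real^3) set \<Rightarrow> (real^3) set" where
  "surface_interior S = S - surface_boundary S"

definition tangent_plane :: "(real^3) set \<Rightarrow> real^3 \<Rightarrow> (real^3) set" where
  "tangent_plane S p =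
     {w. \<exists>V \<phi> q. local_parametrization S V \<phi> \<and> q \<in> V \<inter> half_plane \<and> \<phi> q = p \<and>
         w \<in> range (frechet_derivative \<phi> (at q))}"

text \<open>
  A Gauss map is an orientation of the surface. A continuous unit normal field on a smooth surface
  is automatically smooth.
\<close>

definition gauss_map :: "(real^3) set \<Rightarrow> (real^3 \<Rightarrow> real^3) \<Rightarrow> bool" where
  "gauss_map S N \<longleftrightarrow>
     continuous_on S N \<and>
     (\<forall>p\<in>S. norm (N p) = 1 \<and> (\<forall>w\<in>tangent_plane S p. N p \<bullet> w = 0))"

text \<open>
  The principal curvatures are the eigenvalues, with multiplicity, of the shape operator \<open>-dN\<close> on
  the tangent plane; as this operator is symmetric, it has an orthonormal eigenbasis \<open>e1, e2\<close>.
  A derivative \<open>N'\<close> of \<open>N\<close> within \<open>S\<close> is a linear map on \<open>\<real>\<^sup>3\<close> whose restriction to the tangent plane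
  is uniquely determined (and equal to \<open>dN\<close>), also at boundary points.
\<close>

definition principal_curvatures ::
    "(real^3) set \<Rightarrow> (real^3 \<Rightarrow> real^3) \<Rightarrow> real^3 \<Rightarrow> real \<Rightarrow> real \<Rightarrow> bool" where
  "principal_curvatures S N p k1 k2 \<longleftrightarrow>
     (\<exists>N' e1 e2. (N has_derivative N') (at p within S) \<and>
        e1 \<in> tangent_plane S p \<and> e2 \<in> tangent_plane S p \<and>
        norm e1 = 1 \<and> norm e2 = 1 \<and> e1 \<bullet> e2 = 0 \<and>
        - N' e1 = k1 *\<^sub>R e1 \<and> - N' e2 = k2 *\<^sub>R e2)"

text \<open>
  With the shape operator \<open>-dN\<close> one has \<open>\<Delta>\<psi> = 2 H N\<close>: round spheres have positive mean curvature
  with respect to the inward normal.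
\<close>

definition has_mean_curvature ::
    "(real^3) set \<Rightarrow> (real^3 \<Rightarrow> real^3) \<Rightarrow> real^3 \<Rightarrow> real \<Rightarrow> bool" where
  "has_mean_curvature S N p H \<longleftrightarrow>
     (\<exists>k1 k2. principal_curvatures S N p k1 k2 \<and> H = (k1 + k2) / 2)"

text \<open>
  Surfaces are smooth, connected and oriented (by \<open>N\<close>), possibly with boundary.
\<close>

definition translating_soliton ::
    "real \<Rightarrow> real^3 \<Rightarrow> (real^3) set \<Rightarrow> (real^3 \<Rightarrow> real^3) \<Rightarrow> bool" where
  "translating_soliton lam v S N \<longleftrightarrow>
     embedded_surface S \<and> connected S \<and> gauss_map S N \<and>
     (\<forall>p\<in>S. has_mean_curvature S N p (lam + (N p \<bullet> v) / 2))"

definition jordan_curve :: "(real^3) set \<Rightarrow> bool" where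
  "jordan_curve \<Gamma> \<longleftrightarrow>
     (\<exists>\<gamma>. simple_path \<gamma> \<and> pathfinish \<gamma> = pathstart \<gamma> \<and> path_image \<gamma> = \<Gamma>)"

text \<open>
  The complement is taken in the plane \<open>P\<close>; the library's \<open>inside\<close> refers to the complement in the
  whole space, which is connected for a curve in \<open>\<real>\<^sup>3\<close>.
\<close>

definition domain_bounded_by :: "(real^3) set \<Rightarrow> (real^3) set \<Rightarrow> (real^3) set \<Rightarrow> bool" where
  "domain_bounded_by P \<Gamma> D \<longleftrightarrow> D \<in> components (P - \<Gamma>) \<and> bounded D"

end

theory Submission
  imports Defs
begin

text \<open>
  Suppose that the interior of \<open>S\<close> lies in neither open half space, and let \<open>q\<close> and \<open>p\<close> be interior points
  at which the height \<open>x \<mapsto> a \<bullet> x\<close> over \<open>P\<close> is largest and smallest; the normals there are \<open>\<plusminus> sgn a\<close>.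
  As \<open>S\<close> misses the exterior of \<open>D\<close>, the set \<open>X = S \<union> (P - D)\<close> is a closed topological surface without
  boundary, and it separates space into the part above it and the part below it. Both \<open>N\<close> and
  the vertical rays from \<open>p\<close> and \<open>q\<close> compare the sides, which forces \<open>N p = N q\<close>. Hence \<open>p\<close> and \<open>q\<close> have the
  same mean curvature \<open>lam + N p \<bullet> v / 2\<close>, while the second derivative test gives it opposite signs, so it
  vanishes. Thus the plane through \<open>p\<close> parallel to \<open>P\<close> solves the soliton equation as well, and by Hopf's
  strong maximum principle \<open>S\<close> is contained in it.

  The separation is obtained without duality theorems: locally a two-valued function telling the
  sides of \<open>X\<close> apart is written down explicitly (also along \<open>\<Gamma>\<close>, where \<open>S\<close> may be tangent to \<open>P\<close>), two
  such functions on a convex set agree up to a global sign because \<open>\<Gamma>\<close> does not disconnect it, and they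
  are therefore glued over a large box.
\<close>

section \<open>The strong minimum principle\<close>

text \<open>The obstacle is that \<open>lam + (N p \<bullet> v) / 2\<close> has no sign and depends
  on the orientation, so touching \<open>S\<close> with a horizontal plane at one extremum yields
  nothing. Only when top and bottom have the same normal do the two second derivative tests pull in
  opposite directions. This is a global statement about orientations, hence the topological part.
  Along \<Gamma> the angle between \<open>S\<close> and \<open>P\<close> is arbitrary and may
  vanish, so \<open>X\<close> need not be smooth there; two kinds of collar, along \<open>P\<close>
  and along its normal, cover all angles. Although \<open>X\<close> is unbounded, a box suffices: it
  has to contain \<open>S\<close> and a vertical segment through a point of \<open>P\<close> so far
  out that the whole line misses \<open>S\<close>. That segment crosses \<open>X\<close> once and
  calibrates above against below. Surfaces that lie on one side and touch \<open>P\<close> at an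
  interior point are not treated apart: one extremum then has height \<open>b\<close>, and the
  argument is the same. Rigidity works because the constant normal \<open>N p\<close> solves
  \<open>lam + (N p \<bullet> v) / 2 = 0\<close>: the height above the touching plane satisfies a
  linear elliptic inequality with bounded coefficients.\<close>

lemma second_derivative_nonneg_at_min:
  fixes g g' :: "real \<Rightarrow> real"
  assumes "e > 0" and g: "\<And>t. \<bar>t\<bar> < e \<Longrightarrow> (g has_real_derivative g' t) (at t)"
    and g': "(g' has_real_derivative c) (at 0)" and min: "\<And>t. \<bar>t\<bar> < e \<Longrightarrow> g 0 \<le> g t"
  shows "g' 0 = 0" "c \<ge> 0"
proof -
  show g0: "g' 0 = 0"
    using DERIV_local_min[OF g[of 0] \<open>e > 0\<close>] min \<open>e > 0\<close> by simp
  show "c \<ge> 0"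
  proof (rule ccontr)
    assume "\<not> c \<ge> 0"
    then have "c < 0" by simp
    from DERIV_neg_dec_right[OF g' this] obtain d where d: "d > 0" "\<And>h. 0 < h \<Longrightarrow> h < d \<Longrightarrow> g' h < 0"
      using g0 by auto
    define t where "t = min d e / 2"
    have t: "t > 0" "t < d" "t < e" using d(1) \<open>e > 0\<close> by (auto simp: t_def)
    \<comment> \<open>\<open>g'\<close> is differentiable at 0 only, so the mean value theorem for
      \<open>g\<close> replaces a Taylor expansion.\<close>
    have "\<exists>z. z > 0 \<and> z < t \<and> g t - g 0 = (t - 0) * g' z"
      by (rule MVT2) (use t g in auto)
    then obtain z where z: "z > 0" "z < t" "g t - g 0 = t * g' z" by auto
    have "g' z < 0" using d(2) z t by simp
    then have "t * g' z < 0" using t by (simp add: mult_pos_neg)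
    then have "g t < g 0" using z by simp
    then show False using min[of t] t by simp
  qed
qed

lemma second_derivative_test:
  fixes h :: "'a::real_normed_vector \<Rightarrow> real"
  assumes "open U" "x \<in> U" and h: "\<And>y. y \<in> U \<Longrightarrow> (h has_derivative h' y) (at y)"
    and h2: "((\<lambda>y. h' y v) has_derivative h2) (at x)" and min: "\<And>y. y \<in> U \<Longrightarrow> h x \<le> h y"
  shows "h' x v = 0" "h2 v \<ge> 0"
proof -
  obtain r where r: "r > 0" "ball x r \<subseteq> U" using assms(1,2) openE by blast
  \<comment> \<open>The summand 1 keeps \<open>e\<close> positive for \<open>v = 0\<close> as
    well.\<close>
  define e where "e = r / (norm v + 1)"
  have nv: "norm v + 1 > 0" by (smt (verit) norm_ge_zero)
  have e: "e > 0" using r nv by (auto simp: e_def)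
  have inU: "x + t *\<^sub>R v \<in> U" if "\<bar>t\<bar> < e" for t
  proof -
    have "\<bar>t\<bar> * norm v \<le> \<bar>t\<bar> * (norm v + 1)" by (simp add: mult_left_mono)
    also have "\<dots> < r" using that nv by (simp add: e_def field_simps)
    finally show ?thesis using r by (auto simp: dist_norm)
  qed
  have path: "((\<lambda>t. x + t *\<^sub>R v) has_derivative (\<lambda>t. t *\<^sub>R v)) (at t)" for t
    by (auto intro!: derivative_eq_intros)
  have g: "((\<lambda>t. h (x + t *\<^sub>R v)) has_real_derivative h' (x + t *\<^sub>R v) v) (at t)" if "\<bar>t\<bar> < e" for t
  proof -
    have "((\<lambda>t. h (x + t *\<^sub>R v)) has_derivative (\<lambda>s. h' (x + t *\<^sub>R v) (s *\<^sub>R v))) (at t)"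
      by (rule has_derivative_compose[OF path]) (use h inU that in auto)
    moreover have "h' (x + t *\<^sub>R v) (s *\<^sub>R v) = h' (x + t *\<^sub>R v) v * s" for s
      using h[OF inU[OF that]] by (simp add: has_derivative_def linear_simps)
    ultimately show ?thesis by (simp add: has_field_derivative_def)
  qed
  have g': "((\<lambda>t. h' (x + t *\<^sub>R v) v) has_real_derivative h2 v) (at 0)"
  proof -
    have "((\<lambda>t. h' (x + t *\<^sub>R v) v) has_derivative (\<lambda>s. h2 (s *\<^sub>R v))) (at 0)"
      by (rule has_derivative_compose[OF path]) (use h2 in auto)
    moreover have "h2 (s *\<^sub>R v) = h2 v * s" for s
      using h2 by (simp add: has_derivative_def linear_simps)
    ultimately show ?thesis by (simp add: has_field_derivative_def)
  qed
  have "h (x + 0 *\<^sub>R v) \<le> h (x + t *\<^sub>R v)" if "\<bar>t\<bar> < e" for t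
    using min[OF inU[OF that]] by simp
  from second_derivative_nonneg_at_min[OF e g g' this]
  show "h' x v = 0" "h2 v \<ge> 0" by simp_all
qed

text \<open>
  The touching point \<open>z\<close> of the zero set with a ball on which \<open>h > 0\<close> is excluded by comparing \<open>h\<close>
  with a multiple of Hopf's barrier \<open>exp (-\<alpha> |x - y|\<^sup>2) - exp (-\<alpha> R\<^sup>2)\<close> on an annulus.
\<close>

lemma strong_minimum_principle:
  fixes h :: "'a::euclidean_space \<Rightarrow> real"
  assumes R: "R > 0" and c: "c > 0" and C: "C \<ge> 0"
    and h: "\<And>x. x \<in> ball q R \<Longrightarrow> (h has_derivative h' x) (at x)"
    and h2: "\<And>x v. x \<in> ball q R \<Longrightarrow> ((\<lambda>y. h' y v) has_derivative h'' x v) (at x)"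
    and nonneg: "\<And>x. x \<in> ball q R \<Longrightarrow> h x \<ge> 0" and zero: "h q = 0"
    and ell: "\<And>x. x \<in> ball q R \<Longrightarrow> \<exists>w1 w2. (norm w1)\<^sup>2 + (norm w2)\<^sup>2 \<le> M \<and>
       (\<forall>r. c * (norm r)\<^sup>2 \<le> (r \<bullet> w1)\<^sup>2 + (r \<bullet> w2)\<^sup>2) \<and>
       h'' x w1 w1 + h'' x w2 w2 \<le> C * (\<bar>h' x w1\<bar> + \<bar>h' x w2\<bar>)"
    and y: "y \<in> ball q (R/4)"
  shows "h y = 0"
proof (rule ccontr)
  assume "h y \<noteq> 0"
  have "y \<in> ball q R" using y R by auto
  then have hy: "h y > 0" using nonneg[of y] \<open>h y \<noteq> 0\<close> by simp
  have conth: "continuous_on (ball q R) h"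
    by (meson continuous_at_imp_continuous_on h has_derivative_continuous)
  define Z where "Z = {x \<in> cball q (R/2). h x = 0}"
  have sub2: "cball q (R/2) \<subseteq> ball q R" using R by auto
  have "compact Z"
  proof -
    have "closed {x \<in> cball q (R/2). h x \<in> {0}}"
      by (rule continuous_closed_preimage[unfolded vimage_def Int_def mem_Collect_eq])
        (use conth sub2 in \<open>auto intro: continuous_on_subset\<close>)
    then have "closed Z" by (simp add: Z_def)
    moreover have "bounded Z" unfolding Z_def by (rule bounded_subset[of "cball q (R/2)"]) auto
    ultimately show ?thesis using compact_eq_bounded_closed by blast
  qed
  moreover have qZ: "q \<in> Z" using zero R by (auto simp: Z_def)
  \<comment> \<open>A zero nearest to \<open>y\<close>. Since \<open>q\<close> is a zero within
    \<open>R/4\<close> of \<open>y\<close>, so is \<open>z\<close>, and the ball of radius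
    \<open>R0\<close> around \<open>y\<close> stays in \<open>ball q (R/2)\<close>. As
    \<open>Z\<close> contains all zeros there, \<open>h\<close> is positive in the interior of that
    ball.\<close>
  ultimately obtain z where z: "z \<in> Z" "\<And>x. x \<in> Z \<Longrightarrow> dist y z \<le> dist y x"
    using distance_attains_inf[of Z y] compact_imp_closed by blast
  define R0 where "R0 = dist y z"
  have hz: "h z = 0" using z by (simp add: Z_def)
  have R0: "R0 > 0" using hz hy by (auto simp: R0_def)
  have R0R: "R0 < R/4" using z(2)[OF qZ] y by (auto simp: R0_def dist_commute)
  have inball: "x \<in> ball q (R/2)" if "dist x y \<le> R0" for x
    using dist_triangle[of q x y] that y R0R by (auto simp: dist_commute)
  have inbR: "x \<in> ball q R" if "dist x y \<le> R0" for x
    using inball[OF that] R by auto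
  have pos: "h x > 0" if "dist x y < R0" for x
  proof -
    have "x \<notin> Z" using z(2)[of x] that by (auto simp: R0_def dist_commute)
    then have "h x \<noteq> 0" using inball[of x] that by (auto simp: Z_def)
    then show ?thesis using nonneg[of x] inbR[of x] that by fastforce
  qed
  have zy: "dist z y = R0" by (simp add: R0_def dist_commute)
  have "M \<ge> 0"
    using ell[of z] inbR[of z] zy by (smt (verit) zero_le_power2)
  \<comment> \<open>Solved backwards from the last inequality of the barrier estimate:
    \<open>c * R0\<^sup>2 * K\<close> equals the total cost
    \<open>2 * M + 2 * C * R0 * (1 + M)\<close> of the trace and gradient terms. The extra 1 in
    \<alpha> makes the estimate strict.\<close>
  define K where "K = 4 * (2 * M + 2 * C * R0 * (1 + M)) / (4 * c * R0\<^sup>2)"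
  define \<alpha> where "\<alpha> = 1 + K"
  have K0: "K \<ge> 0" using \<open>M \<ge> 0\<close> C R0 c by (auto simp: K_def)
  have al: "\<alpha> > 0" using K0 by (simp add: \<alpha>_def)
  have "c * R0\<^sup>2 * K = 2 * M + 2 * C * R0 * (1 + M)"
    using c R0 by (simp add: K_def field_simps)
  moreover have "c * R0\<^sup>2 * \<alpha> = c * R0\<^sup>2 + c * R0\<^sup>2 * K" by (simp add: \<alpha>_def algebra_simps)
  moreover have "c * R0\<^sup>2 > 0" using c R0 by simp
  ultimately have al2: "\<alpha> * (c * R0\<^sup>2) > 2 * M + 2 * C * R0 * (1 + M)" by (simp add: mult.commute)
  define E where "E x = exp (- \<alpha> * ((x - y) \<bullet> (x - y)))" for x
  define E' where "E' x v = - 2 * \<alpha> * ((x - y) \<bullet> v) * E x" for x v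
  define E'' where "E'' x v u = (4 * \<alpha>\<^sup>2 * ((x - y) \<bullet> v) * ((x - y) \<bullet> u) - 2 * \<alpha> * (u \<bullet> v)) * E x" for x v u
  have dE: "(E has_derivative E' x) (at x)" for x
    unfolding E_def [abs_def] E'_def
    by (auto intro!: derivative_eq_intros simp: fun_eq_iff inner_commute algebra_simps)
  have dE': "((\<lambda>x. E' x v) has_derivative E'' x v) (at x)" for x v
    unfolding E'_def E''_def
    by (rule derivative_eq_intros dE refl)+
      (auto simp: fun_eq_iff inner_commute algebra_simps E'_def power2_eq_square)
  have Epos: "E x > 0" for x by (simp add: E_def)
  have E1: "E x \<le> 1" for x using al by (auto simp: E_def)
  define W where "W x = E x - exp (- \<alpha> * R0\<^sup>2)" for x
  have dW: "(W has_derivative E' x) (at x)" for x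
    unfolding W_def using dE[of x] by (auto intro!: derivative_eq_intros)
  have W1: "W x \<le> 1" for x using E1[of x] exp_gt_zero[of "- \<alpha> * R0\<^sup>2"] unfolding W_def by linarith
  \<comment> \<open>The hole is needed because the good term of \<open>E''\<close> is quadratic in
    \<open>x - y\<close> and degenerates at the centre.\<close>
  define A where "A = {x. R0/2 \<le> dist x y \<and> dist x y \<le> R0}"
  have "compact (sphere y (R0/2))" by simp
  moreover have "continuous_on (sphere y (R0/2)) h"
    by (rule continuous_on_subset[OF conth]) (use inbR R0 in \<open>auto simp: dist_commute\<close>)
  moreover have "sphere y (R0/2) \<noteq> {}"
    using R0 by simp
  ultimately obtain x0 where x0: "x0 \<in> sphere y (R0/2)" "\<And>x. x \<in> sphere y (R0/2) \<Longrightarrow> h x0 \<le> h x"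
    using continuous_attains_inf by metis
  \<comment> \<open>As \<open>W\<close> is at most 1 and vanishes on the outer sphere, this factor
    makes \<open>h - \<epsilon> * W\<close> nonnegative on both boundary spheres of
    \<open>A\<close>.\<close>
  define \<epsilon> where "\<epsilon> = h x0"
  have eps: "\<epsilon> > 0" using pos[of x0] x0 R0 by (auto simp: \<epsilon>_def dist_commute)
  define u where "u x = h x - \<epsilon> * W x" for x
  define u' where "u' x v = h' x v - \<epsilon> * E' x v" for x v
  define u'' where "u'' x v t = h'' x v t - \<epsilon> * E'' x v t" for x v t
  have du: "(u has_derivative u' x) (at x)" if "x \<in> ball q R" for x
    unfolding u_def [abs_def] u'_def by (intro derivative_intros h[OF that] dW)
  have du': "((\<lambda>y. u' y v) has_derivative u'' x v) (at x)" if "x \<in> ball q R" for x v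
    unfolding u'_def u''_def by (intro derivative_intros h2[OF that] dE')
  have uA: "u x \<ge> 0" if xA: "x \<in> A" for x
  proof (rule ccontr)
    assume neg: "\<not> u x \<ge> 0"
    have AB: "A = cball y R0 - ball y (R0/2)" by (auto simp: A_def dist_commute)
    have "compact A" unfolding AB by (rule compact_diff) auto
    moreover have "continuous_on A u"
      using du inbR by (auto simp: A_def intro!: continuous_at_imp_continuous_on has_derivative_continuous)
    ultimately obtain m where m: "m \<in> A" "\<And>x. x \<in> A \<Longrightarrow> u m \<le> u x"
      using continuous_attains_inf[of A u] xA by blast
    have um: "u m < 0" using m(2)[OF xA] neg by simp
    have mR: "dist m y \<noteq> R0"
    proof
      assume d: "dist m y = R0"
      then have "(m - y) \<bullet> (m - y) = R0\<^sup>2" by (simp add: dist_norm flip: power2_norm_eq_inner)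
      then have "W m = 0" by (simp add: W_def E_def)
      then show False using um nonneg[OF inbR[of m]] d by (simp add: u_def)
    qed
    have mR2: "dist m y \<noteq> R0/2"
    proof
      assume "dist m y = R0/2"
      then have "h m \<ge> \<epsilon>" using x0(2)[of m] by (simp add: \<epsilon>_def dist_commute)
      moreover have "\<epsilon> * W m \<le> \<epsilon>" using W1[of m] eps by simp
      ultimately show False using um by (simp add: u_def)
    qed
    define O' where "O' = ball y R0 - cball y (R0/2)"
    have O': "open O'" "m \<in> O'" "O' \<subseteq> A"
      using m(1) mR mR2 by (auto simp: O'_def A_def dist_commute)
    have mq: "m \<in> ball q R" using m(1) inbR by (auto simp: A_def)
    \<comment> \<open>At an interior minimum of \<open>u\<close> the gradients of \<open>h\<close>
      and \<open>\<epsilon> * E\<close> coincide, so the inequality assumed for \<open>h\<close>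
      turns into one for the explicit function \<open>E\<close>, which the choice of \<alpha>
      refutes.\<close>
    have test: "u' m v = 0" "u'' m v v \<ge> 0" for v
    proof -
      have OU: "\<And>y. y \<in> O' \<Longrightarrow> (u has_derivative u' y) (at y)"
        using du O'(3) inbR by (auto simp: A_def)
      show "u' m v = 0" "u'' m v v \<ge> 0"
        using second_derivative_test[OF O'(1,2) OU du'[OF mq]] m(2) O'(3) by blast+
    qed
    \<comment> \<open>The two directions may vary with the point in any way; the constants
      \<open>M\<close>, \<open>c\<close> and \<open>C\<close> are uniform.\<close>
    obtain w1 w2 where w: "(norm w1)\<^sup>2 + (norm w2)\<^sup>2 \<le> M"
       "\<And>r. c * (norm r)\<^sup>2 \<le> (r \<bullet> w1)\<^sup>2 + (r \<bullet> w2)\<^sup>2"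
       "h'' m w1 w1 + h'' m w2 w2 \<le> C * (\<bar>h' m w1\<bar> + \<bar>h' m w2\<bar>)"
      using ell[OF mq] by blast
    define \<rho> where "\<rho> = norm (m - y)"
    have rho: "R0/2 < \<rho>" "\<rho> < R0" using O'(2) by (auto simp: O'_def \<rho>_def dist_norm norm_minus_commute)
    have hE: "h' m v = \<epsilon> * E' m v" for v using test(1)[of v] by (simp add: u'_def)
    have "\<epsilon> * (E'' m w1 w1 + E'' m w2 w2) \<le> h'' m w1 w1 + h'' m w2 w2"
      using test(2)[of w1] test(2)[of w2] by (simp add: u''_def algebra_simps)
    also have "\<dots> \<le> \<epsilon> * (C * (\<bar>E' m w1\<bar> + \<bar>E' m w2\<bar>))"
      using w(3) eps by (simp add: hE abs_mult algebra_simps)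
    finally have 1: "E'' m w1 w1 + E'' m w2 w2 \<le> C * (\<bar>E' m w1\<bar> + \<bar>E' m w2\<bar>)"
      using eps by simp
    \<comment> \<open>Trades norms for squares, so that the bound \<open>M\<close> on the sum of
      squares gives \<open>norm w1 + norm w2 \<le> 1 + M\<close>.\<close>
    have n1: "norm w \<le> 1/2 + (norm w)\<^sup>2/2" for w :: 'a
      using zero_le_power2[of "norm w - 1"] by (simp add: power2_eq_square algebra_simps)
    have absE: "\<bar>E' m w\<bar> \<le> 2 * \<alpha> * R0 * norm w * E m" for w
    proof -
      have "\<bar>(m - y) \<bullet> w\<bar> \<le> norm (m - y) * norm w" by (rule Cauchy_Schwarz_ineq2)
      also have "\<dots> \<le> R0 * norm w" using rho by (simp add: \<rho>_def mult_right_mono)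
      finally have "2 * \<alpha> * \<bar>(m - y) \<bullet> w\<bar> * E m \<le> 2 * \<alpha> * (R0 * norm w) * E m"
        using al Epos[of m] by (intro mult_right_mono mult_left_mono) auto
      then show ?thesis using al Epos[of m] by (simp add: E'_def abs_mult mult.assoc)
    qed
    have "\<bar>E' m w1\<bar> + \<bar>E' m w2\<bar> \<le> 2 * \<alpha> * R0 * E m * (norm w1 + norm w2)"
      using absE[of w1] absE[of w2] by (simp add: algebra_simps)
    also have "\<dots> \<le> 2 * \<alpha> * R0 * E m * (1 + M)"
      using n1[of w1] n1[of w2] w(1) \<open>M \<ge> 0\<close> al R0 Epos[of m] by (intro mult_left_mono) auto
    finally have 2: "C * (\<bar>E' m w1\<bar> + \<bar>E' m w2\<bar>) \<le> C * (2 * \<alpha> * R0 * E m * (1 + M))"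
      using C by (rule mult_left_mono)
    have "E'' m w1 w1 + E'' m w2 w2 =
       (4 * \<alpha>\<^sup>2 * (((m - y) \<bullet> w1)\<^sup>2 + ((m - y) \<bullet> w2)\<^sup>2) - 2 * \<alpha> * ((norm w1)\<^sup>2 + (norm w2)\<^sup>2)) * E m"
      by (simp add: E''_def power2_eq_square power2_norm_eq_inner[unfolded power2_eq_square] algebra_simps)
    also have "\<dots> \<ge> (4 * \<alpha>\<^sup>2 * (c * (R0/2)\<^sup>2) - 2 * \<alpha> * M) * E m"
    proof (rule mult_right_mono)
      have "(R0/2)\<^sup>2 \<le> \<rho>\<^sup>2" using rho R0 by (intro power_mono) auto
      then have "c * (R0/2)\<^sup>2 \<le> c * \<rho>\<^sup>2" using c by (intro mult_left_mono) auto
      also have "\<dots> \<le> ((m - y) \<bullet> w1)\<^sup>2 + ((m - y) \<bullet> w2)\<^sup>2" using w(2)[of "m - y"] by (simp add: \<rho>_def)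
      finally have "4 * \<alpha>\<^sup>2 * (c * (R0/2)\<^sup>2) \<le> 4 * \<alpha>\<^sup>2 * (((m - y) \<bullet> w1)\<^sup>2 + ((m - y) \<bullet> w2)\<^sup>2)"
        by (intro mult_left_mono) auto
      moreover have "2 * \<alpha> * ((norm w1)\<^sup>2 + (norm w2)\<^sup>2) \<le> 2 * \<alpha> * M" using w(1) al by (intro mult_left_mono) auto
      ultimately show "4 * \<alpha>\<^sup>2 * (c * (R0/2)\<^sup>2) - 2 * \<alpha> * M
         \<le> 4 * \<alpha>\<^sup>2 * (((m - y) \<bullet> w1)\<^sup>2 + ((m - y) \<bullet> w2)\<^sup>2) - 2 * \<alpha> * ((norm w1)\<^sup>2 + (norm w2)\<^sup>2)"
        by linarith
    qed (use Epos[of m] in auto)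
    finally have 3: "(4 * \<alpha>\<^sup>2 * (c * (R0/2)\<^sup>2) - 2 * \<alpha> * M) * E m \<le> C * (2 * \<alpha> * R0 * E m * (1 + M))"
      using 1 2 by linarith
    have "(\<alpha> * (\<alpha> * (c * R0\<^sup>2) - 2 * M)) * E m \<le> (\<alpha> * (2 * C * R0 * (1 + M))) * E m"
      using 3 by (simp add: power2_eq_square algebra_simps)
    then have "\<alpha> * (\<alpha> * (c * R0\<^sup>2) - 2 * M) \<le> \<alpha> * (2 * C * R0 * (1 + M))"
      using Epos[of m] by (rule mult_right_le_imp_le)
    then have "\<alpha> * (c * R0\<^sup>2) - 2 * M \<le> 2 * C * R0 * (1 + M)" using al by (rule mult_left_le_imp_le)
    then show False using al2 by simp
  qed
  have zq: "z \<in> ball q R" using inbR zy by simp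
  \<comment> \<open>Hopf's boundary point argument: \<open>z\<close> is an interior minimum of
    \<open>h\<close>, so the gradient of \<open>h\<close> vanishes there, while \<open>W\<close>
    strictly increases from \<open>z\<close> towards \<open>y\<close>. Hence \<open>u\<close>
    becomes negative just inside the annulus.\<close>
  have "h' z v = 0" for v
    by (rule second_derivative_test(1)[of "ball q R" z h h', OF _ zq h h2[OF zq]]) (use nonneg hz in auto)
  then have u'z: "u' z (y - z) = - \<epsilon> * (2 * \<alpha> * R0\<^sup>2 * E z)"
  proof -
    have "(z - y) \<bullet> (y - z) = - ((z - y) \<bullet> (z - y))"
      by (metis inner_minus_right minus_diff_eq)
    then have "(z - y) \<bullet> (y - z) = - R0\<^sup>2" using zy by (simp add: dist_norm flip: power2_norm_eq_inner)
    then show ?thesis using \<open>\<And>v. h' z v = 0\<close> by (simp add: u'_def E'_def)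
  qed
  have "((\<lambda>t. u (z + t *\<^sub>R (y - z))) has_real_derivative u' z (y - z)) (at 0)"
  proof -
    have "((\<lambda>t. z + t *\<^sub>R (y - z)) has_derivative (\<lambda>t. t *\<^sub>R (y - z))) (at 0)"
      by (auto intro!: derivative_eq_intros)
    then have "((\<lambda>t. u (z + t *\<^sub>R (y - z))) has_derivative (\<lambda>s. u' z (s *\<^sub>R (y - z)))) (at 0)"
      by (rule has_derivative_compose) (use du[OF zq] in simp)
    moreover have "u' z (s *\<^sub>R (y - z)) = u' z (y - z) * s" for s
      using du[OF zq] by (simp add: has_derivative_def linear_simps)
    ultimately show ?thesis by (simp add: has_field_derivative_def)
  qed
  moreover have "u' z (y - z) < 0" using u'z eps al R0 Epos[of z] by (simp add: mult_pos_pos)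
  ultimately obtain d where d: "d > 0" "\<And>t. 0 < t \<Longrightarrow> t < d \<Longrightarrow> u (z + t *\<^sub>R (y - z)) < u z"
    using DERIV_neg_dec_right[of "\<lambda>t. u (z + t *\<^sub>R (y - z))"] by force
  define t where "t = min d 1 / 2"
  have t: "0 < t" "t < d" "t \<le> 1/2" using d by (auto simp: t_def)
  have "z + t *\<^sub>R (y - z) - y = (1 - t) *\<^sub>R (z - y)" by (simp add: algebra_simps)
  then have "dist (z + t *\<^sub>R (y - z)) y = (1 - t) * R0" using t zy by (simp add: dist_norm)
  moreover have "(1 - t) * R0 \<ge> 1/2 * R0" using t R0 by (intro mult_right_mono) auto
  moreover have "(1 - t) * R0 \<le> 1 * R0" using t R0 by (intro mult_right_mono) auto
  ultimately have "z + t *\<^sub>R (y - z) \<in> A" by (auto simp: A_def)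
  moreover have "u z = 0"
    using hz zy by (simp add: u_def W_def E_def dist_norm flip: power2_norm_eq_inner)
  ultimately show False using uA[of "z + t *\<^sub>R (y - z)"] d(2)[OF t(1,2)] by simp
qed

section \<open>Charts\<close>

abbreviation fderiv :: "('a::euclidean_space \<Rightarrow> 'b::euclidean_space) \<Rightarrow> 'a \<Rightarrow> 'a \<Rightarrow> 'b" where
  "fderiv f x \<equiv> frechet_derivative f (at x)"

lemma smooth_on_has_derivative:
  assumes "smooth_on U f" "x \<in> U"
  shows "(f has_derivative fderiv f x) (at x)"
proof -
  have "Ck_on (Suc 0) U f" using assms(1) unfolding smooth_on_def by blast
  then show ?thesis using assms(2) frechet_derivative_works by auto
qed

lemma smooth_on_fderiv:
  assumes "smooth_on U f"
  shows "smooth_on U (\<lambda>x. fderiv f x v)"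
  unfolding smooth_on_def
proof
  fix k
  have "Ck_on (Suc k) U f" using assms unfolding smooth_on_def by blast
  then show "Ck_on k U (\<lambda>x. fderiv f x v)" by simp
qed

lemma smooth_on_continuous:
  assumes "smooth_on U f"
  shows "continuous_on U f"
  using assms Ck_on.simps(1) unfolding smooth_on_def by blast

lemma smooth_on_linear:
  assumes "smooth_on U f" "x \<in> U"
  shows "linear (fderiv f x)"
  using smooth_on_has_derivative[OF assms] has_derivative_linear by blast

lemma linear_axis2:
  fixes L :: "real^2 \<Rightarrow> 'b::real_vector"
  assumes "linear L"
  shows "L v = v$1 *\<^sub>R L (axis 1 1) + v$2 *\<^sub>R L (axis 2 1)"
proof -
  have "v = v$1 *\<^sub>R axis 1 1 + v$2 *\<^sub>R axis 2 1"
    by (simp add: vec_eq_iff forall_2 axis_def)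
  then have "L v = L (v$1 *\<^sub>R axis 1 1 + v$2 *\<^sub>R axis 2 1)" by simp
  then show ?thesis using assms by (simp add: linear_add linear_scale)
qed

text \<open>Unlike a Gauss map, this field lives on the whole parameter domain, also beyond the edge
  of the half plane, where the collars need a normal too.\<close>

definition coord_normal :: "(real^2 \<Rightarrow> real^3) \<Rightarrow> real^2 \<Rightarrow> real^3" where
  "coord_normal \<phi> q = cross3 (fderiv \<phi> q (axis 1 1)) (fderiv \<phi> q (axis 2 1))"

lemma local_parametrizationD:
  assumes "local_parametrization S V \<phi>"
  shows "open V" "smooth_on V \<phi>" "\<And>q. q \<in> V \<Longrightarrow> inj (fderiv \<phi> q)"
    "\<And>q. q \<in> V \<Longrightarrow> q \<in> half_plane \<Longrightarrow> \<phi> q \<in> S"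
  using assms unfolding local_parametrization_def homeomorphism_def by blast+

lemma continuous_on_coord_normal:
  assumes "smooth_on V \<phi>"
  shows "continuous_on V (coord_normal \<phi>)"
  unfolding coord_normal_def
  by (intro continuous_on_cross smooth_on_continuous[OF smooth_on_fderiv[OF assms]])

lemma coord_normal_orthogonal:
  assumes "smooth_on V \<phi>" "q \<in> V"
  shows "coord_normal \<phi> q \<bullet> fderiv \<phi> q w = 0"
  unfolding linear_axis2[OF smooth_on_linear[OF assms], of w]
  by (simp add: coord_normal_def inner_right_distrib dot_cross_self)

lemma coord_normal_nonzero:
  assumes "smooth_on V \<phi>" "q \<in> V" "inj (fderiv \<phi> q)"
  shows "coord_normal \<phi> q \<noteq> 0"
proof
  let ?L = "fderiv \<phi> q"
  have lin: "linear ?L" using smooth_on_linear[OF assms(1,2)] .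
  assume "coord_normal \<phi> q = 0"
  then have "collinear {0, ?L (axis 1 1), ?L (axis 2 1)}"
    by (simp add: coord_normal_def cross_eq_0)
  then consider "?L (axis 1 1) = 0" | "?L (axis 2 1) = 0" | c where "?L (axis 2 1) = c *\<^sub>R ?L (axis 1 1)"
    using collinear_lemma by blast
  then show False
  proof cases
    case 1
    then have "axis 1 (1::real) = (0::real^2)" using assms(3) lin linear_injective_0 by blast
    then show False by (simp add: axis_eq_0_iff)
  next
    case 2
    then have "axis 2 (1::real) = (0::real^2)" using assms(3) lin linear_injective_0 by blast
    then show False by (simp add: axis_eq_0_iff)
  next
    case (3 c)
    then have "?L (axis 2 1) = ?L (c *\<^sub>R axis 1 1)" using lin by (simp add: linear_scale)
    then have "axis 2 (1::real) = (c *\<^sub>R axis 1 1 :: real^2)" using assms(3) by (simp add: inj_eq)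
    then show False by (simp add: vec_eq_iff forall_2 axis_def)
  qed
qed

lemma gauss_map_orthogonal:
  assumes "gauss_map S N" "local_parametrization S V \<phi>" "q \<in> V" "q \<in> half_plane"
  shows "N (\<phi> q) \<bullet> fderiv \<phi> q w = 0"
proof -
  have "fderiv \<phi> q w \<in> tangent_plane S (\<phi> q)"
    unfolding tangent_plane_def using assms(2-4) by blast
  then show ?thesis
    using assms local_parametrizationD(4)[OF assms(2)] unfolding gauss_map_def by blast
qed

text \<open>Inclusion plus equality of dimensions. It is used to write any vector orthogonal to the
  normal as the image of a parameter direction.\<close>

lemma range_fderiv_eq_normal_complement:
  fixes \<phi> :: "real^2 \<Rightarrow> real^3"
  assumes "smooth_on V \<phi>" "q \<in> V" "inj (fderiv \<phi> q)" "n \<noteq> 0" "\<And>w. n \<bullet> fderiv \<phi> q w = 0"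
  shows "range (fderiv \<phi> q) = {u. n \<bullet> u = 0}"
proof (rule subspace_dim_equal)
  have lin: "linear (fderiv \<phi> q)" using smooth_on_linear[OF assms(1,2)] .
  show "subspace (range (fderiv \<phi> q))" using linear_subspace_image[OF lin subspace_UNIV] .
  show "subspace {u. n \<bullet> u = 0}" by (rule subspace_hyperplane)
  show "range (fderiv \<phi> q) \<subseteq> {u. n \<bullet> u = 0}" using assms(5) by auto
  have "dim (range (fderiv \<phi> q)) = 2"
    using dim_image_eq[OF lin, of UNIV] assms(3) by simp
  moreover have "dim {u. n \<bullet> u = 0} = 2" using dim_hyperplane[OF assms(4)] by simp
  ultimately show "dim {u. n \<bullet> u = 0} \<le> dim (range (fderiv \<phi> q))" by simp
qed

text \<open>Differentiating the identity \<open>N (\<phi> x) \<bullet> fderiv \<phi> x w = 0\<close>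
  expresses the normal part of the second derivatives of \<phi> through \<open>- dN\<close>. Pulling
  the principal directions back to parameters \<open>w1\<close>, \<open>w2\<close> then gives
  \<open>2 * H\<close> as a trace, without metric coefficients. The identity is needed on a full
  neighbourhood of \<open>q\<close>, whence \<open>q $ 2 > 0\<close>.\<close>

lemma principal_curvature_sum:
  assumes gm: "gauss_map S N" and lp: "local_parametrization S V \<phi>" and q: "q \<in> V" "q $ 2 > 0"
    and H: "has_mean_curvature S N (\<phi> q) H"
  obtains w1 w2 where "norm (fderiv \<phi> q w1) = 1" "norm (fderiv \<phi> q w2) = 1"
    "fderiv \<phi> q w1 \<bullet> fderiv \<phi> q w2 = 0"
    "N (\<phi> q) \<bullet> fderiv (\<lambda>x. fderiv \<phi> x w1) q w1 + N (\<phi> q) \<bullet> fderiv (\<lambda>x. fderiv \<phi> x w2) q w2 = 2 * H"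
proof -
  note [simp] = local_parametrizationD(1)[OF lp]
  note sm = local_parametrizationD(2)[OF lp]
  have qH: "q \<in> half_plane" using q by (simp add: half_plane_def)
  obtain k1 k2 N' e1 e2 where HH: "H = (k1 + k2) / 2" and
    N': "(N has_derivative N') (at (\<phi> q) within S)"
    and e: "e1 \<in> tangent_plane S (\<phi> q)" "e2 \<in> tangent_plane S (\<phi> q)"
    "norm e1 = 1" "norm e2 = 1" "e1 \<bullet> e2 = 0" "- N' e1 = k1 *\<^sub>R e1" "- N' e2 = k2 *\<^sub>R e2"
    using H unfolding has_mean_curvature_def principal_curvatures_def by blast
  define B where "B = V \<inter> {x. x $ 2 > 0}"
  have B: "open B" "q \<in> B" using q by (auto simp: B_def intro!: open_Int open_halfspace_component_gt_cart)
  have BS: "\<phi> ` B \<subseteq> S" using local_parametrizationD(4)[OF lp] by (auto simp: B_def half_plane_def)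
  have pS: "\<phi> q \<in> S" using local_parametrizationD(4)[OF lp q(1) qH] .
  have d\<phi>: "(\<phi> has_derivative fderiv \<phi> q) (at q within B)"
    using smooth_on_has_derivative[OF sm q(1)] has_derivative_at_withinI by blast
  have "((\<lambda>x. N (\<phi> x)) has_derivative (\<lambda>u. N' (fderiv \<phi> q u))) (at q within B)"
    by (rule has_derivative_in_compose[OF d\<phi> has_derivative_subset[OF N' BS]])
  then have dN: "((\<lambda>x. N (\<phi> x)) has_derivative (\<lambda>u. N' (fderiv \<phi> q u))) (at q)"
    using B at_within_open by metis
  have key: "N (\<phi> q) \<bullet> fderiv (\<lambda>x. fderiv \<phi> x w) q u = - (N' (fderiv \<phi> q u) \<bullet> fderiv \<phi> q w)" for w u
  proof -
    have "((\<lambda>x. N (\<phi> x) \<bullet> fderiv \<phi> x w) has_derivative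
       (\<lambda>u. N (\<phi> q) \<bullet> fderiv (\<lambda>x. fderiv \<phi> x w) q u + N' (fderiv \<phi> q u) \<bullet> fderiv \<phi> q w)) (at q)"
      by (rule has_derivative_inner[OF dN smooth_on_has_derivative[OF smooth_on_fderiv[OF sm] q(1)]])
    moreover have "((\<lambda>x. N (\<phi> x) \<bullet> fderiv \<phi> x w) has_derivative (\<lambda>u. 0)) (at q)"
    proof (rule has_derivative_transform_within_open[of "\<lambda>x. 0", OF _ B])
      show "\<And>x. x \<in> B \<Longrightarrow> 0 = N (\<phi> x) \<bullet> fderiv \<phi> x w"
        using gauss_map_orthogonal[OF gm lp] by (simp add: B_def half_plane_def)
    qed simp
    ultimately have "(\<lambda>u. N (\<phi> q) \<bullet> fderiv (\<lambda>x. fderiv \<phi> x w) q u + N' (fderiv \<phi> q u) \<bullet> fderiv \<phi> q w) = (\<lambda>u. 0)"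
      by (rule has_derivative_unique)
    from fun_cong[OF this, of u] show ?thesis by simp
  qed
  have "N (\<phi> q) \<noteq> 0" using gm pS unfolding gauss_map_def by force
  then have rng: "range (fderiv \<phi> q) = {u. N (\<phi> q) \<bullet> u = 0}"
    using range_fderiv_eq_normal_complement[OF sm q(1) local_parametrizationD(3)[OF lp q(1)]]
      gauss_map_orthogonal[OF gm lp q(1) qH] by blast
  have "N (\<phi> q) \<bullet> e1 = 0" "N (\<phi> q) \<bullet> e2 = 0"
    using gm pS e unfolding gauss_map_def by auto
  then obtain w1 w2 where w: "fderiv \<phi> q w1 = e1" "fderiv \<phi> q w2 = e2"
    using rng by (metis (mono_tags, lifting) mem_Collect_eq imageE)
  have "e1 \<bullet> e1 = 1" "e2 \<bullet> e2 = 1" using e by (simp_all add: dot_square_norm)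
  moreover have "N' e1 = - k1 *\<^sub>R e1" "N' e2 = - k2 *\<^sub>R e2" using e(6,7) by (metis scaleR_minus_left minus_minus)+
  ultimately have "N (\<phi> q) \<bullet> fderiv (\<lambda>x. fderiv \<phi> x w1) q w1 + N (\<phi> q) \<bullet> fderiv (\<lambda>x. fderiv \<phi> x w2) q w2 = 2 * H"
    unfolding key w HH by simp
  then show thesis using that[of w1 w2] w e by blast
qed

section \<open>Interior and boundary points in charts, and connectedness of the interior\<close>

lemma chart_image_open:
  assumes lp: "local_parametrization S V \<phi>" and "open B" "B \<subseteq> V"
  obtains W where "open W" "S \<inter> W = \<phi> ` (B \<inter> half_plane)"
proof -
  obtain U g where U: "open U" "homeomorphism (V \<inter> half_plane) (S \<inter> U) \<phi> g"
    using lp unfolding local_parametrization_def by blast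
  have "openin (top_of_set (V \<inter> half_plane)) (B \<inter> half_plane)"
    unfolding openin_open using assms(2,3) by (intro exI[of _ B]) auto
  then have "openin (top_of_set (S \<inter> U)) (\<phi> ` (B \<inter> half_plane))"
    using homeomorphism_imp_open_map[OF U(2)] by blast
  then obtain W where "open W" "\<phi> ` (B \<inter> half_plane) = (S \<inter> U) \<inter> W"
    unfolding openin_open by blast
  then show thesis using that[of "U \<inter> W"] U(1) by (simp add: Int_assoc open_Int)
qed

text \<open>By invariance of domain: if the point were on the edge of another chart, the transition
  map would send an open set of the plane onto an open set inside the half plane that contains an
  edge point.\<close>

lemma chart_interior:
  assumes lp: "local_parametrization S V \<phi>" and q: "q \<in> V" "q $ 2 > 0"
  shows "\<phi> q \<in> surface_interior S"
proof -
  have "\<phi> q \<notin> surface_boundary S"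
  proof
    assume "\<phi> q \<in> surface_boundary S"
    then obtain V' \<psi> q' where lp': "local_parametrization S V' \<psi>" and q': "q' \<in> V'" "q' $ 2 = 0" "\<psi> q' = \<phi> q"
      unfolding surface_boundary_def by blast
    obtain U g where U: "open U" "homeomorphism (V \<inter> half_plane) (S \<inter> U) \<phi> g"
      using lp unfolding local_parametrization_def by blast
    obtain U' g' where U': "open U'" "homeomorphism (V' \<inter> half_plane) (S \<inter> U') \<psi> g'"
      using lp' unfolding local_parametrization_def by blast
    have cont: "continuous_on V \<phi>" using smooth_on_continuous local_parametrizationD(2)[OF lp] by blast
    define B where "B = {x \<in> V. \<phi> x \<in> U'} \<inter> {x. x $ 2 > 0}"
    have "open {x \<in> V. \<phi> x \<in> U'}"
      using continuous_open_preimage[OF cont local_parametrizationD(1)[OF lp] U'(1)]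
      by (simp add: vimage_def Int_def)
    then have "open B" unfolding B_def by (intro open_Int open_halfspace_component_gt_cart)
    have q'H: "q' \<in> V' \<inter> half_plane" using q' by (simp add: half_plane_def)
    have g'q: "g' (\<phi> q) = q'" using U'(2) q'H unfolding homeomorphism_def q'(3)[symmetric] by blast
    have "\<phi> q \<in> U'" using q'H U'(2) unfolding homeomorphism_def q'(3)[symmetric] by blast
    then have qB: "q \<in> B" using q by (simp add: B_def)
    have BS: "\<phi> ` B \<subseteq> S \<inter> U'" using local_parametrizationD(4)[OF lp] by (auto simp: B_def half_plane_def)
    have "continuous_on B (g' \<circ> \<phi>)"
    proof (rule continuous_on_compose)
      show "continuous_on B \<phi>" by (rule continuous_on_subset[OF cont]) (auto simp: B_def)
      show "continuous_on (\<phi> ` B) g'"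
        by (rule continuous_on_subset[OF homeomorphism_cont2[OF U'(2)] BS])
    qed
    moreover have "inj_on (g' \<circ> \<phi>) B"
    proof (rule comp_inj_on)
      show "inj_on \<phi> B"
        by (rule inj_on_inverseI[of _ g]) (use U(2) in \<open>auto simp: homeomorphism_def B_def half_plane_def\<close>)
      show "inj_on g' (\<phi> ` B)"
        by (rule inj_on_inverseI[of _ \<psi>]) (use BS homeomorphism_apply2[OF U'(2)] in blast)
    qed
    ultimately have "open ((g' \<circ> \<phi>) ` B)" using \<open>open B\<close> invariance_of_domain by blast
    moreover have "q' \<in> (g' \<circ> \<phi>) ` B" using g'q qB by force
    ultimately obtain r where r: "r > 0" "ball q' r \<subseteq> (g' \<circ> \<phi>) ` B" using openE by blast
    have "(g' \<circ> \<phi>) ` B \<subseteq> half_plane" using BS homeomorphism_image2[OF U'(2)] by force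
    \<comment> \<open>The point just below the edge, which the open image would have to
      contain.\<close>
    moreover have "q' - (r/2) *\<^sub>R axis 2 1 \<in> ball q' r" using r by (simp add: dist_norm)
    ultimately have "q' - (r/2) *\<^sub>R axis 2 1 \<in> half_plane" using r by blast
    then show False using q' r by (simp add: half_plane_def)
  qed
  then show ?thesis
    using local_parametrizationD(4)[OF lp q(1)] q(2) by (simp add: surface_interior_def half_plane_def)
qed

lemma chart_boundary:
  assumes "local_parametrization S V \<phi>" "q \<in> V" "q $ 2 = 0"
  shows "\<phi> q \<in> surface_boundary S"
  using assms unfolding surface_boundary_def by blast

lemma interior_chart:
  assumes "embedded_surface S" "p \<in> surface_interior S"
  obtains V \<phi> q where "local_parametrization S V \<phi>" "q \<in> V" "q $ 2 > 0" "\<phi> q = p"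
proof -
  have "p \<in> S" using assms(2) by (simp add: surface_interior_def)
  then obtain V \<phi> q where c: "local_parametrization S V \<phi>" "q \<in> V" "q \<in> half_plane" "\<phi> q = p"
    using assms(1) unfolding embedded_surface_def by (metis IntE imageE)
  then have "q $ 2 \<noteq> 0" using assms(2) chart_boundary by (force simp: surface_interior_def)
  then show thesis using c that by (force simp: half_plane_def)
qed

text \<open>A separation of \<open>T\<close> would extend to \<open>S\<close>: each point of
  \<open>S\<close> has a neighbourhood with connected trace on \<open>T\<close>, which lies on one
  side, and by density two such neighbourhoods of the same point cannot lie on different
  sides.\<close>

lemma connected_dense_part:
  fixes S T :: "'a::topological_space set"
  assumes "connected S" "T \<subseteq> S" and dense: "S \<subseteq> closure T"
    and loc: "\<And>x. x \<in> S \<Longrightarrow> \<exists>W. open W \<and> x \<in> W \<and> connected (W \<inter> T)"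
  shows "connected T"
proof (rule connectedI)
  fix A B assume AB: "open A" "open B" "A \<inter> T \<noteq> {}" "B \<inter> T \<noteq> {}" "A \<inter> B \<inter> T = {}" "T \<subseteq> A \<union> B"
  define G where "G C = \<Union>{W. open W \<and> connected (W \<inter> T) \<and> W \<inter> T \<subseteq> C}" for C
  have op: "open (G C)" for C by (auto simp: G_def)
  have ne: "W \<inter> T \<noteq> {}" if "open W" "x \<in> W" "x \<in> S" for W x
    using dense that closure_iff_nhds_not_empty by (metis Int_commute subset_refl subset_iff)
  have either: "W \<inter> T \<subseteq> A \<or> W \<inter> T \<subseteq> B" if "connected (W \<inter> T)" for W
    using connectedD[OF that AB(1,2)] AB(5,6) by blast
  have "S \<subseteq> G A \<union> G B"
  proof
    fix x assume "x \<in> S"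
    then obtain W where "open W" "x \<in> W" "connected (W \<inter> T)" using loc by blast
    then show "x \<in> G A \<union> G B" using either[of W] by (auto simp: G_def)
  qed
  moreover have "G A \<inter> G B \<inter> S = {}"
  proof (rule ccontr)
    assume "G A \<inter> G B \<inter> S \<noteq> {}"
    then obtain x W W' where x: "x \<in> S" "x \<in> W" "x \<in> W'" "open W" "open W'" "W \<inter> T \<subseteq> A" "W' \<inter> T \<subseteq> B"
      by (auto simp: G_def)
    then have "(W \<inter> W') \<inter> T \<noteq> {}" using ne[of "W \<inter> W'" x] by blast
    then show False using x AB(5) by blast
  qed
  moreover have ne2: "G C \<inter> S \<noteq> {}" if CT: "C \<inter> T \<noteq> {}" and C: "C = A \<or> C = B" for C
  proof -
    obtain x where x: "x \<in> C" "x \<in> T" using CT by blast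
    then obtain W where W: "open W" "x \<in> W" "connected (W \<inter> T)" using loc assms(2) by blast
    then have "W \<inter> T \<subseteq> C" using either[of W] x C AB(5) by blast
    then show ?thesis using W x assms(2) by (auto simp: G_def)
  qed
  moreover have "G A \<inter> S \<noteq> {}" "G B \<inter> S \<noteq> {}" using ne2 AB(3,4) by simp_all
  ultimately show False using connectedD[OF assms(1) op op, of A B] by blast
qed

lemma convex_upper_half: "convex {x::real^2. x $ 2 > 0}"
  using convex_halfspace_gt[of 0 "axis 2 1 :: real^2"] by (simp add: inner_axis')

text \<open>The chart carries a half ball onto a relative neighbourhood; removing the edge leaves a
  convex set, whose image is exactly the interior part. These are the local hypotheses of
  \<open>connected_dense_part\<close>.\<close>

lemma interior_nhd_chart:
  assumes lp: "local_parametrization S V \<phi>" and q: "q \<in> V" "q \<in> half_plane"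
  shows "\<exists>W. open W \<and> \<phi> q \<in> W \<and> connected (W \<inter> surface_interior S)" "\<phi> q \<in> closure (surface_interior S)"
proof -
  obtain r where r: "r > 0" "ball q r \<subseteq> V" using local_parametrizationD(1)[OF lp] q(1) openE by blast
  obtain W where W: "open W" "S \<inter> W = \<phi> ` (ball q r \<inter> half_plane)"
    using chart_image_open[OF lp open_ball r(2)] by blast
  have cont: "continuous_on V \<phi>" using smooth_on_continuous local_parametrizationD(2)[OF lp] by blast
  let ?B = "ball q r \<inter> {x. x $ 2 > 0}"
  have "W \<inter> surface_interior S = \<phi> ` ?B"
  proof
    show "W \<inter> surface_interior S \<subseteq> \<phi> ` ?B"
    proof
      fix p assume p: "p \<in> W \<inter> surface_interior S"
      then have "p \<in> S \<inter> W" by (simp add: surface_interior_def)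
      then obtain x where x: "p = \<phi> x" "x \<in> ball q r" "x \<in> half_plane" using W(2) by auto
      moreover have "x $ 2 \<noteq> 0" using p x chart_boundary[OF lp, of x] r(2) by (auto simp: surface_interior_def)
      ultimately show "p \<in> \<phi> ` ?B" by (auto simp: half_plane_def)
    qed
    show "\<phi> ` ?B \<subseteq> W \<inter> surface_interior S"
      using W(2) chart_interior[OF lp] r(2) by (auto simp: half_plane_def)
  qed
  moreover have "connected (\<phi> ` ?B)"
  proof (rule connected_continuous_image)
    show "continuous_on ?B \<phi>" by (rule continuous_on_subset[OF cont]) (use r in auto)
    show "connected ?B" by (intro convex_connected convex_Int convex_upper_half convex_ball)
  qed
  moreover have "\<phi> q \<in> W"
  proof -
    have "\<phi> q \<in> \<phi> ` (ball q r \<inter> half_plane)" using q(2) r(1) by simp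
    then show ?thesis using W(2) by blast
  qed
  ultimately show "\<exists>W. open W \<and> \<phi> q \<in> W \<and> connected (W \<inter> surface_interior S)"
    using W(1) by (intro exI[of _ W]) simp
  \<comment> \<open>Interior points converging to \<open>\<phi> q\<close>; the 2 in the denominator
    keeps even the first shift below \<open>r\<close>.\<close>
  define s where "s n = q + (r / (2 + real n)) *\<^sub>R axis 2 1" for n
  have sV: "s n \<in> V \<and> s n $ 2 > 0" for n
  proof -
    have "r / (2 + real n) < r" using r by (simp add: divide_less_eq)
    then have "dist q (s n) < r" using r by (simp add: s_def dist_norm)
    moreover have "s n $ 2 > 0" using r q by (simp add: s_def half_plane_def add_nonneg_pos)
    ultimately show ?thesis using r(2) by auto
  qed
  have "(\<lambda>n. r / (2 + real n)) \<longlonglongrightarrow> 0"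
    by (intro tendsto_divide_0[OF tendsto_const] filterlim_at_top_imp_at_infinity
      filterlim_tendsto_add_at_top[OF tendsto_const] filterlim_real_sequentially)
  then have "s \<longlonglongrightarrow> q + 0 *\<^sub>R axis 2 1" unfolding s_def by (intro tendsto_intros)
  then have "(\<lambda>n. \<phi> (s n)) \<longlonglongrightarrow> \<phi> q"
    using continuous_on_tendsto_compose[OF cont, of s q sequentially] q sV by simp
  moreover have "\<phi> (s n) \<in> surface_interior S" for n using chart_interior[OF lp] sV by blast
  ultimately show "\<phi> q \<in> closure (surface_interior S)"
    unfolding closure_sequential by (intro exI[of _ "\<lambda>n. \<phi> (s n)"]) simp
qed

lemma surface_interior_connected:
  assumes "embedded_surface S" "connected S"
  shows "connected (surface_interior S)"
proof (rule connected_dense_part[OF assms(2)])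
  show "surface_interior S \<subseteq> S" by (auto simp: surface_interior_def)
  show "S \<subseteq> closure (surface_interior S)"
  proof
    fix p assume "p \<in> S"
    then obtain V \<phi> q where "local_parametrization S V \<phi>" "q \<in> V" "q \<in> half_plane" "\<phi> q = p"
      using assms(1) unfolding embedded_surface_def by (metis IntE imageE)
    then show "p \<in> closure (surface_interior S)" using interior_nhd_chart(2) by blast
  qed
next
  fix p assume "p \<in> S"
  then obtain V \<phi> q where "local_parametrization S V \<phi>" "q \<in> V" "q \<in> half_plane" "\<phi> q = p"
    using assms(1) unfolding embedded_surface_def by (metis IntE imageE)
  then show "\<exists>W. open W \<and> p \<in> W \<and> connected (W \<inter> surface_interior S)"
    using interior_nhd_chart(1) by blast
qed

section \<open>Collar coordinates\<close>

text \<open>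
  Sliding a chart along a transversal direction \<open>d\<close> gives coordinates \<open>(Q, T)\<close> of space in which the
  surface is the part \<open>Q $ 2 \<ge> 0\<close> of \<open>T = 0\<close>.
\<close>

lemma collar_coordinates:
  fixes d :: "real^3"
  assumes lp: "local_parametrization S V \<phi>" and q0: "q0 \<in> V" "q0 \<in> half_plane"
    and d: "d \<bullet> coord_normal \<phi> q0 \<noteq> 0"
  obtains R W Q T where "R > 0" "ball q0 R \<subseteq> V" "open W" "continuous_on W Q" "continuous_on W T"
    "\<And>y. y \<in> W \<Longrightarrow> Q y \<in> ball q0 R \<and> \<bar>T y\<bar> < R \<and> \<phi> (Q y) + T y *\<^sub>R d = y"
    "\<And>q t. q \<in> ball q0 R \<Longrightarrow> \<bar>t\<bar> < R \<Longrightarrow>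
       \<phi> q + t *\<^sub>R d \<in> W \<and> Q (\<phi> q + t *\<^sub>R d) = q \<and> T (\<phi> q + t *\<^sub>R d) = t"
    "\<And>y. y \<in> W \<Longrightarrow> y \<in> S \<longleftrightarrow> T y = 0 \<and> Q y \<in> half_plane"
    "\<And>q. q \<in> ball q0 R \<Longrightarrow> d \<bullet> coord_normal \<phi> q \<noteq> 0"
    "\<And>y. y \<in> W \<Longrightarrow>
       (T has_derivative (\<lambda>n. coord_normal \<phi> (Q y) \<bullet> n / (d \<bullet> coord_normal \<phi> (Q y)))) (at y)"
proof -
  note sm = local_parametrizationD(2)[OF lp]
  note opV = local_parametrizationD(1)[OF lp]
  \<comment> \<open>\<open>pr\<close> and \<open>em\<close> split space into the parameter plane and
    a line, so that the sliding map is a map from \<open>real^3\<close> to itself and the inverse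
    function theorem applies.\<close>
  define pr :: "real^3 \<Rightarrow> real^2" where "pr u = u$1 *\<^sub>R axis 1 1 + u$2 *\<^sub>R axis 2 1" for u
  define em :: "real^2 \<Rightarrow> real \<Rightarrow> real^3" where
    "em q t = q$1 *\<^sub>R axis 1 1 + q$2 *\<^sub>R axis 2 1 + t *\<^sub>R axis 3 1" for q t
  have pr_em [simp]: "pr (em q t) = q" "em q t $ 3 = t" for q t
    by (simp_all add: pr_def em_def vec_eq_iff forall_2 axis_def)
  have [simp]: "pr u $ 1 = u $ 1" "pr u $ 2 = u $ 2" for u by (simp_all add: pr_def axis_def)
  have em_pr: "em (pr u) (u$3) = u" for u
    by (simp add: pr_def em_def vec_eq_iff forall_3 axis_def)
  have prlin: "bounded_linear pr"
    unfolding pr_def by (intro bounded_linear_intros bounded_linear_compose[OF bounded_linear_scaleR_left] bounded_linear_vec_nth)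
  define F where "F u = \<phi> (pr u) + u$3 *\<^sub>R d" for u
  define V0 where "V0 = {q \<in> V. d \<bullet> coord_normal \<phi> q \<in> - {0}}"
  have contV: "continuous_on V (\<lambda>q. d \<bullet> coord_normal \<phi> q)"
    by (intro continuous_intros continuous_on_coord_normal[OF sm])
  have "open V0" unfolding V0_def
    using continuous_open_preimage[OF contV opV open_Compl[OF closed_singleton]] by (simp add: vimage_def Int_def)
  have q0V0: "q0 \<in> V0" using q0 d by (simp add: V0_def)
  define U where "U = pr -` V0"
  have "open U" unfolding U_def
    using open_vimage[OF \<open>open V0\<close>] linear_continuous_on[OF prlin] by blast
  \<comment> \<open>A sum of rank one operators: continuity in operator norm, which the inverse
    function theorem asks for, then reduces to continuity of the partial derivatives of
    \<phi>.\<close>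
  define F' where "F' u = (blinfun_scaleR_left (fderiv \<phi> (pr u) (axis 1 1)) o\<^sub>L blinfun_inner_right (axis 1 1 :: real^3))
     + (blinfun_scaleR_left (fderiv \<phi> (pr u) (axis 2 1)) o\<^sub>L blinfun_inner_right (axis 2 1 :: real^3))
     + (blinfun_scaleR_left d o\<^sub>L blinfun_inner_right (axis 3 1 :: real^3))" for u :: "real^3"
  have F'_apply: "blinfun_apply (F' u) w = fderiv \<phi> (pr u) (pr w) + w$3 *\<^sub>R d" if "pr u \<in> V" for u w
    unfolding linear_axis2[OF smooth_on_linear[OF sm that], of "pr w"]
    by (simp add: F'_def blinfun.add_left inner_axis')
  have dF: "(F has_derivative blinfun_apply (F' u)) (at u)" if "u \<in> U" for u
  proof -
    have prV: "pr u \<in> V" using that by (simp add: U_def V0_def)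
    have "(pr has_derivative pr) (at u)" using prlin by (rule bounded_linear_imp_has_derivative)
    then have "((\<lambda>u. \<phi> (pr u)) has_derivative (\<lambda>w. fderiv \<phi> (pr u) (pr w))) (at u)"
      by (rule has_derivative_compose[where f = pr and g = \<phi>]) (rule smooth_on_has_derivative[OF sm prV])
    then have "(F has_derivative (\<lambda>w. fderiv \<phi> (pr u) (pr w) + w$3 *\<^sub>R d)) (at u)"
      unfolding F_def
      by (intro has_derivative_add has_derivative_scaleR_left
          bounded_linear_imp_has_derivative[OF bounded_linear_vec_nth])
    moreover have "blinfun_apply (F' u) = (\<lambda>w. fderiv \<phi> (pr u) (pr w) + w$3 *\<^sub>R d)"
      using F'_apply[OF prV] by (rule ext)
    ultimately show ?thesis by simp
  qed
  have contF': "continuous_on U F'"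
  proof -
    have c: "continuous_on U (\<lambda>u. fderiv \<phi> (pr u) v)" for v
      using continuous_on_compose2[OF smooth_on_continuous[OF smooth_on_fderiv[OF sm]]
          linear_continuous_on[OF prlin], of U] by (auto simp: U_def V0_def)
    show ?thesis unfolding F'_def
      by (intro continuous_intros bounded_linear.continuous_on[OF bounded_linear_blinfun_scaleR_left] c)
  qed
  \<comment> \<open>Pairing with the normal cancels the tangential part and leaves the third
    coordinate. This gives injectivity of the derivative at \<open>x0\<close> and, at the end, the
    derivative of \<open>T\<close>.\<close>
  have height: "coord_normal \<phi> (pr u) \<bullet> blinfun_apply (F' u) w = w$3 * (d \<bullet> coord_normal \<phi> (pr u))"
    if "pr u \<in> V" for u w
    unfolding F'_apply[OF that] using coord_normal_orthogonal[OF sm that]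
    by (simp add: inner_right_distrib inner_commute)
  define x0 where "x0 = em q0 0"
  have x0: "x0 \<in> U" "pr x0 = q0" "F x0 = \<phi> q0" using q0V0 by (simp_all add: x0_def U_def F_def)
  have "inj (blinfun_apply (F' x0))"
  proof -
    have lin: "linear (blinfun_apply (F' x0))" by (simp add: blinfun.bounded_linear_right bounded_linear.linear)
    have "w = 0" if w: "blinfun_apply (F' x0) w = 0" for w
    proof -
      have prV: "pr x0 \<in> V" using x0 q0 by simp
      have "w$3 = 0" using height[OF prV, of w] w d x0 by simp
      then have "fderiv \<phi> q0 (pr w) = 0" using F'_apply[OF prV, of w] w x0 by simp
      then have "pr w = 0"
        using local_parametrizationD(3)[OF lp q0(1)] smooth_on_linear[OF sm q0(1)] linear_injective_0 by blast
      then show "w = 0" using em_pr[of w] \<open>w$3 = 0\<close> by (simp add: em_def)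
    qed
    then show ?thesis using linear_injective_0[OF lin] by blast
  qed
  then obtain G where G: "linear G" "G \<circ> blinfun_apply (F' x0) = id"
    using linear_injective_left_inverse blinfun.bounded_linear_right bounded_linear.linear by blast
  have "blinfun_apply (Blinfun G) = G"
    using bounded_linear_Blinfun_apply G(1) linear_conv_bounded_linear by blast
  then have inv: "Blinfun G o\<^sub>L F' x0 = id_blinfun"
    using G(2) by (intro blinfun_eqI) (simp add: fun_eq_iff)
  obtain U' V' g g' where IF: "open U'" "U' \<subseteq> U" "x0 \<in> U'" "open V'" "F x0 \<in> V'" "homeomorphism U' V' F g"
    "\<And>y. y \<in> V' \<Longrightarrow> (g has_derivative (g' y)) (at y)"
    "\<And>y. y \<in> V' \<Longrightarrow> g' y = Hilbert_Choice.inv (blinfun_apply (F' (g y)))"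
    "\<And>y. y \<in> V' \<Longrightarrow> bij (blinfun_apply (F' (g y)))"
    using inverse_function_theorem[OF \<open>open U\<close> dF contF' x0(1) inv] by blast
  \<comment> \<open>Product neighbourhoods, so that \<open>(Q, T)\<close> ranges over a full ball
    times a full interval.\<close>
  define box where "box R = {u. pr u \<in> ball q0 R \<and> \<bar>u$3\<bar> < R}" for R
  have box_mono: "box r \<subseteq> box R" if "r \<le> R" for r R using that by (auto simp: box_def)
  have box_open: "open (box R)" for R
  proof -
    have "open (pr -` ball q0 R \<inter> {u. u$3 \<in> {-R<..<R}})"
      by (intro open_Int open_vimage open_Collect_less open_vimage[unfolded vimage_def] open_greaterThanLessThan
          linear_continuous_on[OF prlin] continuous_intros open_ball)
    moreover have "box R = pr -` ball q0 R \<inter> {u. u$3 \<in> {-R<..<R}}" by (auto simp: box_def)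
    ultimately show ?thesis by simp
  qed
  have small: "\<exists>R>0. box R \<subseteq> B" if B: "open B" "x0 \<in> B" for B
  proof -
    obtain e where e: "e > 0" "ball x0 e \<subseteq> B" using B openE by blast
    have "box (e/2) \<subseteq> ball x0 e"
    proof
      fix u assume u: "u \<in> box (e/2)"
      have "u - x0 = em (pr u - q0) 0 + u$3 *\<^sub>R axis 3 1"
        using em_pr[of u] by (simp add: em_def x0_def vec_eq_iff forall_3 axis_def)
      moreover have "norm (em (pr u - q0) 0) = norm (pr u - q0)"
        by (simp add: norm_vec_def L2_set_def sum_2 sum_3 em_def axis_def)
      ultimately have "norm (u - x0) \<le> norm (pr u - q0) + \<bar>u$3\<bar>"
        by (metis norm_triangle_ineq norm_scaleR norm_axis_1 mult.right_neutral)
      then show "u \<in> ball x0 e" using u by (simp add: box_def dist_norm norm_minus_commute)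
    qed
    then show ?thesis using e by (intro exI[of _ "e/2"]) auto
  qed
  obtain R1 where R1: "R1 > 0" "box R1 \<subseteq> U'" using small IF(1,3) by blast
  have ballV: "ball q0 R1 \<subseteq> V0"
  proof
    fix q assume "q \<in> ball q0 R1"
    then have "em q 0 \<in> box R1" using R1(1) by (simp add: box_def)
    then have "em q 0 \<in> U" using R1(2) IF(2) by blast
    then show "q \<in> V0" by (simp add: U_def)
  qed
  have ballR: "q \<in> V0" if "q \<in> ball q0 R" "R \<le> R1" for q R
    using that ballV by (meson subsetD subset_ball)
  obtain Us gs where Us: "open Us" "homeomorphism (V \<inter> half_plane) (S \<inter> Us) \<phi> gs"
    using lp unfolding local_parametrization_def by blast
  have "\<phi> q0 \<in> S \<inter> Us" using Us(2) q0 unfolding homeomorphism_def by blast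
  have gsq0: "gs (\<phi> q0) = q0" using homeomorphism_apply1[OF Us(2)] q0 by blast
  have "continuous_on (S \<inter> Us) gs" using homeomorphism_cont2[OF Us(2)] .
  \<comment> \<open>Embeddedness enters here: another sheet of \<open>S\<close> could otherwise pass
    through the collar. Continuity of the inverse chart forces every point of \<open>S\<close> close
    to \<open>\<phi> q0\<close> to have its parameter close to \<open>q0\<close>.\<close>
  then obtain \<rho> where rho: "\<rho> > 0" "\<And>y. y \<in> S \<inter> Us \<Longrightarrow> dist y (\<phi> q0) < \<rho> \<Longrightarrow> dist (gs y) q0 < R1"
    using \<open>\<phi> q0 \<in> S \<inter> Us\<close> R1(1) gsq0 unfolding continuous_on_iff by metis
  have contF: "continuous_on U' F" using homeomorphism_cont1[OF IF(6)] .
  have "open {u \<in> U'. F u \<in> Us \<inter> ball (\<phi> q0) \<rho>}"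
    using continuous_open_preimage[OF contF IF(1) open_Int[OF Us(1) open_ball]]
    by (simp only: vimage_def Int_def mem_Collect_eq)
  moreover have "x0 \<in> {u \<in> U'. F u \<in> Us \<inter> ball (\<phi> q0) \<rho>}"
    using IF(3) x0 \<open>\<phi> q0 \<in> S \<inter> Us\<close> rho(1) by simp
  ultimately obtain R2 where R2: "R2 > 0" "box R2 \<subseteq> {u \<in> U'. F u \<in> Us \<inter> ball (\<phi> q0) \<rho>}"
    using small by blast
  define R where "R = min R1 R2"
  have R: "R > 0" "R \<le> R1" "R \<le> R2" using R1 R2 by (auto simp: R_def)
  have boxU: "box R \<subseteq> U'" using box_mono[OF R(2)] R1(2) by blast
  define W where "W = F ` box R"
  define Q where "Q = pr \<circ> g"
  define T where "T y = g y $ 3" for y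
  have Fem: "F (em q t) = \<phi> q + t *\<^sub>R d" for q t by (simp add: F_def)
  have gF: "g (F u) = u" if "u \<in> U'" for u using homeomorphism_apply1[OF IF(6) that] .
  have WV': "W \<subseteq> V'" using boxU homeomorphism_image1[OF IF(6)] unfolding W_def by blast
  have contg: "continuous_on V' g" using homeomorphism_cont2[OF IF(6)] .
  have "openin (top_of_set V') W"
    unfolding W_def using homeomorphism_imp_open_map[OF IF(6), of "box R"] boxU box_open
    by (metis open_openin_trans openin_open_eq IF(1))
  then have "open W" using IF(4) openin_open_eq by blast
  have Winv: "g y \<in> box R \<and> F (g y) = y" if "y \<in> W" for y
    using that boxU gF unfolding W_def by auto
  show thesis
  proof (rule that[of R W Q T])
    show "R > 0" by (rule R)
    show "ball q0 R \<subseteq> V" using ballR R(2) by (auto simp: V0_def)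
    show "open W" by fact
    show "continuous_on W Q" unfolding Q_def
      by (rule continuous_on_compose[OF continuous_on_subset[OF contg WV'] linear_continuous_on[OF prlin]])
    show "continuous_on W T" unfolding T_def
      by (intro continuous_intros continuous_on_subset[OF contg WV'])
    show "Q y \<in> ball q0 R \<and> \<bar>T y\<bar> < R \<and> \<phi> (Q y) + T y *\<^sub>R d = y" if "y \<in> W" for y
      using Winv[OF that] by (simp add: Q_def T_def box_def F_def)
    show "\<phi> q + t *\<^sub>R d \<in> W \<and> Q (\<phi> q + t *\<^sub>R d) = q \<and> T (\<phi> q + t *\<^sub>R d) = t"
      if "q \<in> ball q0 R" "\<bar>t\<bar> < R" for q t
    proof -
      have b: "em q t \<in> box R" using that by (simp add: box_def)
      then have "F (em q t) \<in> W" by (auto simp: W_def)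
      moreover have "g (F (em q t)) = em q t" using gF b boxU by blast
      ultimately show ?thesis by (simp add: Q_def T_def Fem)
    qed
    show "d \<bullet> coord_normal \<phi> q \<noteq> 0" if "q \<in> ball q0 R" for q
      using ballR[OF that R(2)] by (simp add: V0_def)
    show "y \<in> S \<longleftrightarrow> T y = 0 \<and> Q y \<in> half_plane" if y: "y \<in> W" for y
    proof
      assume "y \<in> S"
      have "F (g y) \<in> Us \<inter> ball (\<phi> q0) \<rho>" using Winv[OF y] box_mono[OF R(3)] R2(2) by blast
      then have yU: "y \<in> S \<inter> Us" "dist y (\<phi> q0) < \<rho>"
        using Winv[OF y] \<open>y \<in> S\<close> by (auto simp: dist_commute)
      then have "dist (gs y) q0 < R1" using rho(2) by blast
      then have "em (gs y) 0 \<in> box R1" using R1(1) by (simp add: box_def dist_commute)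
      \<comment> \<open>\<open>F\<close> is injective on \<open>U'\<close>, so the collar
        coordinates of a point of \<open>S\<close> are its chart parameter and height 0.\<close>
      then have "g (F (em (gs y) 0)) = em (gs y) 0" using gF R1(2) by blast
      moreover have "F (em (gs y) 0) = y"
        using homeomorphism_apply2[OF Us(2) yU(1)] by (simp add: Fem)
      ultimately have "g y = em (gs y) 0" by simp
      moreover have "gs y \<in> half_plane" using homeomorphism_image2[OF Us(2)] yU(1) by blast
      ultimately show "T y = 0 \<and> Q y \<in> half_plane" by (simp add: T_def Q_def)
    next
      assume a: "T y = 0 \<and> Q y \<in> half_plane"
      have "pr (g y) \<in> V" using Winv[OF y] ballR[OF _ R(2)] by (auto simp: box_def V0_def)
      then have "\<phi> (pr (g y)) \<in> S" using a local_parametrizationD(4)[OF lp] by (simp add: Q_def)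
      then show "y \<in> S" using Winv[OF y] a by (simp add: F_def T_def)
    qed
    show "(T has_derivative (\<lambda>n. coord_normal \<phi> (Q y) \<bullet> n / (d \<bullet> coord_normal \<phi> (Q y)))) (at y)"
      if y: "y \<in> W" for y
    proof -
      have yV': "y \<in> V'" using y WV' by blast
      have prV: "pr (g y) \<in> V0" using Winv[OF y] ballR[OF _ R(2)] by (auto simp: box_def)
      have "(T has_derivative (\<lambda>n. g' y n $ 3)) (at y)"
        unfolding T_def by (rule bounded_linear.has_derivative[OF bounded_linear_vec_nth IF(7)[OF yV']])
      moreover have "g' y n $ 3 = coord_normal \<phi> (Q y) \<bullet> n / (d \<bullet> coord_normal \<phi> (Q y))" for n
      proof -
        have "blinfun_apply (F' (g y)) (g' y n) = n"
          using IF(8,9)[OF yV'] by (simp add: bij_is_surj surj_f_inv_f)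
        then have "coord_normal \<phi> (Q y) \<bullet> n = g' y n $ 3 * (d \<bullet> coord_normal \<phi> (Q y))"
          using height[of "g y" "g' y n"] prV by (simp add: Q_def V0_def)
        then show ?thesis using prV by (simp add: Q_def V0_def)
      qed
      ultimately show ?thesis by simp
    qed
  qed
qed

text \<open>Both \<open>N\<close> and \<open>coord_normal\<close> are normal to the surface, so
  \<open>T\<close> has nonzero derivative along \<open>N\<close> at \<open>x\<close>. By continuity
  the sign \<kappa> of this derivative persists, and \<open>T\<close> is strictly monotone along all
  short normal segments based near \<open>x\<close>.\<close>

lemma collar_sign_along_normal:
  assumes gm: "gauss_map S N" and lp: "local_parametrization S V \<phi>" and V: "Q ` W \<subseteq> V"
    and W: "open W" "continuous_on W Q"
    and chart: "\<And>y. y \<in> W \<Longrightarrow> \<phi> (Q y) + T y *\<^sub>R d = y"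
    and S: "\<And>y. y \<in> W \<Longrightarrow> y \<in> S \<longleftrightarrow> T y = 0 \<and> Q y \<in> half_plane"
    and nz: "\<And>y. y \<in> W \<Longrightarrow> d \<bullet> coord_normal \<phi> (Q y) \<noteq> 0"
    and dT: "\<And>y. y \<in> W \<Longrightarrow>
       (T has_derivative (\<lambda>n. coord_normal \<phi> (Q y) \<bullet> n / (d \<bullet> coord_normal \<phi> (Q y)))) (at y)"
    and x: "x \<in> S" "x \<in> W"
  obtains r \<kappa> where "r > 0" "\<And>x' t. x' \<in> S \<Longrightarrow> dist x' x < r \<Longrightarrow> 0 < t \<Longrightarrow> t < r \<Longrightarrow>
      x' + t *\<^sub>R N x' \<in> W \<and> x' - t *\<^sub>R N x' \<in> W \<and>
      \<kappa> * T (x' + t *\<^sub>R N x') > 0 \<and> \<kappa> * T (x' - t *\<^sub>R N x') < (0::real)"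
proof -
  note sm = local_parametrizationD(2)[OF lp]
  have norm1: "norm (N y) = 1" if "y \<in> S" for y using gm that unfolding gauss_map_def by blast
  define K where "K y x' = coord_normal \<phi> (Q y) \<bullet> N x' / (d \<bullet> coord_normal \<phi> (Q y))" for y x'
  have contnu: "continuous_on W (\<lambda>y. coord_normal \<phi> (Q y))"
    by (rule continuous_on_compose2[OF continuous_on_coord_normal[OF sm] W(2) V])
  have contN: "continuous_on S N" using gm unfolding gauss_map_def by blast
  \<comment> \<open>The point of evaluation and the foot of the normal are independent variables, so
    that one radius serves all feet near \<open>x\<close>.\<close>
  have contK: "continuous_on (W \<times> S) (\<lambda>p. K (fst p) (snd p))"
    unfolding K_def
    by (intro continuous_intros continuous_on_compose2[OF contnu, of _ fst] continuous_on_compose2[OF contN, of _ snd])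
      (use nz in auto)
  have qV: "Q x \<in> V" "Q x \<in> half_plane" and fx: "\<phi> (Q x) = x"
    using x V S[OF x(2)] chart[OF x(2)] by auto
  have "coord_normal \<phi> (Q x) \<bullet> N x \<noteq> 0"
  proof
    assume z: "coord_normal \<phi> (Q x) \<bullet> N x = 0"
    have "N x \<noteq> 0" using norm1[OF x(1)] by auto
    then have "range (fderiv \<phi> (Q x)) = {u. N x \<bullet> u = 0}"
      using range_fderiv_eq_normal_complement[OF sm qV(1) local_parametrizationD(3)[OF lp qV(1)]]
        gauss_map_orthogonal[OF gm lp qV] fx by simp
    moreover have "N x \<bullet> coord_normal \<phi> (Q x) = 0" using z by (simp add: inner_commute)
    ultimately obtain w where "coord_normal \<phi> (Q x) = fderiv \<phi> (Q x) w" by blast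
    then have "coord_normal \<phi> (Q x) \<bullet> coord_normal \<phi> (Q x) = 0"
      using coord_normal_orthogonal[OF sm qV(1), of w] by simp
    then show False using coord_normal_nonzero[OF sm qV(1) local_parametrizationD(3)[OF lp qV(1)]] by simp
  qed
  then have Kx: "K x x \<noteq> 0" using nz[OF x(2)] by (simp add: K_def)
  define \<kappa> where "\<kappa> = sgn (K x x)"
  have "\<bar>K x x\<bar> > 0" using Kx by simp
  then obtain e where e: "e > 0" "\<And>p. p \<in> W \<times> S \<Longrightarrow> dist p (x, x) < e \<Longrightarrow> dist (K (fst p) (snd p)) (K x x) < \<bar>K x x\<bar>"
    using contK x unfolding continuous_on_iff by (metis SigmaI fst_conv snd_conv)
  have pos: "\<kappa> * K y x' > 0" if "y \<in> W" "x' \<in> S" "dist y x < e/2" "dist x' x < e/2" for y x'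
  proof -
    have "dist (y, x') (x, x) \<le> dist y x + dist x' x"
      by (simp add: dist_Pair_Pair sqrt_sum_squares_le_sum)
    then have "dist (K y x') (K x x) < \<bar>K x x\<bar>" using e(2)[of "(y, x')"] that by simp
    then show ?thesis by (auto simp: \<kappa>_def sgn_if dist_real_def split: if_splits)
  qed
  obtain \<rho> where rho: "\<rho> > 0" "ball x \<rho> \<subseteq> W" using W(1) x(2) openE by blast
  \<comment> \<open>Points of the normal segments lie within \<open>2 * r\<close> of
    \<open>x\<close>, that is, within \<open>e/2\<close> and inside \<open>W\<close>.\<close>
  define r where "r = min (e/4) (\<rho>/2)"
  have r: "r > 0" using e rho by (simp add: r_def)
  show thesis
  proof (rule that[OF r, where \<kappa> = \<kappa>])
    fix x' t assume x': "x' \<in> S" "dist x' x < r" and t: "0 < t" "t < r"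
    have near: "dist (x' + s *\<^sub>R N x') x < 2 * r" if "\<bar>s\<bar> < r" for s
    proof -
      have "dist (x' + s *\<^sub>R N x') x \<le> dist (x' + s *\<^sub>R N x') x' + dist x' x" by (rule dist_triangle)
      then show ?thesis using that x' norm1[OF x'(1)] by (simp add: dist_norm)
    qed
    have inW: "x' + s *\<^sub>R N x' \<in> W" if "\<bar>s\<bar> < r" for s
    proof -
      have "dist x (x' + s *\<^sub>R N x') < \<rho>" using near[OF that] by (simp add: r_def dist_commute)
      then show ?thesis using rho(2) by auto
    qed
    have der: "((\<lambda>s. \<kappa> * T (x' + s *\<^sub>R N x')) has_real_derivative \<kappa> * K (x' + s *\<^sub>R N x') x') (at s)"
      if "\<bar>s\<bar> < r" for s
    proof -
      have "((\<lambda>s. x' + s *\<^sub>R N x') has_derivative (\<lambda>s. s *\<^sub>R N x')) (at s)"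
        by (auto intro!: derivative_eq_intros)
      from has_derivative_compose[OF this dT[OF inW[OF that]]]
      have "((\<lambda>s. T (x' + s *\<^sub>R N x')) has_real_derivative K (x' + s *\<^sub>R N x') x') (at s)"
        unfolding has_field_derivative_def
        by (rule has_derivative_eq_rhs) (simp add: K_def fun_eq_iff)
      then show ?thesis by (rule DERIV_cmult)
    qed
    have pos': "\<kappa> * K (x' + s *\<^sub>R N x') x' > 0" if "\<bar>s\<bar> < r" for s
      using pos[OF inW[OF that] x'(1)] near[OF that] x'(2) r by (simp add: r_def)
    have ex: "\<exists>D. ((\<lambda>s. \<kappa> * T (x' + s *\<^sub>R N x')) has_real_derivative D) (at s) \<and> D > 0" if "\<bar>s\<bar> < r" for s
      using der[OF that] pos'[OF that] by blast
    have "T x' = 0" using S[of x'] inW[of 0] x' r by simp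
    moreover have "\<kappa> * T (x' + 0 *\<^sub>R N x') < \<kappa> * T (x' + t *\<^sub>R N x')"
      by (rule DERIV_pos_imp_increasing[OF t(1)], rule ex) (use t in simp)
    moreover have "\<kappa> * T (x' + (-t) *\<^sub>R N x') < \<kappa> * T (x' + 0 *\<^sub>R N x')"
      by (rule DERIV_pos_imp_increasing[of "-t" 0], use t in simp, rule ex) (use t in simp)
    ultimately show "x' + t *\<^sub>R N x' \<in> W \<and> x' - t *\<^sub>R N x' \<in> W \<and>
      \<kappa> * T (x' + t *\<^sub>R N x') > 0 \<and> \<kappa> * T (x' - t *\<^sub>R N x') < 0"
      using inW[of t] inW[of "-t"] t by simp
  qed
qed

text \<open>The first order condition for the squared distance makes \<open>y - x'\<close>
  orthogonal to the tangent plane. It is an equation, rather than a one-sided inequality, because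
  the foot is an interior point.\<close>

lemma nearest_point_on_normal:
  assumes gm: "gauss_map S N" and es: "embedded_surface S" and x': "x' \<in> surface_interior S"
    and near: "\<And>z. z \<in> S \<Longrightarrow> dist y x' \<le> dist y z"
  shows "y = x' + dist y x' *\<^sub>R N x' \<or> y = x' - dist y x' *\<^sub>R N x'"
proof -
  obtain V \<phi> q where lp: "local_parametrization S V \<phi>" and q: "q \<in> V" "q $ 2 > 0" "\<phi> q = x'"
    using interior_chart[OF es x'] .
  note sm = local_parametrizationD(2)[OF lp]
  have qH: "q \<in> half_plane" using q by (simp add: half_plane_def)
  have x'S: "x' \<in> S" using x' by (simp add: surface_interior_def)
  define n where "n = N x'"
  have n1: "norm n = 1" using gm x'S unfolding gauss_map_def n_def by blast
  define B where "B = V \<inter> {x. x $ 2 > 0}"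
  have B: "open B" "q \<in> B" unfolding B_def
    using q local_parametrizationD(1)[OF lp] by (auto intro!: open_Int open_halfspace_component_gt_cart)
  have "((\<lambda>x. (y - \<phi> x) \<bullet> (y - \<phi> x)) has_derivative
     (\<lambda>w. (y - \<phi> q) \<bullet> (- fderiv \<phi> q w) + (- fderiv \<phi> q w) \<bullet> (y - \<phi> q))) (at q)"
    using smooth_on_has_derivative[OF sm q(1)]
    by (intro has_derivative_inner) (auto intro!: derivative_eq_intros)
  moreover have "eventually (\<lambda>x. (y - \<phi> q) \<bullet> (y - \<phi> q) \<le> (y - \<phi> x) \<bullet> (y - \<phi> x)) (at q)"
  proof -
    have "(y - \<phi> q) \<bullet> (y - \<phi> q) \<le> (y - \<phi> x) \<bullet> (y - \<phi> x)" if "x \<in> B" for x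
    proof -
      have "\<phi> x \<in> S" using that local_parametrizationD(4)[OF lp] by (auto simp: B_def half_plane_def)
      then have "norm (y - x') \<le> norm (y - \<phi> x)" using near by (simp add: dist_norm)
      then show ?thesis using q(3) by (simp add: norm_le)
    qed
    then show ?thesis using B eventually_at_topological by blast
  qed
  ultimately have "(\<lambda>w. (y - \<phi> q) \<bullet> (- fderiv \<phi> q w) + (- fderiv \<phi> q w) \<bullet> (y - \<phi> q)) = (\<lambda>w. 0)"
    by (rule has_derivative_local_min)
  then have "(y - \<phi> q) \<bullet> (- fderiv \<phi> q w) + (- fderiv \<phi> q w) \<bullet> (y - \<phi> q) = 0" for w
    by (rule fun_cong)
  then have orth: "(y - x') \<bullet> fderiv \<phi> q w = 0" for w
    using q(3) by (simp add: inner_commute)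
  define c where "c = (y - x') \<bullet> n"
  have "n \<noteq> 0" using n1 by auto
  then have rng: "range (fderiv \<phi> q) = {u. n \<bullet> u = 0}"
    using range_fderiv_eq_normal_complement[OF sm q(1) local_parametrizationD(3)[OF lp q(1)]]
      gauss_map_orthogonal[OF gm lp q(1) qH] q(3) by (simp add: n_def)
  have nn: "n \<bullet> n = 1" using n1 by (simp add: dot_square_norm)
  have "n \<bullet> (y - x' - c *\<^sub>R n) = 0" using nn by (simp add: c_def inner_diff_right inner_commute)
  then obtain w where w: "y - x' - c *\<^sub>R n = fderiv \<phi> q w" using rng by blast
  have "(y - x' - c *\<^sub>R n) \<bullet> (y - x' - c *\<^sub>R n) = (y - x') \<bullet> (y - x' - c *\<^sub>R n) - c * (n \<bullet> (y - x' - c *\<^sub>R n))"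
    by (simp add: inner_diff_left)
  also have "\<dots> = 0" using \<open>n \<bullet> (y - x' - c *\<^sub>R n) = 0\<close> orth[of w] w by simp
  finally have eq: "y - x' = c *\<^sub>R n" by simp
  then have "dist y x' = \<bar>c\<bar>" using n1 by (simp add: dist_norm)
  moreover have "y = x' + c *\<^sub>R n" using eq by (simp add: algebra_simps)
  ultimately show ?thesis by (cases "c \<ge> 0") (simp_all add: n_def)
qed

section \<open>The Jordan curve in its plane\<close>

locale plane_domain =
  fixes a :: "real^3" and b :: real and P \<Gamma> D :: "(real^3) set"
  assumes a: "a \<noteq> 0" and P_def: "P = {x. a \<bullet> x = b}"
    and jordan: "jordan_curve \<Gamma>" and \<Gamma>P: "\<Gamma> \<subseteq> P" and dom: "domain_bounded_by P \<Gamma> D"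
begin

lemma closed_P: "closed P"
  unfolding P_def by (rule closed_hyperplane)

lemma D_subset: "D \<subseteq> P - \<Gamma>" and D_connected: "connected D" and D_nonempty: "D \<noteq> {}"
  and D_bounded: "bounded D"
  using dom in_components_subset[of D "P - \<Gamma>"] in_components_connected[of D "P - \<Gamma>"]
    in_components_nonempty[of D "P - \<Gamma>"]
  unfolding domain_bounded_by_def by blast+

lemma D_maximal:
  assumes "connected A" "A \<subseteq> P - \<Gamma>" "A \<inter> D \<noteq> {}"
  shows "A \<subseteq> D"
  using components_maximal[of D "P - \<Gamma>" A] dom assms unfolding domain_bounded_by_def by blast

text \<open>The Jordan curve theorem is transported from the complex plane by a homeomorphism; what
  remains is to identify the bounded component \<open>D\<close> with the inside of the image
  curve.\<close>

lemma jordan_domain: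
  shows closure_D: "closure D = D \<union> \<Gamma>"
    and \<Gamma>_subset_closure_exterior: "\<Gamma> \<subseteq> closure (P - \<Gamma> - D)"
    and closed_P_minus_D: "closed (P - D)"
    and \<Gamma>_nonempty: "\<Gamma> \<noteq> {}"
proof -
  obtain \<gamma> where \<gamma>: "simple_path \<gamma>" "pathfinish \<gamma> = pathstart \<gamma>" "path_image \<gamma> = \<Gamma>"
    using jordan unfolding jordan_curve_def by blast
  show "\<Gamma> \<noteq> {}" using path_image_nonempty \<gamma> by blast
  have "aff_dim P = 2" unfolding P_def using aff_dim_hyperplane[OF a] by simp
  moreover have "aff_dim (UNIV :: complex set) = 2" by simp
  ultimately have "P homeomorphic (UNIV :: complex set)"
    using homeomorphic_affine_sets[of P "UNIV :: complex set"] affine_hyperplane[of a b] by (simp add: P_def)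
  then obtain f g where h: "homeomorphism P (UNIV :: complex set) f g" unfolding homeomorphic_def by blast
  note hom = homeomorphism_cont1[OF h] homeomorphism_cont2[OF h]
  have gf: "g (f x) = x" if "x \<in> P" for x using homeomorphism_apply1[OF h that] .
  have fg: "f (g z) = z" for z using homeomorphism_apply2[OF h] by simp
  have gP: "g z \<in> P" for z using homeomorphism_image2[OF h] by blast
  define C where "C = f ` \<Gamma>"
  have C: "C = path_image (f \<circ> \<gamma>)" using \<gamma>(3) by (simp add: C_def path_image_compose)
  have "simple_path (f \<circ> \<gamma>)"
  proof (rule simple_path_continuous_image[OF \<gamma>(1)])
    show "continuous_on (path_image \<gamma>) f" using continuous_on_subset[OF hom(1)] \<Gamma>P \<gamma>(3) by blast
    show "inj_on f (path_image \<gamma>)"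
      by (rule inj_on_inverseI[of _ g]) (use gf \<Gamma>P \<gamma>(3) in blast)
  qed
  moreover have "pathfinish (f \<circ> \<gamma>) = pathstart (f \<circ> \<gamma>)"
    using \<gamma>(2) by (simp add: pathfinish_compose pathstart_compose)
  ultimately have J: "inside C \<noteq> {}" "connected (inside C)" "connected (outside C)" "open (inside C)"
     "\<not> bounded (outside C)" "inside C \<inter> outside C = {}" "inside C \<union> outside C = - C"
     "frontier (inside C) = C" "frontier (outside C) = C"
    using Jordan_inside_outside[of "f \<circ> \<gamma>"] unfolding C by blast+
  have gC: "g z \<in> \<Gamma> \<longleftrightarrow> z \<in> C" for z
  proof
    show "g z \<in> \<Gamma> \<Longrightarrow> z \<in> C" using fg unfolding C_def by (metis imageI)
    show "z \<in> C \<Longrightarrow> g z \<in> \<Gamma>" using gf \<Gamma>P unfolding C_def by auto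
  qed
  have conng: "connected (g ` A)" if "connected A" for A
    using connected_continuous_image[OF continuous_on_subset[OF hom(2)] that] by blast
  have fD: "connected (f ` D)"
    using connected_continuous_image[OF continuous_on_subset[OF hom(1)] D_connected] D_subset by blast
  have fDC: "f ` D \<subseteq> - C"
  proof clarify
    fix x assume "x \<in> D" "f x \<in> C"
    then show False using gC[of "f x"] gf D_subset by auto
  qed
  \<comment> \<open>A homeomorphism alone does not control bounds; the compactness of
    \<open>closure D\<close> does.\<close>
  have "bounded (f ` D)"
  proof -
    have "closure D \<subseteq> P" using D_subset closed_P by (metis Diff_subset closure_minimal subset_trans)
    then have "compact (f ` closure D)"
      using compact_continuous_image[OF continuous_on_subset[OF hom(1)]] D_bounded compact_closure by blast
    then show ?thesis using compact_imp_bounded bounded_subset closure_subset image_mono by metis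
  qed
  \<comment> \<open>Maximality of the component \<open>D\<close>, seen in the complex plane. Applied
    to the outside it would make the image of \<open>D\<close> unbounded; applied to the inside it
    gives equality.\<close>
  have meets: "A \<subseteq> f ` D" if A: "connected A" "A \<subseteq> - C" "A \<inter> f ` D \<noteq> {}" for A
  proof -
    have "g ` A \<subseteq> D"
    proof (rule D_maximal[OF conng[OF A(1)]])
      show "g ` A \<subseteq> P - \<Gamma>" using A(2) gP gC by auto
      obtain x where "x \<in> D" "f x \<in> A" using A(3) by auto
      then have "g (f x) \<in> g ` A \<inter> D" using gf D_subset by auto
      then show "g ` A \<inter> D \<noteq> {}" by blast
    qed
    then show ?thesis using fg by (metis image_subset_iff image_eqI subsetI)
  qed
  have "f ` D \<inter> outside C = {}"
  proof (rule ccontr)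
    assume "f ` D \<inter> outside C \<noteq> {}"
    then have "outside C \<subseteq> f ` D" using meets[OF J(3)] J(7) by blast
    then show False using \<open>bounded (f ` D)\<close> bounded_subset J(5) by blast
  qed
  then have "f ` D \<subseteq> inside C" using fDC J(7) by blast
  moreover have "inside C \<subseteq> f ` D"
    using meets[OF J(2)] J(7) \<open>f ` D \<subseteq> inside C\<close> D_nonempty by blast
  ultimately have fDin: "f ` D = inside C" by blast
  have D: "D = g ` inside C"
    unfolding fDin[symmetric] image_image using gf D_subset by force
  have gCim: "g ` C = \<Gamma>" unfolding C_def image_image using gf \<Gamma>P by force
  have clin: "closure (inside C) = inside C \<union> C" using closure_Un_frontier[of "inside C"] J(8) by simp
  have clout: "closure (outside C) = outside C \<union> C" using closure_Un_frontier[of "outside C"] J(9) by simp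
  have image_cl: "g ` closure A \<subseteq> closure (g ` A)" for A
    by (rule image_closure_subset[OF continuous_on_subset[OF hom(2)]]) (auto simp: closure_subset)
  show "closure D = D \<union> \<Gamma>"
  proof
    have "bounded (inside C)" using \<open>bounded (f ` D)\<close> fDin by simp
    then have "compact (g ` closure (inside C))"
      using compact_continuous_image[OF continuous_on_subset[OF hom(2)]] compact_closure by blast
    then have "closed (D \<union> \<Gamma>)" unfolding clin image_Un D[symmetric] gCim by (rule compact_imp_closed)
    then show "closure D \<subseteq> D \<union> \<Gamma>" by (simp add: closure_minimal)
    show "D \<union> \<Gamma> \<subseteq> closure D"
      using image_cl[of "inside C"] unfolding clin image_Un D[symmetric] gCim .
  qed
  have ext: "P - \<Gamma> - D = g ` outside C"
  proof
    show "P - \<Gamma> - D \<subseteq> g ` outside C"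
    proof
      fix x assume x: "x \<in> P - \<Gamma> - D"
      then have "f x \<notin> C" using gC[of "f x"] gf by auto
      moreover have "f x \<notin> inside C" using x D gf by (metis DiffD1 DiffD2 imageI)
      ultimately have "f x \<in> outside C" using J(7) by blast
      then show "x \<in> g ` outside C" using x gf by (metis DiffD1 imageI)
    qed
    show "g ` outside C \<subseteq> P - \<Gamma> - D"
    proof clarify
      fix z assume z: "z \<in> outside C"
      have "g z \<notin> D" using z J(6) fDin fg by (metis IntI empty_iff imageI)
      then show "g z \<in> P - \<Gamma> - D" using gP gC z J(7) by blast
    qed
  qed
  show "\<Gamma> \<subseteq> closure (P - \<Gamma> - D)"
    using image_cl[of "outside C"] unfolding clout image_Un ext[symmetric] gCim by blast
  have "x \<in> D \<longleftrightarrow> f x \<in> inside C" if "x \<in> P" for x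
  proof
    show "x \<in> D \<Longrightarrow> f x \<in> inside C" using fDin by blast
    assume "f x \<in> inside C"
    then have "g (f x) \<in> D" unfolding D by (rule imageI)
    then show "x \<in> D" using gf[OF that] by simp
  qed
  then have "P - D = P \<inter> f -` (- inside C)" by auto
  then show "closed (P - D)"
    using continuous_closed_preimage[OF hom(1) closed_P closed_Compl[OF J(4)]] by simp
qed

text \<open>Every neighbourhood of a point of \<Gamma> meets both \<open>D\<close> and the exterior,
  and neither of two connected pieces can meet both. So it suffices to exhibit the two pieces of
  \<open>P\<close> near \<Gamma> to know which of them belongs to \<open>P - D\<close>, up to
  exchanging them.\<close>

lemma local_sides:
  assumes x: "x \<in> \<Gamma>" "open W" "x \<in> W" and AB: "connected A" "connected B" "P \<inter> W - \<Gamma> = A \<union> B"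
  shows "(A \<subseteq> D \<and> B \<inter> D = {}) \<or> (B \<subseteq> D \<and> A \<inter> D = {})"
proof -
  have A: "A \<subseteq> D \<or> A \<inter> D = {}" and B: "B \<subseteq> D \<or> B \<inter> D = {}"
    using D_maximal AB by blast+
  have "W \<inter> D \<noteq> {}" using x closure_D closure_iff_nhds_not_empty by (metis Int_commute UnI2 subset_refl)
  moreover have "W \<inter> D \<subseteq> A \<union> B" unfolding AB(3)[symmetric] using D_subset by auto
  ultimately have "A \<inter> D \<noteq> {} \<or> B \<inter> D \<noteq> {}" by auto
  have "W \<inter> (P - \<Gamma> - D) \<noteq> {}"
    using x \<Gamma>_subset_closure_exterior open_Int_closure_eq_empty[OF x(2), of "P - \<Gamma> - D"] by auto
  moreover have "W \<inter> (P - \<Gamma> - D) \<subseteq> (A \<union> B) - D" unfolding AB(3)[symmetric] by auto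
  ultimately have "\<not> A \<subseteq> D \<or> \<not> B \<subseteq> D" by auto
  then show ?thesis using A B \<open>A \<inter> D \<noteq> {} \<or> B \<inter> D \<noteq> {}\<close> by argo
qed

text \<open>An open half of \<open>O'\<close> stays connected when points of its closure are added,
  here all of \<open>O' \<inter> P - \<Gamma>\<close>. The two enlarged halves share a point of
  \<open>P\<close> off \<Gamma>, which exists because \<Gamma> lies in the closure of
  \<open>D\<close>.\<close>

lemma connected_minus_\<Gamma>:
  assumes "convex O'" "open O'"
  shows "connected (O' - \<Gamma>)"
proof (cases "O' \<inter> P = {}")
  case True
  then have "O' - \<Gamma> = O'" using \<Gamma>P by blast
  then show ?thesis using assms(1) convex_connected by simp
next
  case False
  then obtain y where y: "y \<in> O'" "y \<in> P" by blast
  have "\<exists>y0. y0 \<in> O' \<inter> P - \<Gamma>"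
  proof (cases "y \<in> \<Gamma>")
    case True
    then have "O' \<inter> D \<noteq> {}"
      using y assms closure_D closure_iff_nhds_not_empty by (metis Int_commute UnI2 subset_refl)
    then show ?thesis using D_subset by blast
  qed (use y in blast)
  then obtain y0 where y0: "y0 \<in> O' \<inter> P - \<Gamma>" by blast
  have side: "connected ((O' \<inter> {x. \<sigma> * (a \<bullet> x) < \<sigma> * b}) \<union> (O' \<inter> P - \<Gamma>))" if \<sigma>: "\<sigma> = 1 \<or> \<sigma> = -1" for \<sigma> :: real
  proof (rule connected_intermediate_closure)
    have "{x. \<sigma> * (a \<bullet> x) < \<sigma> * b} = {x. (\<sigma> *\<^sub>R a) \<bullet> x < \<sigma> * b}" by simp
    then show "connected (O' \<inter> {x. \<sigma> * (a \<bullet> x) < \<sigma> * b})"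
      using convex_connected convex_Int[OF assms(1) convex_halfspace_lt] by metis
    show "(O' \<inter> {x. \<sigma> * (a \<bullet> x) < \<sigma> * b}) \<subseteq> (O' \<inter> {x. \<sigma> * (a \<bullet> x) < \<sigma> * b}) \<union> (O' \<inter> P - \<Gamma>)" by blast
    have "z \<in> closure (O' \<inter> {x. \<sigma> * (a \<bullet> x) < \<sigma> * b})" if z: "z \<in> O'" "z \<in> P" for z
      unfolding closure_approachable
    proof (intro allI impI)
      fix e :: real assume e: "e > 0"
      obtain r where r: "r > 0" "ball z r \<subseteq> O'" using assms(2) z(1) openE by blast
      define t where "t = min e r / 2 / norm a"
      have t: "t > 0" "t * norm a < e" "t * norm a < r" using e r a by (auto simp: t_def)
      have dz: "dist (z - (\<sigma> * t) *\<^sub>R a) z = t * norm a"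
        using \<sigma> t by (auto simp: dist_norm)
      then have "z - (\<sigma> * t) *\<^sub>R a \<in> O'" using r(2) t by (auto simp: dist_commute subset_eq)
      moreover have "\<sigma> * (a \<bullet> (z - (\<sigma> * t) *\<^sub>R a)) < \<sigma> * b"
      proof -
        have "\<sigma> * \<sigma> = 1" using \<sigma> by auto
        have "a \<bullet> a > 0" using a by simp
        then have "t * (a \<bullet> a) > 0" using t by simp
        moreover have "\<sigma> * (a \<bullet> (z - (\<sigma> * t) *\<^sub>R a)) = \<sigma> * b - (\<sigma> * \<sigma>) * (t * (a \<bullet> a))"
          using z(2) by (simp add: P_def inner_diff_right algebra_simps)
        ultimately show ?thesis using \<open>\<sigma> * \<sigma> = 1\<close> by simp
      qed
      ultimately show "\<exists>y \<in> O' \<inter> {x. \<sigma> * (a \<bullet> x) < \<sigma> * b}. dist y z < e" using dz t(2) by (intro bexI[of _ "z - (\<sigma> * t) *\<^sub>R a"]) auto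
    qed
    then show "(O' \<inter> {x. \<sigma> * (a \<bullet> x) < \<sigma> * b}) \<union> (O' \<inter> P - \<Gamma>) \<subseteq> closure (O' \<inter> {x. \<sigma> * (a \<bullet> x) < \<sigma> * b})"
      by (intro Un_least closure_subset subsetI) simp
  qed
  have "O' - \<Gamma> = ((O' \<inter> {x. 1 * (a \<bullet> x) < 1 * b}) \<union> (O' \<inter> P - \<Gamma>)) \<union>
     ((O' \<inter> {x. -1 * (a \<bullet> x) < -1 * b}) \<union> (O' \<inter> P - \<Gamma>))"
    using \<Gamma>P by (auto simp: P_def)
  moreover have "connected \<dots>"
    by (rule connected_Un[OF side side]) (use y0 in auto)
  ultimately show ?thesis by metis
qed

text \<open>Moving far in a direction \<open>u\<close> orthogonal to \<open>a\<close> keeps the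
  \<open>u\<close>-component large along the entire vertical line, so the line avoids any prescribed
  ball.\<close>

lemma far_exterior_point:
  obtains z where "z \<in> P - \<Gamma> - D" "\<And>t. norm (z + t *\<^sub>R a) > R"
proof -
  obtain B where B: "\<And>x. x \<in> closure D \<Longrightarrow> norm x \<le> B"
    using bounded_closure[OF D_bounded] unfolding bounded_iff by auto
  obtain u where u: "norm u = 1" "a \<bullet> u = 0"
  proof -
    obtain w where w: "w \<noteq> 0" "orthogonal a w"
      using orthogonal_to_vector_exists[of a] by auto
    then show thesis using that[of "sgn w"] by (simp add: norm_sgn sgn_div_norm orthogonal_def)
  qed
  \<comment> \<open>\<open>B\<close> keeps the point off \<open>closure D\<close>,
    \<open>\<bar>R\<bar>\<close> keeps the line out of the ball, and the 1 makes both
    strict.\<close>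
  define s where "s = max B \<bar>R\<bar> + 1"
  define z where "z = (b / (a \<bullet> a)) *\<^sub>R a + s *\<^sub>R u"
  have "a \<bullet> a \<noteq> 0" using a by simp
  have big: "norm (z + t *\<^sub>R a) \<ge> s" for t
  proof -
    have "(z + t *\<^sub>R a) \<bullet> u = s" using u by (simp add: z_def inner_add_left dot_square_norm)
    then show ?thesis using Cauchy_Schwarz_ineq2[of "z + t *\<^sub>R a" u] u(1) by simp
  qed
  have "z \<notin> closure D" using B[of z] big[of 0] by (auto simp: s_def)
  moreover have "z \<in> P" using u \<open>a \<bullet> a \<noteq> 0\<close> by (simp add: P_def z_def inner_add_right)
  ultimately have "z \<in> P - \<Gamma> - D" using closure_D by blast
  moreover have "norm (z + t *\<^sub>R a) > R" for t using big[of t] by (simp add: s_def)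
  ultimately show thesis by (rule that)
qed

end

section \<open>Side functions\<close>

text \<open>The conclusions of \<open>collar_coordinates\<close> in interpretable form; each use
  chooses a direction \<open>d\<close> adapted to the position of \<open>P\<close>.\<close>

locale collar =
  fixes S :: "(real^3) set" and V \<phi> q0 and d :: "real^3" and R W Q T
  assumes chart: "local_parametrization S V \<phi>"
    and R_pos: "R > 0" and ball_V: "ball q0 R \<subseteq> V"
    and open_W: "open W" and cont_Q: "continuous_on W Q" and cont_T: "continuous_on W T"
    and Q_ball: "y \<in> W \<Longrightarrow> Q y \<in> ball q0 R" and T_bound: "y \<in> W \<Longrightarrow> \<bar>T y\<bar> < R"
    and QT: "y \<in> W \<Longrightarrow> \<phi> (Q y) + T y *\<^sub>R d = y"
    and in_W: "q \<in> ball q0 R \<Longrightarrow> \<bar>t\<bar> < R \<Longrightarrow> \<phi> q + t *\<^sub>R d \<in> W"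
    and Q_eq: "q \<in> ball q0 R \<Longrightarrow> \<bar>t\<bar> < R \<Longrightarrow> Q (\<phi> q + t *\<^sub>R d) = q"
    and T_eq: "q \<in> ball q0 R \<Longrightarrow> \<bar>t\<bar> < R \<Longrightarrow> T (\<phi> q + t *\<^sub>R d) = t"
    and S_iff: "y \<in> W \<Longrightarrow> y \<in> S \<longleftrightarrow> T y = 0 \<and> Q y $ 2 \<ge> 0"
    and transversal: "q \<in> ball q0 R \<Longrightarrow> d \<bullet> coord_normal \<phi> q \<noteq> 0"
    and deriv_T: "y \<in> W \<Longrightarrow>
       (T has_derivative (\<lambda>n. coord_normal \<phi> (Q y) \<bullet> n / (d \<bullet> coord_normal \<phi> (Q y)))) (at y)"
begin

lemma center: "\<phi> q0 \<in> W" "Q (\<phi> q0) = q0" "T (\<phi> q0) = 0"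
  using in_W[of q0 0] Q_eq[of q0 0] T_eq[of q0 0] R_pos by auto

lemma sign_along_normal:
  assumes "gauss_map S N" "x \<in> S" "x \<in> W"
  obtains r \<kappa> where "r > 0" "\<And>x' t. x' \<in> S \<Longrightarrow> dist x' x < r \<Longrightarrow> 0 < t \<Longrightarrow> t < r \<Longrightarrow>
      x' + t *\<^sub>R N x' \<in> W \<and> x' - t *\<^sub>R N x' \<in> W \<and>
      \<kappa> * T (x' + t *\<^sub>R N x') > 0 \<and> \<kappa> * T (x' - t *\<^sub>R N x') < (0::real)"
proof (rule collar_sign_along_normal[OF assms(1) chart _ open_W cont_Q QT _ _ deriv_T assms(2,3)])
  show "Q ` W \<subseteq> V" using Q_ball ball_V by blast
  show "\<And>y. y \<in> W \<Longrightarrow> (y \<in> S) = (T y = 0 \<and> Q y \<in> half_plane)" using S_iff by (simp add: half_plane_def)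
  show "\<And>y. y \<in> W \<Longrightarrow> d \<bullet> coord_normal \<phi> (Q y) \<noteq> 0" using transversal Q_ball by blast
  fix r \<kappa> assume "r > 0" "\<And>x' t. x' \<in> S \<Longrightarrow> dist x' x < r \<Longrightarrow> 0 < t \<Longrightarrow> t < r \<Longrightarrow>
      x' + t *\<^sub>R N x' \<in> W \<and> x' - t *\<^sub>R N x' \<in> W \<and>
      \<kappa> * T (x' + t *\<^sub>R N x') > 0 \<and> \<kappa> * T (x' - t *\<^sub>R N x') < 0"
  then show thesis by (rule that)
qed

end

lemma collar_exists:
  assumes "local_parametrization S V \<phi>" "q0 \<in> V" "q0 $ 2 \<ge> 0" "d \<bullet> coord_normal \<phi> q0 \<noteq> 0"
  obtains R W Q T where "collar S V \<phi> q0 d R W Q T"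
proof -
  have "q0 \<in> half_plane" using assms(3) by (simp add: half_plane_def)
  show thesis
  proof (rule collar_coordinates[OF assms(1,2) \<open>q0 \<in> half_plane\<close> assms(4)])
    fix R W Q T assume c: "R > 0" "ball q0 R \<subseteq> V" "open W" "continuous_on W Q" "continuous_on W T"
    "\<And>y. y \<in> W \<Longrightarrow> Q y \<in> ball q0 R \<and> \<bar>T y\<bar> < R \<and> \<phi> (Q y) + T y *\<^sub>R d = y"
    "\<And>q t. q \<in> ball q0 R \<Longrightarrow> \<bar>t\<bar> < R \<Longrightarrow>
       \<phi> q + t *\<^sub>R d \<in> W \<and> Q (\<phi> q + t *\<^sub>R d) = q \<and> T (\<phi> q + t *\<^sub>R d) = t"
    "\<And>y. y \<in> W \<Longrightarrow> y \<in> S \<longleftrightarrow> T y = 0 \<and> Q y \<in> half_plane"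
    "\<And>q. q \<in> ball q0 R \<Longrightarrow> d \<bullet> coord_normal \<phi> q \<noteq> 0"
    "\<And>y. y \<in> W \<Longrightarrow>
       (T has_derivative (\<lambda>n. coord_normal \<phi> (Q y) \<bullet> n / (d \<bullet> coord_normal \<phi> (Q y)))) (at y)"
    have "collar S V \<phi> q0 d R W Q T"
      by unfold_locales (use assms(1) c in \<open>simp_all add: half_plane_def\<close>)
    then show thesis by (rule that)
  qed
qed

lemma sign_locally_constant:
  fixes f :: "'a::metric_space \<Rightarrow> real"
  assumes "open W" "continuous_on W f" "y \<in> W" "f y \<noteq> 0"
  obtains r where "r > 0" "ball y r \<subseteq> W" "\<And>y'. y' \<in> ball y r \<Longrightarrow> f y' \<noteq> 0 \<and> (f y' > 0 \<longleftrightarrow> f y > 0)"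
proof -
  have "isCont f y" using assms continuous_on_eq_continuous_at by blast
  then obtain e where e: "e > 0" "\<And>y'. dist y' y < e \<Longrightarrow> dist (f y') (f y) < \<bar>f y\<bar>"
    using assms(4) unfolding continuous_at_eps_delta by (metis zero_less_abs_iff)
  obtain r where r: "r > 0" "ball y r \<subseteq> W" using assms openE by blast
  show thesis
  proof (rule that[of "min e r"])
    fix y' assume "y' \<in> ball y (min e r)"
    then have "dist y' y < e" by (simp add: dist_commute)
    then have "dist (f y') (f y) < \<bar>f y\<bar>" by (rule e(2))
    then show "f y' \<noteq> 0 \<and> (f y' > 0 \<longleftrightarrow> f y > 0)" by (auto simp: dist_real_def)
  qed (use e r in auto)
qed

section \<open>Local side functions of \<open>X\<close> and their uniqueness up to sign\<close>

locale spanning_surface = plane_domain +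
  fixes S :: "(real^3) set" and N :: "real^3 \<Rightarrow> real^3"
  assumes embedded: "embedded_surface S" and S_connected: "connected S" and gauss: "gauss_map S N"
    and S_compact: "compact S" and boundary: "surface_boundary S = \<Gamma>"
    and S_exterior: "S \<inter> (P - closure D) = {}"
begin

definition X :: "(real^3) set" where "X = S \<union> (P - D)"

text \<open>\<open>c\<close> is the value on the side into which \<open>N\<close> points. The radius
  is uniform over all feet \<open>x'\<close> near \<open>x\<close>: a nearby point is tested at its
  own nearest point of \<open>S\<close>, and the set of points with a given \<open>c\<close> becomes
  open.\<close>

definition flips :: "(real^3 \<Rightarrow> bool) \<Rightarrow> real^3 \<Rightarrow> bool \<Rightarrow> bool" where
  "flips s x c \<longleftrightarrow> (\<exists>r>0. \<forall>x'\<in>S. \<forall>t. dist x' x < r \<longrightarrow> 0 < t \<longrightarrow> t < r \<longrightarrow>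
     x' + t *\<^sub>R N x' \<notin> X \<and> x' - t *\<^sub>R N x' \<notin> X \<and>
     s (x' + t *\<^sub>R N x') = c \<and> s (x' - t *\<^sub>R N x') = (\<not> c))"

text \<open>
  A function on \<open>U\<close> that tells the two local sides of the topological surface \<open>X = S \<union> (P - D)\<close> apart;
  nothing is required along \<open>\<Gamma>\<close>, and its values on \<open>X\<close> itself are irrelevant.
\<close>

definition side_fun :: "(real^3) set \<Rightarrow> (real^3 \<Rightarrow> bool) \<Rightarrow> bool" where
  "side_fun U s \<longleftrightarrow>
     (\<forall>x\<in>U - X. \<exists>r>0. \<forall>y\<in>ball x r. s y = s x) \<and>
     (\<forall>x\<in>U \<inter> (S - \<Gamma>). \<exists>c. flips s x c) \<and>
     (\<forall>x\<in>U \<inter> (P - D - \<Gamma>). \<exists>r>0. \<exists>c. \<forall>y\<in>ball x r. a \<bullet> y \<noteq> b \<longrightarrow> s y = (c = (a \<bullet> y > b)))"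

lemma S_closed: "closed S" using S_compact compact_imp_closed by blast

lemma closed_X: "closed X" unfolding X_def using S_closed closed_P_minus_D by blast

lemma interior_eq: "surface_interior S = S - \<Gamma>" by (simp add: surface_interior_def boundary)

lemma \<Gamma>_subset_S: "\<Gamma> \<subseteq> S"
proof
  fix p assume "p \<in> \<Gamma>"
  then obtain V \<phi> q where "local_parametrization S V \<phi>" "q \<in> V" "q $ 2 = 0" "\<phi> q = p"
    unfolding boundary[symmetric] surface_boundary_def by blast
  then show "p \<in> S" using local_parametrizationD(4)[of S V \<phi> q] by (simp add: half_plane_def)
qed

lemma \<Gamma>_subset_X: "\<Gamma> \<subseteq> X" using \<Gamma>_subset_S by (auto simp: X_def)

text \<open>The disjointness of \<open>S\<close> from the exterior enters through this equation: the
  two parts of \<open>X\<close> meet along \<Gamma> only, so \<open>X\<close> does not branch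
  elsewhere.\<close>

lemma S_Int_exterior: "S \<inter> (P - D) = \<Gamma>"
  using S_exterior closure_D \<Gamma>_subset_S \<Gamma>P D_subset by auto

lemma norm_N: "x \<in> S \<Longrightarrow> norm (N x) = 1"
  using gauss unfolding gauss_map_def by blast

lemma interior_surface_nhd:
  assumes "x \<in> S - \<Gamma>"
  obtains r where "r > 0" "\<And>y. dist y x < r \<Longrightarrow> y \<notin> P - D"
proof -
  have "x \<notin> P - D" using assms S_Int_exterior by blast
  then have "x \<in> - (P - D)" by blast
  then obtain r where r: "r > 0" "ball x r \<subseteq> - (P - D)" using closed_P_minus_D open_Compl openE by blast
  have "y \<notin> P - D" if "dist y x < r" for y using r(2) that by (auto simp: dist_commute)
  then show thesis using that r(1) by blast
qed

lemma exterior_nhd: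
  assumes "x \<in> P - D - \<Gamma>"
  obtains r where "r > 0" "\<And>y. dist y x < r \<Longrightarrow> y \<in> X \<longleftrightarrow> a \<bullet> y = b"
proof -
  have "x \<notin> S" using assms S_Int_exterior by blast
  have "x \<notin> closure D" using assms closure_D by blast
  then have "x \<in> - (S \<union> closure D)" using \<open>x \<notin> S\<close> by blast
  moreover have "open (- (S \<union> closure D))" using S_closed by blast
  ultimately obtain r where r: "r > 0" "ball x r \<subseteq> - (S \<union> closure D)" using openE by blast
  have "y \<in> X \<longleftrightarrow> a \<bullet> y = b" if "dist y x < r" for y
  proof -
    have "y \<in> ball x r" using that by (simp add: dist_commute)
    then have "y \<notin> S" "y \<notin> D" using r(2) closure_subset[of D] by auto
    then show ?thesis unfolding X_def by (auto simp: P_def)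
  qed
  then show thesis using that r(1) by blast
qed

lemma side_fun_Un: "side_fun U s \<Longrightarrow> side_fun U' s \<Longrightarrow> side_fun (U \<union> U') s"
  unfolding side_fun_def by blast

lemma side_fun_subset: "side_fun U s \<Longrightarrow> U' \<subseteq> U \<Longrightarrow> side_fun U' s"
  unfolding side_fun_def by blast

text \<open>Booleans serve as signs and their equality as multiplication: \<open>k = True\<close>
  keeps the values of \<open>s1\<close>, \<open>k = False\<close> negates them all.\<close>

lemma flips_cong:
  assumes "flips s1 x c" "open U" "x \<in> U" "\<And>y. y \<in> U - X \<Longrightarrow> s2 y = (s1 y = k)"
  shows "flips s2 x (c = k)"
proof -
  obtain r where r: "r > 0" "\<And>x' t. x' \<in> S \<Longrightarrow> dist x' x < r \<Longrightarrow> 0 < t \<Longrightarrow> t < r \<Longrightarrow>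
     x' + t *\<^sub>R N x' \<notin> X \<and> x' - t *\<^sub>R N x' \<notin> X \<and>
     s1 (x' + t *\<^sub>R N x') = c \<and> s1 (x' - t *\<^sub>R N x') = (\<not> c)"
    using assms(1) unfolding flips_def by blast
  obtain e where e: "e > 0" "ball x e \<subseteq> U" using assms openE by blast
  show ?thesis unfolding flips_def
  proof (intro exI[of _ "min r (e/2)"] conjI ballI allI impI)
    show "min r (e/2) > 0" using r e by simp
    fix x' t assume x': "x' \<in> S" "dist x' x < min r (e/2)" and t: "0 < t" "t < min r (e/2)"
    have rr: "x' + t *\<^sub>R N x' \<notin> X \<and> x' - t *\<^sub>R N x' \<notin> X \<and>
     s1 (x' + t *\<^sub>R N x') = c \<and> s1 (x' - t *\<^sub>R N x') = (\<not> c)" using r(2) x' t by simp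
    then show "x' + t *\<^sub>R N x' \<notin> X" "x' - t *\<^sub>R N x' \<notin> X" by simp_all
    have "dist (x' + u *\<^sub>R N x') x < e" if "\<bar>u\<bar> = t" for u
      using dist_triangle[of "x' + u *\<^sub>R N x'" x x'] x' t that norm_N[OF x'(1)] by (simp add: dist_norm)
    from this[of t] this[of "-t"] have "x' + t *\<^sub>R N x' \<in> U" "x' - t *\<^sub>R N x' \<in> U"
      using e(2) t by (auto simp: dist_commute subset_eq)
    then show "s2 (x' + t *\<^sub>R N x') = (c = k)" "s2 (x' - t *\<^sub>R N x') = (\<not> (c = k))"
      using assms(4) rr by auto
  qed
qed

lemma side_fun_cong:
  assumes s: "side_fun U s1" and U: "open U" and eq: "\<And>y. y \<in> U - X \<Longrightarrow> s2 y = (s1 y = k)"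
  shows "side_fun U s2"
  unfolding side_fun_def
proof (intro conjI ballI)
  fix x assume x: "x \<in> U - X"
  then obtain r where r: "r > 0" "\<forall>y\<in>ball x r. s1 y = s1 x" using s unfolding side_fun_def by blast
  have "open (U - X)" using U closed_X by blast
  then obtain e where e: "e > 0" "ball x e \<subseteq> U - X" using x openE by blast
  show "\<exists>r>0. \<forall>y\<in>ball x r. s2 y = s2 x"
  proof (intro exI[of _ "min r e"] conjI ballI)
    fix y assume "y \<in> ball x (min r e)"
    then show "s2 y = s2 x" using eq[of y] eq[OF x] r(2) e(2) by auto
  qed (use r e in simp)
next
  fix x assume x: "x \<in> U \<inter> (S - \<Gamma>)"
  then show "\<exists>c. flips s2 x c" using s flips_cong[where U = U and ?s1.0 = s1 and ?s2.0 = s2, OF _ U _ eq] unfolding side_fun_def by blast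
next
  fix x assume x: "x \<in> U \<inter> (P - D - \<Gamma>)"
  then obtain r c where r: "r > 0" "\<forall>y\<in>ball x r. a \<bullet> y \<noteq> b \<longrightarrow> s1 y = (c = (a \<bullet> y > b))"
    using s unfolding side_fun_def by blast
  obtain e where e: "e > 0" "ball x e \<subseteq> U" using U x openE by blast
  obtain r2 where r2: "r2 > 0" "\<And>y. dist y x < r2 \<Longrightarrow> y \<in> X \<longleftrightarrow> a \<bullet> y = b"
    using exterior_nhd x by blast
  show "\<exists>r>0. \<exists>c. \<forall>y\<in>ball x r. a \<bullet> y \<noteq> b \<longrightarrow> s2 y = (c = (a \<bullet> y > b))"
  proof (intro exI[of _ "min r (min e r2)"] exI[of _ "c = k"] conjI ballI impI)
    fix y assume y: "y \<in> ball x (min r (min e r2))" "a \<bullet> y \<noteq> b"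
    then have "y \<in> U - X" using e(2) r2(2)[of y] by (auto simp: dist_commute)
    moreover have "s1 y = (c = (a \<bullet> y > b))" using r(2) y by auto
    ultimately show "s2 y = ((c = k) = (a \<bullet> y > b))" using eq[of y] by auto
  qed (use r e r2 in simp)
qed

text \<open>A point \<open>y\<close> near \<open>x\<close> and off \<open>X\<close> lies on the
  normal line through its nearest point of \<open>S\<close>. There \<open>flips\<close> dictates
  both values, up to the same unknown choice of side, which cancels in the comparison.\<close>

lemma flips_near:
  assumes x: "x \<in> S - \<Gamma>" and 1: "flips s1 x c1" and 2: "flips s2 x c2"
  shows "\<exists>r>0. \<forall>y\<in>ball x r - X. s1 y = (s2 y = (c1 = c2))"
proof -
  obtain r1 where r1: "r1 > 0" "\<And>x' t. x' \<in> S \<Longrightarrow> dist x' x < r1 \<Longrightarrow> 0 < t \<Longrightarrow> t < r1 \<Longrightarrow>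
     s1 (x' + t *\<^sub>R N x') = c1 \<and> s1 (x' - t *\<^sub>R N x') = (\<not> c1)"
    using 1 unfolding flips_def by blast
  obtain r2 where r2: "r2 > 0" "\<And>x' t. x' \<in> S \<Longrightarrow> dist x' x < r2 \<Longrightarrow> 0 < t \<Longrightarrow> t < r2 \<Longrightarrow>
     s2 (x' + t *\<^sub>R N x') = c2 \<and> s2 (x' - t *\<^sub>R N x') = (\<not> c2)"
    using 2 unfolding flips_def by blast
  obtain r3 where r3: "r3 > 0" "\<And>y. dist y x < r3 \<Longrightarrow> y \<notin> P - D" using interior_surface_nhd[OF x] by blast
  \<comment> \<open>Halved because the nearest point may be twice as far from \<open>x\<close> as
    \<open>y\<close> is.\<close>
  define r where "r = min r1 (min r2 r3) / 2"
  show ?thesis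
  proof (intro exI[of _ r] conjI ballI)
    show "r > 0" using r1 r2 r3 by (simp add: r_def)
    fix y assume y: "y \<in> ball x r - X"
    obtain x' where x': "x' \<in> S" "\<And>z. z \<in> S \<Longrightarrow> dist y x' \<le> dist y z"
      using distance_attains_inf[OF S_closed, of y] x by blast
    have yx: "dist y x < r" using y by (simp add: dist_commute)
    have le: "dist y x' \<le> dist y x" using x'(2) x by blast
    then have d: "dist x' x < 2 * r"
      using dist_triangle[of x' x y] yx by (simp add: dist_commute)
    then have "x' \<notin> P - D" using r3(2) by (simp add: r_def)
    then have "x' \<in> surface_interior S" using x'(1) \<Gamma>P D_subset unfolding interior_eq by blast
    then have cases: "y = x' + dist y x' *\<^sub>R N x' \<or> y = x' - dist y x' *\<^sub>R N x'"
      using nearest_point_on_normal[OF gauss embedded] x'(2) by blast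
    have "y \<noteq> x'" using y x'(1) by (auto simp: X_def)
    then have t: "dist y x' > 0" by simp
    have "dist y x' < 2 * r" using le yx t by linarith
    then have t: "dist y x' > 0" "dist y x' < r1" "dist y x' < r2"
      using t by (simp_all add: r_def)
    have "s1 (x' + dist y x' *\<^sub>R N x') = c1 \<and> s1 (x' - dist y x' *\<^sub>R N x') = (\<not> c1)"
      using r1(2)[of x' "dist y x'"] x'(1) d t by (simp add: r_def)
    moreover have "s2 (x' + dist y x' *\<^sub>R N x') = c2 \<and> s2 (x' - dist y x' *\<^sub>R N x') = (\<not> c2)"
      using r2(2)[of x' "dist y x'"] x'(1) d t by (simp add: r_def)
    ultimately show "s1 y = (s2 y = (c1 = c2))" using cases by metis
  qed
qed

text \<open>The relative sign of the two functions is locally constant off \<Gamma>, also across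
  \<open>X\<close>, since both flip there. Removing \<Gamma> leaves \<open>U\<close> connected, so
  the sign is constant.\<close>

lemma side_fun_unique:
  assumes U: "connected (U - \<Gamma>)" and s1: "side_fun U s1" and s2: "side_fun U s2"
  obtains c where "\<And>y. y \<in> U - X \<Longrightarrow> s1 y = (s2 y = c)"
proof -
  define G where "G c = \<Union>{ball x r |x r. \<forall>y\<in>ball x r - X. s1 y = (s2 y = c)}" for c
  have opG: "open (G c)" for c unfolding G_def by blast
  have GX: "s1 y = (s2 y = c)" if "y \<in> G c" "y \<notin> X" for y c using that unfolding G_def by blast
  have GI: "x \<in> G c" if "r > 0" "\<forall>y\<in>ball x r - X. s1 y = (s2 y = c)" for x r c
    unfolding G_def using that centre_in_ball[of x r] by blast
  have cover: "x \<in> G True \<union> G False" if x: "x \<in> U - \<Gamma>" for x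
  proof -
    consider "x \<in> U - X" | "x \<in> U \<inter> (S - \<Gamma>)" | "x \<in> U \<inter> (P - D - \<Gamma>)" using x by (auto simp: X_def)
    then have "\<exists>c. \<exists>r>0. \<forall>y\<in>ball x r - X. s1 y = (s2 y = c)"
    proof cases
      case 1
      obtain r1 where r1: "r1 > 0" "\<forall>y\<in>ball x r1. s1 y = s1 x" using s1 1 unfolding side_fun_def by blast
      obtain r2 where r2: "r2 > 0" "\<forall>y\<in>ball x r2. s2 y = s2 x" using s2 1 unfolding side_fun_def by blast
      show ?thesis
      proof (intro exI[of _ "s1 x = s2 x"] exI[of _ "min r1 r2"] conjI ballI)
        fix y assume "y \<in> ball x (min r1 r2) - X"
        then have "s1 y = s1 x" "s2 y = s2 x" using r1(2) r2(2) by simp_all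
        then show "s1 y = (s2 y = (s1 x = s2 x))" by argo
      qed (use r1 r2 in simp)
    next
      case 2
      then obtain c1 c2 where "flips s1 x c1" "flips s2 x c2" using s1 s2 unfolding side_fun_def by blast
      then show ?thesis using flips_near 2 by blast
    next
      case 3
      obtain r1 c1 where r1: "r1 > 0" "\<forall>y\<in>ball x r1. a \<bullet> y \<noteq> b \<longrightarrow> s1 y = (c1 = (a \<bullet> y > b))"
        using s1 3 unfolding side_fun_def by blast
      obtain r2 c2 where r2: "r2 > 0" "\<forall>y\<in>ball x r2. a \<bullet> y \<noteq> b \<longrightarrow> s2 y = (c2 = (a \<bullet> y > b))"
        using s2 3 unfolding side_fun_def by blast
      obtain r3 where r3: "r3 > 0" "\<And>y. dist y x < r3 \<Longrightarrow> y \<in> X \<longleftrightarrow> a \<bullet> y = b"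
        using exterior_nhd 3 by blast
      show ?thesis
      proof (intro exI[of _ "c1 = c2"] exI[of _ "min r1 (min r2 r3)"] conjI ballI)
        fix y assume y: "y \<in> ball x (min r1 (min r2 r3)) - X"
        then have "a \<bullet> y \<noteq> b" using r3(2)[of y] by (auto simp: dist_commute)
        then show "s1 y = (s2 y = (c1 = c2))" using r1(2) r2(2) y by auto
      qed (use r1 r2 r3 in simp)
    qed
    then show ?thesis using GI by (metis (full_types) UnCI)
  qed
  \<comment> \<open>\<open>X\<close> has no interior point in \<open>U - \<Gamma>\<close>; otherwise
    a point could satisfy both relative signs vacuously.\<close>
  have dense: "\<exists>y\<in>B. y \<notin> X" if B: "open B" "x \<in> B" "x \<in> U - \<Gamma>" for x B
  proof (cases "x \<in> X")
    case True
    obtain e where e: "e > 0" "ball x e \<subseteq> B" using B openE by blast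
    consider "x \<in> U \<inter> (S - \<Gamma>)" | "x \<in> U \<inter> (P - D - \<Gamma>)" using B True by (auto simp: X_def)
    then show ?thesis
    proof cases
      case 1
      then obtain c where "flips s1 x c" using s1 unfolding side_fun_def by blast
      then obtain r where r: "r > 0" "\<And>t. 0 < t \<Longrightarrow> t < r \<Longrightarrow> x + t *\<^sub>R N x \<notin> X"
        unfolding flips_def using 1 by (metis DiffD1 IntD2 dist_self)
      define t where "t = min r e / 2"
      have "t > 0" "t < r" "t < e" using r e by (auto simp: t_def)
      moreover have "dist x (x + t *\<^sub>R N x) = t" using norm_N[of x] 1 \<open>t > 0\<close> by (simp add: dist_norm)
      ultimately show ?thesis using r(2)[of t] e(2) by (intro bexI[of _ "x + t *\<^sub>R N x"]) auto
    next
      case 2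
      obtain r3 where r3: "r3 > 0" "\<And>y. dist y x < r3 \<Longrightarrow> y \<in> X \<longleftrightarrow> a \<bullet> y = b"
        using exterior_nhd 2 by blast
      define t where "t = min r3 e / 2 / norm a"
      have t: "t > 0" "t * norm a < r3" "t * norm a < e" using r3 e a by (auto simp: t_def)
      have "dist (x + t *\<^sub>R a) x = t * norm a" using t by (simp add: dist_norm)
      moreover have "a \<bullet> (x + t *\<^sub>R a) \<noteq> b" using 2 t a by (auto simp: P_def inner_add_right)
      ultimately show ?thesis
        using r3(2)[of "x + t *\<^sub>R a"] t e(2) by (intro bexI[of _ "x + t *\<^sub>R a"]) (auto simp: dist_commute)
    qed
  qed (use B in blast)
  have "G True \<inter> G False \<inter> (U - \<Gamma>) = {}"
  proof (rule ccontr)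
    assume "G True \<inter> G False \<inter> (U - \<Gamma>) \<noteq> {}"
    then obtain x where "x \<in> G True \<inter> G False" "x \<in> U - \<Gamma>" by blast
    then obtain y where "y \<in> G True" "y \<in> G False" "y \<notin> X"
      using dense[of "G True \<inter> G False" x] opG by blast
    then show False using GX by blast
  qed
  moreover have "U - \<Gamma> \<subseteq> G True \<union> G False" using cover by blast
  ultimately have "G True \<inter> (U - \<Gamma>) = {} \<or> G False \<inter> (U - \<Gamma>) = {}"
    using connectedD[OF U opG opG] by blast
  then obtain c where "U - \<Gamma> \<subseteq> G c" using \<open>U - \<Gamma> \<subseteq> G True \<union> G False\<close> by blast
  then have "s1 y = (s2 y = c)" if "y \<in> U - X" for y using GX \<Gamma>_subset_X that by blast
  then show thesis by (rule that)
qed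

text \<open>Converts a local description by the sign of \<open>T\<close>, in which side functions
  are built, into the chart-free one by \<open>N\<close>, in which they are compared.\<close>

lemma collar_flips:
  assumes "collar S V \<phi> q0 d R W Q T" and x: "x \<in> S - \<Gamma>" "x \<in> W"
    and r0: "r0 > 0" "\<And>y. y \<in> ball x r0 \<Longrightarrow> T y \<noteq> 0 \<Longrightarrow> s y = (c = (T y > 0))"
  shows "\<exists>c. flips s x c"
proof -
  interpret collar S V \<phi> q0 d R W Q T by fact
  have "x \<in> S" using x by blast
  then obtain r \<kappa> where r: "r > 0" "\<And>x' t. x' \<in> S \<Longrightarrow> dist x' x < r \<Longrightarrow> 0 < t \<Longrightarrow> t < r \<Longrightarrow>
      x' + t *\<^sub>R N x' \<in> W \<and> x' - t *\<^sub>R N x' \<in> W \<and>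
      \<kappa> * T (x' + t *\<^sub>R N x') > 0 \<and> \<kappa> * T (x' - t *\<^sub>R N x') < 0"
    using sign_along_normal[OF gauss _ x(2)] by blast
  obtain r3 where r3: "r3 > 0" "\<And>y. dist y x < r3 \<Longrightarrow> y \<notin> P - D" using interior_surface_nhd[OF x(1)] by blast
  define e where "e = min r (min r0 r3) / 2"
  have "flips s x (c = (\<kappa> > 0))"
    unfolding flips_def
  proof (intro exI[of _ e] conjI ballI allI impI)
    show "e > 0" using r r0 r3 by (simp add: e_def)
    fix x' t assume x': "x' \<in> S" "dist x' x < e" and t: "0 < t" "t < e"
    have er: "e < r" "2 * e \<le> r0" "2 * e \<le> r3" using r r0 r3 by (auto simp: e_def)
    have sg: "x' + t *\<^sub>R N x' \<in> W \<and> x' - t *\<^sub>R N x' \<in> W \<and>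
      \<kappa> * T (x' + t *\<^sub>R N x') > 0 \<and> \<kappa> * T (x' - t *\<^sub>R N x') < 0"
      using r(2)[of x' t] x' t er by simp
    have near: "dist (x' + u *\<^sub>R N x') x < 2 * e" if "\<bar>u\<bar> = t" for u
      using dist_triangle[of "x' + u *\<^sub>R N x'" x x'] x' t that norm_N[OF x'(1)] by (simp add: dist_norm)
    have out: "x' + u *\<^sub>R N x' \<notin> X" if "\<bar>u\<bar> = t" "x' + u *\<^sub>R N x' \<in> W" "T (x' + u *\<^sub>R N x') \<noteq> 0" for u
      using S_iff[OF that(2)] that(3) r3(2)[of "x' + u *\<^sub>R N x'"] near[OF that(1)] er by (auto simp: X_def)
    have sv: "s (x' + u *\<^sub>R N x') = (c = (T (x' + u *\<^sub>R N x') > 0))"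
      if "\<bar>u\<bar> = t" "T (x' + u *\<^sub>R N x') \<noteq> 0" for u
      using r0(2)[of "x' + u *\<^sub>R N x'"] near[OF that(1)] er that(2) by (simp add: dist_commute)
    have T1: "T (x' + t *\<^sub>R N x') \<noteq> 0" "(T (x' + t *\<^sub>R N x') > 0) = (\<kappa> > 0)"
      and T2: "T (x' - t *\<^sub>R N x') \<noteq> 0" "(T (x' - t *\<^sub>R N x') > 0) = (\<not> \<kappa> > 0)"
      using sg by (auto simp: zero_less_mult_iff mult_less_0_iff)
    show "x' + t *\<^sub>R N x' \<notin> X" using out[of t] sg T1 t by simp
    show "x' - t *\<^sub>R N x' \<notin> X" using out[of "-t"] sg T2 t by simp
    show "s (x' + t *\<^sub>R N x') = (c = (\<kappa> > 0))" using sv[of t] T1 t by simp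
    show "s (x' - t *\<^sub>R N x') = (\<not> (c = (\<kappa> > 0)))" using sv[of "-t"] T2 t by auto
  qed
  then show ?thesis by blast
qed

text \<open>Near such a point \<open>X\<close> is empty, a single sheet of \<open>S\<close>, or a
  piece of \<open>P\<close>, with the obvious functions: a constant, the sign of \<open>T\<close>,
  the sign of the height.\<close>

lemma side_fun_exists_off_\<Gamma>:
  assumes "x \<notin> \<Gamma>"
  shows "\<exists>r>0. \<exists>s. side_fun (ball x r) s"
proof -
  consider "x \<notin> X" | "x \<in> S - \<Gamma>" | "x \<in> P - D - \<Gamma>" using assms by (auto simp: X_def)
  then show ?thesis
  proof cases
    case 1
    then obtain r where "r > 0" "ball x r \<subseteq> - X" using closed_X open_Compl openE by (metis ComplI)
    then have "side_fun (ball x r) (\<lambda>y. True)"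
      unfolding side_fun_def X_def using zero_less_one by blast
    then show ?thesis using \<open>r > 0\<close> by blast
  next
    case 2
    then obtain V \<phi> q0 where lp: "local_parametrization S V \<phi>" and q0: "q0 \<in> V" "q0 $ 2 > 0" "\<phi> q0 = x"
      using interior_chart[OF embedded] interior_eq by blast
    \<comment> \<open>Any transversal direction would do at an interior point; the normal itself is
      one.\<close>
    define d where "d = coord_normal \<phi> q0"
    have "d \<bullet> coord_normal \<phi> q0 \<noteq> 0"
      using coord_normal_nonzero[OF local_parametrizationD(2)[OF lp] q0(1) local_parametrizationD(3)[OF lp q0(1)]]
      by (simp add: d_def)
    moreover have "q0 $ 2 \<ge> 0" using q0 by simp
    ultimately obtain R W Q T where col: "collar S V \<phi> q0 d R W Q T" using collar_exists[OF lp q0(1)] by blast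
    then interpret collar S V \<phi> q0 d R W Q T .
    have cQ: "continuous_on W (\<lambda>y. Q y $ 2)" by (intro continuous_intros cont_Q)
    have xW: "x \<in> W" "Q x = q0" using center q0 by auto
    obtain r1 where r1: "r1 > 0" "ball x r1 \<subseteq> W" "\<And>y. y \<in> ball x r1 \<Longrightarrow> Q y $ 2 > 0"
      using sign_locally_constant[OF open_W cQ xW(1)] q0 xW(2) by (metis less_numeral_extra(3))
    obtain r3 where r3: "r3 > 0" "\<And>y. dist y x < r3 \<Longrightarrow> y \<notin> P - D" using interior_surface_nhd[OF 2] by blast
    define r where "r = min r1 r3"
    have r: "r > 0" "ball x r \<subseteq> W" using r1 r3 by (auto simp: r_def)
    have XT: "y \<in> X \<longleftrightarrow> T y = 0" if "y \<in> ball x r" for y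
    proof -
      have "y \<in> W" using r(2) that by blast
      moreover have "Q y $ 2 > 0" using r1(3)[of y] that by (simp add: r_def)
      moreover have "y \<notin> P - D" using r3(2)[of y] that by (simp add: r_def dist_commute)
      ultimately show ?thesis using S_iff[of y] unfolding X_def by auto
    qed
    have "side_fun (ball x r) (\<lambda>y. T y > 0)"
      unfolding side_fun_def
    proof (intro conjI ballI)
      fix y assume y: "y \<in> ball x r - X"
      then have yT: "T y \<noteq> 0" and yW: "y \<in> W" using XT r(2) by auto
      obtain e where e: "e > 0" "\<And>y'. y' \<in> ball y e \<Longrightarrow> T y' \<noteq> 0 \<and> (T y' > 0 \<longleftrightarrow> T y > 0)"
        using sign_locally_constant[OF open_W cont_T yW yT] by metis
      show "\<exists>r>0. \<forall>y'\<in>ball y r. (0 < T y') = (0 < T y)"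
      proof (intro exI[of _ e] conjI ballI e(1))
        fix y' assume "y' \<in> ball y e"
        from conjunct2[OF e(2)[OF this]] show "(0 < T y') = (0 < T y)" .
      qed
    next
      fix y assume y: "y \<in> ball x r \<inter> (S - \<Gamma>)"
      then have yS: "y \<in> S - \<Gamma>" "y \<in> W" using r(2) by auto
      show "\<exists>c. flips (\<lambda>y. 0 < T y) y c"
        by (rule collar_flips[OF col yS zero_less_one, where c = True]) simp
    next
      fix y assume "y \<in> ball x r \<inter> (P - D - \<Gamma>)"
      then show "\<exists>r>0. \<exists>c. \<forall>y'\<in>ball y r. a \<bullet> y' \<noteq> b \<longrightarrow> (0 < T y') = (c = (b < a \<bullet> y'))"
        using r3(2)[of y] by (simp add: r_def dist_commute)
    qed
    then show ?thesis using r by blast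
  next
    case 3
    obtain r where r: "r > 0" "\<And>y. dist y x < r \<Longrightarrow> y \<in> X \<longleftrightarrow> a \<bullet> y = b" using exterior_nhd[OF 3] by blast
    have "x \<notin> S" using 3 S_Int_exterior by blast
    then obtain r2 where r2: "r2 > 0" "ball x r2 \<subseteq> - S" using S_closed open_Compl openE by (metis ComplI)
    have "side_fun (ball x (min r r2)) (\<lambda>y. a \<bullet> y > b)"
      unfolding side_fun_def
    proof (intro conjI ballI)
      fix y assume y: "y \<in> ball x (min r r2) - X"
      then have "a \<bullet> y \<noteq> b" using r(2)[of y] by (auto simp: dist_commute)
      then consider "y \<in> {y. a \<bullet> y > b}" | "y \<in> {y. a \<bullet> y < b}" by fastforce
      then show "\<exists>r>0. \<forall>y'\<in>ball y r. (b < a \<bullet> y') = (b < a \<bullet> y)"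
      proof cases
        case 1
        then obtain e where "e > 0" "ball y e \<subseteq> {y. a \<bullet> y > b}" using open_halfspace_gt openE by metis
        then show ?thesis using 1 by (intro exI[of _ e]) auto
      next
        case 2
        then obtain e where "e > 0" "ball y e \<subseteq> {y. a \<bullet> y < b}" using open_halfspace_lt openE by metis
        then show ?thesis using 2 by (intro exI[of _ e]) force
      qed
    next
      fix y assume "y \<in> ball x (min r r2) \<inter> (S - \<Gamma>)"
      then show "\<exists>c. flips (\<lambda>y. b < a \<bullet> y) y c" using r2(2) by auto
    next
      fix y assume "y \<in> ball x (min r r2) \<inter> (P - D - \<Gamma>)"
      show "\<exists>r>0. \<exists>c. \<forall>y'\<in>ball y r. a \<bullet> y' \<noteq> b \<longrightarrow> (b < a \<bullet> y') = (c = (b < a \<bullet> y'))"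
        by (rule exI[of _ 1], rule conjI, simp, rule exI[of _ True], simp)
    qed
    then show ?thesis using r r2 by (intro exI[of _ "min r r2"]) auto
  qed
qed

end

section \<open>Side functions at the points of the boundary curve\<close>

lemma eventually_pos:
  fixes f :: "'a::t2_space \<Rightarrow> real"
  assumes "open W" "continuous_on W f" "y \<in> W"
  shows "f y > 0 \<Longrightarrow> eventually (\<lambda>y'. f y' > 0) (nhds y)"
    and "f y < 0 \<Longrightarrow> eventually (\<lambda>y'. f y' < 0) (nhds y)"
proof -
  have "isCont f y" using assms continuous_on_eq_continuous_at by blast
  then have "(f \<longlongrightarrow> f y) (nhds y)"
    by (simp add: isCont_def tendsto_at_iff_tendsto_nhds)
  then show "f y > 0 \<Longrightarrow> eventually (\<lambda>y'. f y' > 0) (nhds y)"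
    and "f y < 0 \<Longrightarrow> eventually (\<lambda>y'. f y' < 0) (nhds y)"
    by (auto dest: order_tendstoD)
qed

context collar
begin

text \<open>Together with \<open>connected_graph\<close> it supplies the two connected pieces of
  \<open>P - \<Gamma>\<close> for \<open>local_sides\<close>: slabs if the collar runs along
  \<open>P\<close>, graphs if it runs along the normal of \<open>P\<close>.\<close>

lemma connected_slab:
  assumes "convex B" "B \<subseteq> ball q0 R" "convex J" "J \<subseteq> {-R<..<R}"
  shows "connected {y \<in> W. Q y \<in> B \<and> T y \<in> J}"
proof -
  let ?f = "\<lambda>p. \<phi> (fst p) + snd p *\<^sub>R d"
  have "{y \<in> W. Q y \<in> B \<and> T y \<in> J} = ?f ` (B \<times> J)"
  proof
    show "{y \<in> W. Q y \<in> B \<and> T y \<in> J} \<subseteq> ?f ` (B \<times> J)"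
    proof
      fix y assume "y \<in> {y \<in> W. Q y \<in> B \<and> T y \<in> J}"
      then show "y \<in> ?f ` (B \<times> J)" using QT by (intro image_eqI[of _ _ "(Q y, T y)"]) auto
    qed
    have "\<phi> q + t *\<^sub>R d \<in> W" "Q (\<phi> q + t *\<^sub>R d) \<in> B" "T (\<phi> q + t *\<^sub>R d) \<in> J" if "q \<in> B" "t \<in> J" for q t
    proof -
      have "q \<in> ball q0 R" "\<bar>t\<bar> < R" using that assms by (auto simp: abs_less_iff subset_eq)
      then show "\<phi> q + t *\<^sub>R d \<in> W" "Q (\<phi> q + t *\<^sub>R d) \<in> B" "T (\<phi> q + t *\<^sub>R d) \<in> J"
        using in_W Q_eq T_eq that by auto
    qed
    then show "?f ` (B \<times> J) \<subseteq> {y \<in> W. Q y \<in> B \<and> T y \<in> J}" by auto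
  qed
  moreover have "continuous_on (B \<times> J) ?f"
  proof -
    have "continuous_on (ball q0 R) \<phi>"
      using smooth_on_continuous[OF local_parametrizationD(2)[OF chart]] ball_V continuous_on_subset by blast
    then have "continuous_on (B \<times> J) (\<lambda>p. \<phi> (fst p))"
      by (rule continuous_on_compose2) (use assms in \<open>auto intro: continuous_intros\<close>)
    then show ?thesis by (intro continuous_intros)
  qed
  moreover have "connected (B \<times> J)" using assms by (intro convex_connected convex_Times)
  ultimately show ?thesis using connected_continuous_image[of "B \<times> J" ?f] by simp
qed

lemma connected_graph:
  assumes "convex B" "B \<subseteq> ball q0 R" "continuous_on B f" "\<And>q. q \<in> B \<Longrightarrow> \<bar>f q\<bar> < R"
  shows "connected {y \<in> W. Q y \<in> B \<and> T y = f (Q y)}"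
proof -
  let ?f = "\<lambda>q. \<phi> q + f q *\<^sub>R d"
  have "{y \<in> W. Q y \<in> B \<and> T y = f (Q y)} = ?f ` B"
  proof
    show "{y \<in> W. Q y \<in> B \<and> T y = f (Q y)} \<subseteq> ?f ` B"
    proof
      fix y assume y: "y \<in> {y \<in> W. Q y \<in> B \<and> T y = f (Q y)}"
      then have "y = ?f (Q y)" using QT[of y] by auto
      then show "y \<in> ?f ` B" using y by blast
    qed
    show "?f ` B \<subseteq> {y \<in> W. Q y \<in> B \<and> T y = f (Q y)}"
      using in_W Q_eq T_eq assms by auto
  qed
  moreover have "continuous_on B ?f"
    using smooth_on_continuous[OF local_parametrizationD(2)[OF chart]] ball_V assms(2,3)
    by (intro continuous_intros) (metis continuous_on_subset)
  moreover have "connected B" using assms by (intro convex_connected)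
  ultimately show ?thesis using connected_continuous_image[of B ?f] by simp
qed

end

context spanning_surface
begin

lemma side_funI:
  assumes "\<And>x. x \<in> U \<Longrightarrow> x \<notin> X \<Longrightarrow> eventually (\<lambda>y. s y = s x) (nhds x)"
    and "\<And>x. x \<in> U \<Longrightarrow> x \<in> S - \<Gamma> \<Longrightarrow> \<exists>c. flips s x c"
    and "\<And>x. x \<in> U \<Longrightarrow> x \<in> P - D - \<Gamma> \<Longrightarrow> \<exists>c. eventually (\<lambda>y. a \<bullet> y \<noteq> b \<longrightarrow> s y = (c = (a \<bullet> y > b))) (nhds x)"
  shows "side_fun U s"
  unfolding side_fun_def
proof (intro conjI ballI)
  fix x assume "x \<in> U - X"
  then obtain r where "r > 0" "\<And>y. dist y x < r \<Longrightarrow> s y = s x"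
    using assms(1)[of x] unfolding eventually_nhds_metric by blast
  then show "\<exists>r>0. \<forall>y\<in>ball x r. s y = s x" by (metis dist_commute mem_ball)
next
  fix x assume "x \<in> U \<inter> (S - \<Gamma>)"
  then show "\<exists>c. flips s x c" using assms(2) by blast
next
  fix x assume "x \<in> U \<inter> (P - D - \<Gamma>)"
  then have "x \<in> U" "x \<in> P - D - \<Gamma>" by simp_all
  from assms(3)[OF this] obtain c r where "r > 0" "\<And>y. dist y x < r \<Longrightarrow> a \<bullet> y \<noteq> b \<longrightarrow> s y = (c = (a \<bullet> y > b))"
    unfolding eventually_nhds_metric by blast
  then show "\<exists>r>0. \<exists>c. \<forall>y\<in>ball x r. a \<bullet> y \<noteq> b \<longrightarrow> s y = (c = (a \<bullet> y > b))"
    by (metis dist_commute mem_ball)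
qed

lemma collar_flips_eventually:
  assumes "collar S V \<phi> q0 d R W Q T" "x \<in> S - \<Gamma>" "x \<in> W"
    and ev: "eventually (\<lambda>y. T y \<noteq> 0 \<longrightarrow> s y = (c = (T y > 0))) (nhds x)"
  shows "\<exists>c. flips s x c"
proof -
  obtain r where r: "r > 0" "\<And>y. dist y x < r \<Longrightarrow> T y \<noteq> 0 \<longrightarrow> s y = (c = (T y > 0))"
    using ev unfolding eventually_nhds_metric by blast
  show ?thesis
  proof (rule collar_flips[OF assms(1-3) r(1), where c = c])
    fix y assume y: "y \<in> ball x r" "T y \<noteq> 0"
    then have "dist y x < r" by (simp add: dist_commute)
    then show "s y = (c = (T y > 0))" using r(2) y(2) by blast
  qed
qed

lemma boundary_chart:
  assumes "x \<in> \<Gamma>"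
  obtains V \<phi> q where "local_parametrization S V \<phi>" "q \<in> V" "q $ 2 = 0" "\<phi> q = x"
  using assms unfolding boundary[symmetric] surface_boundary_def by blast

lemma chart_edge:
  assumes "local_parametrization S V \<phi>" "q \<in> V" "q $ 2 = 0"
  shows "\<phi> q \<in> \<Gamma>" "a \<bullet> \<phi> q = b"
  using chart_boundary[OF assms] \<Gamma>P unfolding boundary P_def by blast+

lemma height_derivative:
  assumes lp: "local_parametrization S V \<phi>" and q: "q + t *\<^sub>R w \<in> V"
  shows "((\<lambda>t. a \<bullet> \<phi> (q + t *\<^sub>R w)) has_real_derivative a \<bullet> fderiv \<phi> (q + t *\<^sub>R w) w) (at t)"
proof -
  note sm = local_parametrizationD(2)[OF lp]
  have "((\<lambda>t. q + t *\<^sub>R w) has_derivative (\<lambda>t. t *\<^sub>R w)) (at t)"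
    by (auto intro!: derivative_eq_intros)
  from has_derivative_compose[OF this smooth_on_has_derivative[OF sm q]]
  have "((\<lambda>t. a \<bullet> \<phi> (q + t *\<^sub>R w)) has_derivative (\<lambda>s. a \<bullet> fderiv \<phi> (q + t *\<^sub>R w) (s *\<^sub>R w))) (at t)"
    by (rule has_derivative_inner_right)
  then show ?thesis
    unfolding has_field_derivative_def
    by (rule has_derivative_eq_rhs) (simp add: linear_scale[OF smooth_on_linear[OF sm q]] fun_eq_iff)
qed

text \<open>The edge of the chart is mapped into \<Gamma>, hence into \<open>P\<close>, so the
  height is constant along it. Whether \<open>S\<close> is tangent to \<open>P\<close> is thus
  decided by the derivative in the second direction alone.\<close>

lemma edge_derivative:
  assumes lp: "local_parametrization S V \<phi>" and q: "q \<in> V" "q $ 2 = 0"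
  shows "a \<bullet> fderiv \<phi> q (axis 1 1) = 0"
proof -
  obtain e where e: "e > 0" "ball q e \<subseteq> V" using local_parametrizationD(1)[OF lp] q(1) openE by blast
  have "q + t *\<^sub>R axis 1 1 \<in> V" if "\<bar>t\<bar> < e" for t using e(2) that by (auto simp: dist_norm subset_eq)
  then have "a \<bullet> \<phi> (q + t *\<^sub>R axis 1 1) = b" if "\<bar>t\<bar> < e" for t
    using chart_edge(2)[OF lp, of "q + t *\<^sub>R axis 1 1"] that q by (simp add: axis_def)
  from this this[of 0] have "\<forall>y. \<bar>0 - y\<bar> < e \<longrightarrow> a \<bullet> \<phi> (q + 0 *\<^sub>R axis 1 1) = a \<bullet> \<phi> (q + y *\<^sub>R axis 1 1)"
    using e(1) by simp
  from DERIV_local_const[OF height_derivative[OF lp, of q 0 "axis 1 1"] e(1) this] q show ?thesis by simp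
qed

text \<open>Monotonicity of the height along the segment from the edge point below or above
  \<open>q\<close>. Parameters outside the half plane are included because the collar uses the chart
  on both sides of the edge.\<close>

lemma height_sign:
  assumes lp: "local_parametrization S V \<phi>" and q0: "q0 $ 2 = 0" "ball q0 \<delta> \<subseteq> V"
    and pos: "\<And>q. q \<in> ball q0 \<delta> \<Longrightarrow> \<sigma> * (a \<bullet> fderiv \<phi> q (axis 2 1)) > 0" and q: "q \<in> ball q0 \<delta>"
  shows "q $ 2 > 0 \<Longrightarrow> \<sigma> * (a \<bullet> \<phi> q - b) > 0" "q $ 2 < 0 \<Longrightarrow> \<sigma> * (a \<bullet> \<phi> q - b) < 0"
proof -
  define c where "c = q - q$2 *\<^sub>R axis 2 1"
  have c2: "c $ 2 = 0" by (simp add: c_def)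
  \<comment> \<open>Since the centre lies on the edge, every point between \<open>q\<close> and its
    foot \<open>c\<close> is at least as close to it as \<open>q\<close>, componentwise.\<close>
  have ball: "c + t *\<^sub>R axis 2 1 \<in> ball q0 \<delta>" if "\<bar>t\<bar> \<le> \<bar>q$2\<bar>" for t
  proof -
    have "norm (q0 - (c + t *\<^sub>R axis 2 1)) \<le> norm (q0 - q)"
      by (rule norm_le_componentwise_cart) (use that q0(1) in \<open>simp add: c_def axis_def forall_2\<close>)
    then show ?thesis using q by (simp add: dist_norm)
  qed
  have der: "\<exists>D. ((\<lambda>t. \<sigma> * (a \<bullet> \<phi> (c + t *\<^sub>R axis 2 1))) has_real_derivative D) (at t) \<and> D > 0"
    if "\<bar>t\<bar> \<le> \<bar>q$2\<bar>" for t
  proof (intro exI conjI)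
    show "((\<lambda>t. \<sigma> * (a \<bullet> \<phi> (c + t *\<^sub>R axis 2 1))) has_real_derivative
       \<sigma> * (a \<bullet> fderiv \<phi> (c + t *\<^sub>R axis 2 1) (axis 2 1))) (at t)"
      by (intro DERIV_cmult height_derivative[OF lp]) (use ball[OF that] q0(2) in blast)
    show "\<sigma> * (a \<bullet> fderiv \<phi> (c + t *\<^sub>R axis 2 1) (axis 2 1)) > 0" by (rule pos[OF ball[OF that]])
  qed
  have cV: "c \<in> V" using ball[of 0] q0(2) by auto
  have ends: "a \<bullet> \<phi> c = b" "c + q$2 *\<^sub>R axis 2 1 = q"
    using chart_edge(2)[OF lp cV c2] by (simp_all add: c_def)
  show "\<sigma> * (a \<bullet> \<phi> q - b) > 0" if "q $ 2 > 0"
  proof -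
    have "\<sigma> * (a \<bullet> \<phi> (c + 0 *\<^sub>R axis 2 1)) < \<sigma> * (a \<bullet> \<phi> (c + q$2 *\<^sub>R axis 2 1))"
      by (rule DERIV_pos_imp_increasing[OF that], rule der) simp
    then show ?thesis by (simp add: ends right_diff_distrib)
  qed
  show "\<sigma> * (a \<bullet> \<phi> q - b) < 0" if "q $ 2 < 0"
  proof -
    have "\<sigma> * (a \<bullet> \<phi> (c + q$2 *\<^sub>R axis 2 1)) < \<sigma> * (a \<bullet> \<phi> (c + 0 *\<^sub>R axis 2 1))"
      by (rule DERIV_pos_imp_increasing[OF that], rule der) simp
    then show ?thesis by (simp add: ends right_diff_distrib)
  qed
qed

text \<open>
  In the collar along a direction \<open>d\<close> of \<open>P\<close>, the plane is \<open>Q $ 2 = 0\<close> and \<open>P - D\<close> is one half \<open>\<kappa> * T \<ge> 0\<close> of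
  it, so \<open>X\<close> bounds a quadrant.
\<close>

lemma side_fun_transversal:
  assumes lp: "local_parametrization S V \<phi>" and q0: "q0 \<in> V" "q0 $ 2 = 0"
    and tr: "a \<bullet> fderiv \<phi> q0 (axis 2 1) \<noteq> 0"
  shows "\<exists>r>0. \<exists>s. side_fun (ball (\<phi> q0) r) s"
proof -
  note sm = local_parametrizationD(2)[OF lp]
  define p1 where "p1 = fderiv \<phi> q0 (axis 1 1)"
  \<comment> \<open>The direction in \<open>P\<close> perpendicular to \<Gamma>. Sliding along it
    leaves heights unchanged, and its product with the normal is \<open>- (a \<bullet> fderiv \<phi>
    q0 (axis 2 1)) * (p1 \<bullet> p1)\<close>.\<close>
  define d where "d = cross3 a p1"
  have ap1: "a \<bullet> p1 = 0" using edge_derivative[OF lp q0] by (simp add: p1_def)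
  have "p1 \<noteq> 0"
  proof
    assume "p1 = 0"
    then have "axis 1 (1::real) = (0::real^2)"
      using local_parametrizationD(3)[OF lp q0(1)] smooth_on_linear[OF sm q0(1)] linear_injective_0
      unfolding p1_def by blast
    then show False by (simp add: axis_eq_0_iff)
  qed
  then have "d \<bullet> coord_normal \<phi> q0 \<noteq> 0"
    using tr ap1 by (simp add: d_def coord_normal_def dot_cross flip: p1_def)
  moreover have "q0 $ 2 \<ge> 0" using q0 by simp
  ultimately obtain R W Q T where col: "collar S V \<phi> q0 d R W Q T" using collar_exists[OF lp q0(1)] by blast
  then interpret collar S V \<phi> q0 d R W Q T .
  \<comment> \<open>Records whether \<open>S\<close> leaves \<Gamma> upwards or downwards.\<close>
  define \<sigma> where "\<sigma> = sgn (a \<bullet> fderiv \<phi> q0 (axis 2 1))"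
  have cont: "continuous_on V (\<lambda>q. \<sigma> * (a \<bullet> fderiv \<phi> q (axis 2 1)))"
    by (intro continuous_intros smooth_on_continuous[OF smooth_on_fderiv[OF sm]])
  have "\<sigma> * (a \<bullet> fderiv \<phi> q0 (axis 2 1)) > 0" using tr by (auto simp: \<sigma>_def sgn_if)
  then have "eventually (\<lambda>q. \<sigma> * (a \<bullet> fderiv \<phi> q (axis 2 1)) > 0) (nhds q0)"
    by (rule eventually_pos(1)[OF local_parametrizationD(1)[OF lp] cont q0(1)])
  then obtain \<delta>1 where \<delta>1: "\<delta>1 > 0" "\<And>q. dist q q0 < \<delta>1 \<Longrightarrow> \<sigma> * (a \<bullet> fderiv \<phi> q (axis 2 1)) > 0"
    unfolding eventually_nhds_metric by blast
  define \<delta> where "\<delta> = min \<delta>1 R"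
  have \<delta>: "\<delta> > 0" "\<delta> \<le> R" using \<delta>1 R_pos by (auto simp: \<delta>_def)
  have pos: "\<sigma> * (a \<bullet> fderiv \<phi> q (axis 2 1)) > 0" if "q \<in> ball q0 \<delta>" for q
    using \<delta>1(2)[of q] that by (simp add: \<delta>_def dist_commute)
  have \<delta>R: "ball q0 \<delta> \<subseteq> ball q0 R" using \<delta>(2) by (rule subset_ball)
  then have \<delta>V: "ball q0 \<delta> \<subseteq> V" using ball_V by blast
  define W' where "W' = {y \<in> W. Q y \<in> ball q0 \<delta>}"
  have W'W: "W' \<subseteq> W" by (auto simp: W'_def)
  have "open W'"
    using continuous_open_preimage[OF cont_Q open_W open_ball] by (simp only: W'_def vimage_def Int_def mem_Collect_eq)
  have xW': "\<phi> q0 \<in> W'" using center \<delta> by (simp add: W'_def)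
  have cQ: "continuous_on W (\<lambda>y. Q y $ 2)" by (intro continuous_intros cont_Q)
  have ad: "a \<bullet> d = 0" by (simp add: d_def dot_cross_self)
  have height: "a \<bullet> y = a \<bullet> \<phi> (Q y)" if "y \<in> W'" for y
  proof -
    have "a \<bullet> y = a \<bullet> (\<phi> (Q y) + T y *\<^sub>R d)" using QT[of y] that W'W by auto
    then show ?thesis using ad by (simp add: inner_add_right)
  qed
  have sgn1: "Q y $ 2 > 0 \<Longrightarrow> \<sigma> * (a \<bullet> y - b) > 0" "Q y $ 2 < 0 \<Longrightarrow> \<sigma> * (a \<bullet> y - b) < 0"
    "Q y $ 2 = 0 \<Longrightarrow> a \<bullet> y = b" if y: "y \<in> W'" for y
    using height_sign[OF lp q0(2) \<delta>V pos, of "Q y"] chart_edge(2)[OF lp, of "Q y"] y \<delta>V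
    unfolding height[OF y] by (auto simp: W'_def)
  have Piff: "y \<in> P \<longleftrightarrow> Q y $ 2 = 0" if "y \<in> W'" for y
    using sgn1[OF that] unfolding P_def by (cases "Q y $ 2" "0::real" rule: linorder_cases) auto
  have Siff: "y \<in> S \<longleftrightarrow> T y = 0 \<and> Q y $ 2 \<ge> 0" if "y \<in> W'" for y using S_iff that W'W by blast
  have \<Gamma>iff: "y \<in> \<Gamma> \<longleftrightarrow> Q y $ 2 = 0 \<and> T y = 0" if y: "y \<in> W'" for y
  proof
    show "y \<in> \<Gamma> \<Longrightarrow> Q y $ 2 = 0 \<and> T y = 0" using \<Gamma>P \<Gamma>_subset_S Piff[OF y] Siff[OF y] by blast
    assume 0: "Q y $ 2 = 0 \<and> T y = 0"
    then have "y = \<phi> (Q y)" using QT[of y] y W'W by auto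
    moreover have "Q y \<in> V" using y \<delta>V by (auto simp: W'_def)
    ultimately show "y \<in> \<Gamma>" using chart_edge(1)[OF lp] 0 by metis
  qed
  define B where "B = ball q0 \<delta> \<inter> {q. axis 2 1 \<bullet> q = 0}"
  have B: "convex B" "B \<subseteq> ball q0 R"
    unfolding B_def using \<delta>R by (auto intro: convex_Int convex_hyperplane)
  have side: "connected {y \<in> W'. Q y $ 2 = 0 \<and> T y \<in> J}" if "convex J" "J \<subseteq> {-R<..<R}" for J
  proof -
    have "{y \<in> W'. Q y $ 2 = 0 \<and> T y \<in> J} = {y \<in> W. Q y \<in> B \<and> T y \<in> J}"
      by (auto simp: W'_def B_def inner_axis')
    then show ?thesis using connected_slab[OF B that] by simp
  qed
  define A1 where "A1 = {y \<in> W'. Q y $ 2 = 0 \<and> T y \<in> {0<..<R}}"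
  define A2 where "A2 = {y \<in> W'. Q y $ 2 = 0 \<and> T y \<in> {-R<..<0}}"
  have conn: "connected A1" "connected A2"
    unfolding A1_def A2_def by (rule side; use R_pos in \<open>auto intro: convex_real_interval\<close>)+
  have "P \<inter> W' - \<Gamma> = A1 \<union> A2"
    using Piff \<Gamma>iff T_bound W'W by (fastforce simp: A1_def A2_def abs_less_iff)
  then have "(A1 \<subseteq> D \<and> A2 \<inter> D = {}) \<or> (A2 \<subseteq> D \<and> A1 \<inter> D = {})"
    using local_sides[OF _ \<open>open W'\<close> xW' conn] chart_edge(1)[OF lp q0] by blast
  \<comment> \<open>\<kappa> records on which side of \<Gamma> in \<open>P\<close> the exterior
    lies.\<close>
  then obtain \<kappa> :: real where \<kappa>: "\<kappa> = 1 \<or> \<kappa> = -1"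
    and Eiff: "\<And>y. y \<in> W' \<Longrightarrow> y \<in> P - D \<longleftrightarrow> Q y $ 2 = 0 \<and> \<kappa> * T y \<ge> 0"
  proof
    have notD: "y \<in> W' \<Longrightarrow> T y = 0 \<Longrightarrow> Q y $ 2 = 0 \<Longrightarrow> y \<notin> D" for y using \<Gamma>iff D_subset by blast
    have A1iff: "y \<in> A1 \<longleftrightarrow> Q y $ 2 = 0 \<and> T y > 0" if "y \<in> W'" for y
      using T_bound[of y] that W'W by (auto simp: A1_def abs_less_iff)
    have A2iff: "y \<in> A2 \<longleftrightarrow> Q y $ 2 = 0 \<and> T y < 0" if "y \<in> W'" for y
      using T_bound[of y] that W'W by (auto simp: A2_def abs_less_iff)
    {
      assume h: "A1 \<subseteq> D \<and> A2 \<inter> D = {}"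
      have "y \<in> P - D \<longleftrightarrow> Q y $ 2 = 0 \<and> -1 * T y \<ge> 0" if y: "y \<in> W'" for y
        using h A1iff[OF y] A2iff[OF y] notD[OF y] Piff[OF y]
        by (cases "T y" "0::real" rule: linorder_cases) auto
      then show thesis using that[of "-1"] by blast
    }
    {
      assume h: "A2 \<subseteq> D \<and> A1 \<inter> D = {}"
      have "y \<in> P - D \<longleftrightarrow> Q y $ 2 = 0 \<and> 1 * T y \<ge> 0" if y: "y \<in> W'" for y
        using h A1iff[OF y] A2iff[OF y] notD[OF y] Piff[OF y]
        by (cases "T y" "0::real" rule: linorder_cases) auto
      then show thesis using that[of 1] by blast
    }
  qed
  \<comment> \<open>The open quadrant whose two faces are \<open>S\<close>, where
    \<open>T = 0\<close>, and \<open>P - D\<close>, where \<open>Q $ 2 = 0\<close>.\<close>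
  define s where "s y \<longleftrightarrow> Q y $ 2 > 0 \<and> \<kappa> * T y > 0" for y
  have c\<kappa>: "continuous_on W (\<lambda>y. \<kappa> * T y)" by (intro continuous_intros cont_T)
  note ev = eventually_pos[OF open_W cQ] eventually_pos[OF open_W c\<kappa>]
  have "side_fun W' s"
  proof (rule side_funI)
    fix y assume y: "y \<in> W'" "y \<notin> X"
    then have yW: "y \<in> W" using W'W by blast
    have ne: "\<not> (T y = 0 \<and> Q y $ 2 \<ge> 0)" "\<not> (Q y $ 2 = 0 \<and> \<kappa> * T y \<ge> 0)"
      using y Siff Eiff unfolding X_def by blast+
    consider "Q y $ 2 < 0" | "\<kappa> * T y < 0" | "Q y $ 2 > 0" "\<kappa> * T y > 0"
      using ne \<kappa> by fastforce
    then show "\<forall>\<^sub>F y' in nhds y. s y' = s y"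
    proof cases
      case 1
      have "\<not> s y" using 1 by (simp add: s_def)
      show ?thesis using ev(2)[OF yW 1] by (rule eventually_mono) (use \<open>\<not> s y\<close> in \<open>simp add: s_def\<close>)
    next
      case 2
      have "\<not> s y" using 2 by (simp add: s_def)
      show ?thesis using ev(4)[OF yW 2] by (rule eventually_mono) (use \<open>\<not> s y\<close> in \<open>simp add: s_def\<close>)
    next
      case 3
      have "s y" using 3 by (simp add: s_def)
      show ?thesis using eventually_conj[OF ev(1)[OF yW 3(1)] ev(3)[OF yW 3(2)]]
        by (rule eventually_mono) (use \<open>s y\<close> in \<open>simp add: s_def\<close>)
    qed
  next
    fix y assume y: "y \<in> W'" "y \<in> S - \<Gamma>"
    then have yW: "y \<in> W" using W'W by blast
    have "Q y $ 2 > 0" using y Siff \<Gamma>iff by force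
    from ev(1)[OF yW this] have "\<forall>\<^sub>F y' in nhds y. T y' \<noteq> 0 \<longrightarrow> s y' = ((\<kappa> > 0) = (T y' > 0))"
      by (rule eventually_mono) (use \<kappa> in \<open>auto simp: s_def\<close>)
    then show "\<exists>c. flips s y c" by (rule collar_flips_eventually[OF col y(2) yW])
  next
    fix y assume y: "y \<in> W'" "y \<in> P - D - \<Gamma>"
    then have yW: "y \<in> W" using W'W by blast
    have "\<kappa> * T y > 0" using y Eiff \<Gamma>iff \<kappa> by force
    then have "\<forall>\<^sub>F y' in nhds y. \<kappa> * T y' > 0 \<and> y' \<in> W'"
      using ev(3)[OF yW] eventually_nhds_in_open[OF \<open>open W'\<close> y(1)] eventually_conj by blast
    then have "\<forall>\<^sub>F y' in nhds y. a \<bullet> y' \<noteq> b \<longrightarrow> s y' = ((\<sigma> > 0) = (b < a \<bullet> y'))"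
    proof (rule eventually_mono, intro impI)
      fix y' assume y': "\<kappa> * T y' > 0 \<and> y' \<in> W'" "a \<bullet> y' \<noteq> b"
      have "s y' \<longleftrightarrow> Q y' $ 2 > 0" using y' by (simp add: s_def)
      also have "\<dots> \<longleftrightarrow> \<sigma> * (a \<bullet> y' - b) > 0"
        using sgn1[of y'] y' by (cases "Q y' $ 2" "0::real" rule: linorder_cases) auto
      also have "\<dots> \<longleftrightarrow> (\<sigma> > 0) = (b < a \<bullet> y')"
        using y'(2) tr by (auto simp: \<sigma>_def sgn_if)
      finally show "s y' = ((\<sigma> > 0) = (b < a \<bullet> y'))" .
    qed
    then show "\<exists>c. \<forall>\<^sub>F y' in nhds y. a \<bullet> y' \<noteq> b \<longrightarrow> s y' = (c = (b < a \<bullet> y'))" by (rule exI)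
  qed
  moreover obtain r where "r > 0" "ball (\<phi> q0) r \<subseteq> W'" using \<open>open W'\<close> xW' openE by blast
  ultimately show ?thesis using side_fun_subset by blast
qed

text \<open>
  In the collar along the normal \<open>a\<close> of \<open>P\<close>, both \<open>S\<close> and \<open>P\<close> are graphs over the \<open>Q\<close>-plane. If \<open>P - D\<close> lies over
  the side \<open>Q $ 2 \<le> 0\<close>, then \<open>X\<close> is a graph; otherwise \<open>S\<close> and \<open>P - D\<close> lie over the same side, without
  crossing, and \<open>X\<close> bounds the wedge between them.
\<close>

lemma side_fun_tangential:
  assumes lp: "local_parametrization S V \<phi>" and q0: "q0 \<in> V" "q0 $ 2 = 0"
    and tan: "a \<bullet> fderiv \<phi> q0 (axis 2 1) = 0"
  shows "\<exists>r>0. \<exists>s. side_fun (ball (\<phi> q0) r) s"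
proof -
  note sm = local_parametrizationD(2)[OF lp]
  \<comment> \<open>\<open>a\<close> is orthogonal to both coordinate tangents, hence parallel to
    the normal. Being orthogonal to it as well would make the normal vanish.\<close>
  have "a \<bullet> coord_normal \<phi> q0 \<noteq> 0"
  proof
    assume 0: "a \<bullet> coord_normal \<phi> q0 = 0"
    have "cross3 a (coord_normal \<phi> q0) = 0"
      using tan edge_derivative[OF lp q0] by (simp add: coord_normal_def Lagrange)
    then have "coord_normal \<phi> q0 = 0" using 0 a norm_and_cross_eq_0 by blast
    then show False using coord_normal_nonzero[OF sm q0(1) local_parametrizationD(3)[OF lp q0(1)]] by simp
  qed
  moreover have "q0 $ 2 \<ge> 0" using q0 by simp
  ultimately obtain R W Q T where col: "collar S V \<phi> q0 a R W Q T" using collar_exists[OF lp q0(1)] by blast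
  then interpret collar S V \<phi> q0 a R W Q T .
  define \<eta> where "\<eta> = a \<bullet> a"
  have \<eta>: "\<eta> > 0" using a by (simp add: \<eta>_def)
  define h where "h q = a \<bullet> \<phi> q - b" for q
  have conth: "continuous_on V h"
    unfolding h_def by (intro continuous_intros smooth_on_continuous[OF sm])
  have h0: "h q = 0" if "q \<in> V" "q $ 2 = 0" for q using chart_edge(2)[OF lp that] by (simp add: h_def)
  have "continuous_on V (\<lambda>q. R * \<eta> - \<bar>h q\<bar>)" by (intro continuous_intros conth)
  \<comment> \<open>In the collar \<open>P\<close> is the graph \<open>T = - h Q / \<eta>\<close>.
    As \<open>h\<close> vanishes at \<open>q0\<close>, this graph stays in the slab
    \<open>\<bar>T\<bar> < R\<close> over a small ball.\<close>
  then have "eventually (\<lambda>q. R * \<eta> - \<bar>h q\<bar> > 0) (nhds q0)"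
    by (rule eventually_pos(1)[OF local_parametrizationD(1)[OF lp] _ q0(1)]) (use h0[OF q0] R_pos \<eta> in simp)
  then obtain \<delta>1 where \<delta>1: "\<delta>1 > 0" "\<And>q. dist q q0 < \<delta>1 \<Longrightarrow> R * \<eta> - \<bar>h q\<bar> > 0"
    unfolding eventually_nhds_metric by blast
  define \<delta> where "\<delta> = min \<delta>1 R"
  have \<delta>: "\<delta> > 0" "\<delta> \<le> R" using \<delta>1 R_pos by (auto simp: \<delta>_def)
  have hR: "\<bar>h q\<bar> < R * \<eta>" if "q \<in> ball q0 \<delta>" for q
    using \<delta>1(2)[of q] that by (simp add: \<delta>_def dist_commute)
  have \<delta>R: "ball q0 \<delta> \<subseteq> ball q0 R" using \<delta>(2) by (rule subset_ball)
  then have \<delta>V: "ball q0 \<delta> \<subseteq> V" using ball_V by blast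
  define W' where "W' = {y \<in> W. Q y \<in> ball q0 \<delta>}"
  have W'W: "W' \<subseteq> W" by (auto simp: W'_def)
  have "open W'"
    using continuous_open_preimage[OF cont_Q open_W open_ball] by (simp only: W'_def vimage_def Int_def mem_Collect_eq)
  have xW': "\<phi> q0 \<in> W'" using center \<delta> by (simp add: W'_def)
  have QV: "Q y \<in> V" if "y \<in> W'" for y using that \<delta>V by (auto simp: W'_def)
  have height: "a \<bullet> y - b = h (Q y) + T y * \<eta>" if "y \<in> W'" for y
  proof -
    have "a \<bullet> y = a \<bullet> (\<phi> (Q y) + T y *\<^sub>R a)" using QT[of y] that W'W by auto
    then show ?thesis by (simp add: inner_add_right h_def \<eta>_def)
  qed
  have Piff: "y \<in> P \<longleftrightarrow> h (Q y) + T y * \<eta> = 0" if "y \<in> W'" for y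
    using height[OF that] by (auto simp: P_def)
  have Siff: "y \<in> S \<longleftrightarrow> T y = 0 \<and> Q y $ 2 \<ge> 0" if "y \<in> W'" for y using S_iff that W'W by blast
  have \<Gamma>iff: "y \<in> \<Gamma> \<longleftrightarrow> Q y $ 2 = 0 \<and> y \<in> P" if y: "y \<in> W'" for y
  proof
    assume y\<Gamma>: "y \<in> \<Gamma>"
    then have yS: "T y = 0" "Q y $ 2 \<ge> 0" using \<Gamma>_subset_S Siff[OF y] by blast+
    then have "\<phi> (Q y) = y" using QT[of y] y W'W by auto
    then have "\<not> Q y $ 2 > 0" using chart_interior[OF lp QV[OF y]] y\<Gamma> interior_eq by auto
    then show "Q y $ 2 = 0 \<and> y \<in> P" using yS y\<Gamma> \<Gamma>P by auto
  next
    assume y0: "Q y $ 2 = 0 \<and> y \<in> P"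
    then have "T y = 0" using Piff[OF y] h0[OF QV[OF y]] \<eta> by simp
    then have "\<phi> (Q y) = y" using QT[of y] y W'W by auto
    then show "y \<in> \<Gamma>" using chart_edge(1)[OF lp QV[OF y]] y0 by simp
  qed
  define f where "f q = - h q / \<eta>" for q
  have contf: "continuous_on B f" if "B \<subseteq> ball q0 \<delta>" for B
    unfolding f_def using \<eta> continuous_on_subset[OF conth, of B] that \<delta>V by (intro continuous_intros) auto
  have fR: "\<bar>f q\<bar> < R" if "q \<in> ball q0 \<delta>" for q
    using hR[OF that] \<eta> by (simp add: f_def abs_divide field_simps)
  have Tf: "h (Q y) + T y * \<eta> = 0 \<longleftrightarrow> T y = f (Q y)" for y
    using \<eta> by (auto simp: f_def field_simps)
  have side: "connected {y \<in> W. Q y \<in> B \<and> T y = f (Q y)}" if "convex B" "B \<subseteq> ball q0 \<delta>" for B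
    using connected_graph[OF that(1) _ contf[OF that(2)]] that(2) \<delta>R fR by blast
  define A1 where "A1 = {y \<in> W. Q y \<in> ball q0 \<delta> \<inter> {q. q $ 2 > 0} \<and> T y = f (Q y)}"
  define A2 where "A2 = {y \<in> W. Q y \<in> ball q0 \<delta> \<inter> {q. q $ 2 < 0} \<and> T y = f (Q y)}"
  have "convex {q::real^2. q $ 2 < 0}"
    using convex_halfspace_lt[of "axis 2 1 :: real^2" 0] by (simp add: inner_axis')
  then have conn: "connected A1" "connected A2"
    unfolding A1_def A2_def by (intro side convex_Int convex_ball convex_upper_half; blast)+
  have A1iff: "y \<in> A1 \<longleftrightarrow> Q y $ 2 > 0 \<and> y \<in> P" and A2iff: "y \<in> A2 \<longleftrightarrow> Q y $ 2 < 0 \<and> y \<in> P"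
    if y: "y \<in> W'" for y
    using y unfolding A1_def A2_def Piff[OF y] Tf by (auto simp: W'_def)
  have "A1 \<union> A2 \<subseteq> W'" by (auto simp: A1_def A2_def W'_def)
  have "P \<inter> W' - \<Gamma> = A1 \<union> A2"
  proof (intro equalityI subsetI)
    fix y assume y: "y \<in> P \<inter> W' - \<Gamma>"
    then have yW': "y \<in> W'" and "Q y $ 2 \<noteq> 0" using \<Gamma>iff by blast+
    then show "y \<in> A1 \<union> A2" using A1iff[OF yW'] A2iff[OF yW'] y by auto
  next
    fix y assume y: "y \<in> A1 \<union> A2"
    then have yW': "y \<in> W'" using \<open>A1 \<union> A2 \<subseteq> W'\<close> by blast
    then show "y \<in> P \<inter> W' - \<Gamma>" using A1iff[OF yW'] A2iff[OF yW'] \<Gamma>iff[OF yW'] y by auto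
  qed
  then have sides: "(A1 \<subseteq> D \<and> A2 \<inter> D = {}) \<or> (A2 \<subseteq> D \<and> A1 \<inter> D = {})"
    using local_sides[OF _ \<open>open W'\<close> xW' conn] chart_edge(1)[OF lp q0] by blast
  have notD: "y \<in> P \<Longrightarrow> Q y $ 2 = 0 \<Longrightarrow> y \<notin> D" if "y \<in> W'" for y using \<Gamma>iff[OF that] D_subset by blast
  have cQ: "continuous_on W (\<lambda>y. Q y $ 2)" by (intro continuous_intros cont_Q)
  have ca: "continuous_on W (\<lambda>y. a \<bullet> y - b)" by (intro continuous_intros)
  note evQ = eventually_pos[OF open_W cQ]
  note evT = eventually_pos[OF open_W cont_T]
  note eva = eventually_pos[OF open_W ca]
  \<comment> \<open>Over the edge the height above \<open>P\<close> and the height above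
    \<open>S\<close> have the same sign; this is what makes definitions on the two halves fit
    together.\<close>
  have edge: "a \<bullet> y - b = T y * \<eta>" if "y \<in> W'" "Q y $ 2 = 0" for y
    using height[OF that(1)] h0[OF QV[OF that(1)] that(2)] by simp
  have "\<exists>s. side_fun W' s"
    using sides
  proof
    assume h: "A1 \<subseteq> D \<and> A2 \<inter> D = {}"
    have Eiff: "y \<in> P - D \<longleftrightarrow> y \<in> P \<and> Q y $ 2 \<le> 0" if y: "y \<in> W'" for y
      using h A1iff[OF y] A2iff[OF y] notD[OF y]
      by (cases "Q y $ 2" "0::real" rule: linorder_cases) auto
    \<comment> \<open>The region above the graph \<open>X\<close>, measured from \<open>S\<close>
      over the half plane and from \<open>P\<close> over the rest.\<close>
    define s where "s y \<longleftrightarrow> (if Q y $ 2 \<ge> 0 then T y > 0 else a \<bullet> y - b > 0)" for y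
    have s1: "\<forall>\<^sub>F y' in nhds y. s y' = (T y' > 0)" if "Q y $ 2 > 0" "y \<in> W" for y
      using evQ(1)[OF that(2,1)] by (rule eventually_mono) (simp add: s_def)
    have s2: "\<forall>\<^sub>F y' in nhds y. s y' = (a \<bullet> y' - b > 0)" if "Q y $ 2 < 0" "y \<in> W" for y
      using evQ(2)[OF that(2,1)] by (rule eventually_mono) (simp add: s_def)
    have "side_fun W' s"
    proof (rule side_funI)
      fix y assume y: "y \<in> W'" "y \<notin> X"
      then have yW: "y \<in> W" using W'W by blast
      have ne: "\<not> (T y = 0 \<and> Q y $ 2 \<ge> 0)" "\<not> (a \<bullet> y - b = 0 \<and> Q y $ 2 \<le> 0)"
        using y Siff[OF y(1)] Eiff[OF y(1)] unfolding X_def by (auto simp: P_def)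
      consider "Q y $ 2 \<ge> 0" "T y > 0" "Q y $ 2 \<le> 0 \<longrightarrow> a \<bullet> y - b > 0"
        | "Q y $ 2 \<ge> 0" "T y < 0" "Q y $ 2 \<le> 0 \<longrightarrow> a \<bullet> y - b < 0"
        | "Q y $ 2 < 0" "a \<bullet> y - b > 0" | "Q y $ 2 < 0" "a \<bullet> y - b < 0"
        using ne edge[OF y(1)] \<eta> by (smt (verit) mult_pos_pos mult_neg_pos)
      then show "\<forall>\<^sub>F y' in nhds y. s y' = s y"
      proof cases
        case 1
        then have "s y" by (simp add: s_def)
        show ?thesis
        proof (cases "Q y $ 2 > 0")
          case True
          from s1[OF True yW] evT(1)[OF yW 1(2)] show ?thesis
            by eventually_elim (use \<open>s y\<close> in simp)
        next
          case False
          then have "a \<bullet> y - b > 0" using 1 by simp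
          from eva(1)[OF yW this] evT(1)[OF yW 1(2)] show ?thesis
            by eventually_elim (use \<open>s y\<close> 1(1) in \<open>simp add: s_def\<close>)
        qed
      next
        case 2
        then have "\<not> s y" by (simp add: s_def)
        show ?thesis
        proof (cases "Q y $ 2 > 0")
          case True
          from s1[OF True yW] evT(2)[OF yW 2(2)] show ?thesis
            by eventually_elim (use \<open>\<not> s y\<close> in simp)
        next
          case False
          then have "a \<bullet> y - b < 0" using 2 by simp
          from eva(2)[OF yW this] evT(2)[OF yW 2(2)] show ?thesis
            by eventually_elim (use \<open>\<not> s y\<close> 2(1) in \<open>simp add: s_def\<close>)
        qed
      next
        case 3
        then have "s y" by (simp add: s_def)
        from s2[OF 3(1) yW] eva(1)[OF yW 3(2)] show ?thesis
          by eventually_elim (use \<open>s y\<close> in simp)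
      next
        case 4
        then have "\<not> s y" by (simp add: s_def)
        from s2[OF 4(1) yW] eva(2)[OF yW 4(2)] show ?thesis
          by eventually_elim (use \<open>\<not> s y\<close> in simp)
      qed
    next
      fix y assume y: "y \<in> W'" "y \<in> S - \<Gamma>"
      then have yW: "y \<in> W" using W'W by blast
      have "T y = 0" "Q y $ 2 \<ge> 0" using y Siff by blast+
      moreover have "Q y $ 2 \<noteq> 0"
        using \<Gamma>iff[OF y(1)] Piff[OF y(1)] h0[OF QV[OF y(1)]] \<open>T y = 0\<close> y(2) by auto
      ultimately have "Q y $ 2 > 0" by simp
      from s1[OF this yW] have "\<forall>\<^sub>F y' in nhds y. T y' \<noteq> 0 \<longrightarrow> s y' = (True = (T y' > 0))"
        by (rule eventually_mono) simp
      then show "\<exists>c. flips s y c" by (rule collar_flips_eventually[OF col y(2) yW])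
    next
      fix y assume y: "y \<in> W'" "y \<in> P - D - \<Gamma>"
      then have yW: "y \<in> W" using W'W by blast
      have "Q y $ 2 < 0" using y Eiff[OF y(1)] \<Gamma>iff[OF y(1)] by auto
      from s2[OF this yW] have "\<forall>\<^sub>F y' in nhds y. a \<bullet> y' \<noteq> b \<longrightarrow> s y' = (True = (b < a \<bullet> y'))"
        by (rule eventually_mono) simp
      then show "\<exists>c. \<forall>\<^sub>F y' in nhds y. a \<bullet> y' \<noteq> b \<longrightarrow> s y' = (c = (b < a \<bullet> y'))" by (rule exI)
    qed
    then show ?thesis by (intro exI[of _ s])
  next
    assume h: "A2 \<subseteq> D \<and> A1 \<inter> D = {}"
    have Eiff: "y \<in> P - D \<longleftrightarrow> y \<in> P \<and> Q y $ 2 \<ge> 0" if y: "y \<in> W'" for y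
      using h A1iff[OF y] A2iff[OF y] notD[OF y]
      by (cases "Q y $ 2" "0::real" rule: linorder_cases) auto
    \<comment> \<open>Points strictly between \<open>S\<close> and \<open>P\<close>: the two heights
      have opposite signs. By \<open>edge\<close> this region closes up over the edge, where the
      product is a nonnegative multiple of \<open>(T y)\<^sup>2\<close>.\<close>
    define s where "s y \<longleftrightarrow> Q y $ 2 > 0 \<and> T y * (a \<bullet> y - b) < 0" for y
    have cp: "continuous_on W (\<lambda>y. T y * (a \<bullet> y - b))" by (intro continuous_intros cont_T)
    note evp = eventually_pos[OF open_W cp]
    have "side_fun W' s"
    proof (rule side_funI)
      fix y assume y: "y \<in> W'" "y \<notin> X"
      then have yW: "y \<in> W" using W'W by blast
      have ne: "Q y $ 2 \<ge> 0 \<longrightarrow> T y \<noteq> 0 \<and> a \<bullet> y - b \<noteq> 0"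
        using y Siff[OF y(1)] Eiff[OF y(1)] unfolding X_def by (auto simp: P_def)
      have "T y * (T y * \<eta>) > 0" if "T y \<noteq> 0"
      proof -
        have "(T y)\<^sup>2 * \<eta> > 0" using that \<eta> by (intro mult_pos_pos) auto
        then show ?thesis by (simp add: power2_eq_square mult.assoc)
      qed
      then have e: "T y * (a \<bullet> y - b) > 0" if "Q y $ 2 = 0"
        using ne edge[OF y(1) that] that by simp
      have ne': "Q y $ 2 \<ge> 0 \<Longrightarrow> T y * (a \<bullet> y - b) \<noteq> 0" using ne by simp
      consider "Q y $ 2 < 0" | "T y * (a \<bullet> y - b) > 0" | "Q y $ 2 > 0" "T y * (a \<bullet> y - b) < 0"
        using ne' e by linarith
      then show "\<forall>\<^sub>F y' in nhds y. s y' = s y"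
      proof cases
        case 1
        then have "\<not> s y" by (simp add: s_def)
        from evQ(2)[OF yW 1] show ?thesis
          by eventually_elim (use \<open>\<not> s y\<close> in \<open>simp add: s_def\<close>)
      next
        case 2
        then have "\<not> s y" by (simp add: s_def)
        from evp(1)[OF yW 2] show ?thesis
          by eventually_elim (use \<open>\<not> s y\<close> in \<open>simp add: s_def\<close>)
      next
        case 3
        then have "s y" by (simp add: s_def)
        from evQ(1)[OF yW 3(1)] evp(2)[OF yW 3(2)] show ?thesis
          by eventually_elim (use \<open>s y\<close> in \<open>simp add: s_def\<close>)
      qed
    next
      fix y assume y: "y \<in> W'" "y \<in> S - \<Gamma>"
      then have yW: "y \<in> W" using W'W by blast
      have yT: "T y = 0" "Q y $ 2 \<ge> 0" using y Siff by blast+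
      have "Q y $ 2 \<noteq> 0"
        using \<Gamma>iff[OF y(1)] Piff[OF y(1)] h0[OF QV[OF y(1)]] yT y(2) by auto
      then have Q: "Q y $ 2 > 0" using yT by simp
      \<comment> \<open>Away from \<Gamma> the sheets are disjoint, so near \<open>y\<close> the
        height over \<open>P\<close> keeps its sign and membership in the wedge is decided by
        \<open>T\<close> alone.\<close>
      have "y \<notin> P - D" using y(2) S_Int_exterior by blast
      then have "a \<bullet> y - b \<noteq> 0" using Eiff[OF y(1)] yT by (auto simp: P_def)
      then consider "a \<bullet> y - b > 0" | "a \<bullet> y - b < 0" by linarith
      then show "\<exists>c. flips s y c"
      proof cases
        case 1
        from evQ(1)[OF yW Q] eva(1)[OF yW 1]
        have "\<forall>\<^sub>F y' in nhds y. T y' \<noteq> 0 \<longrightarrow> s y' = (False = (T y' > 0))"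
          by eventually_elim (auto simp: s_def mult_less_0_iff)
        then show ?thesis by (rule collar_flips_eventually[OF col y(2) yW])
      next
        case 2
        from evQ(1)[OF yW Q] eva(2)[OF yW 2]
        have "\<forall>\<^sub>F y' in nhds y. T y' \<noteq> 0 \<longrightarrow> s y' = (True = (T y' > 0))"
          by eventually_elim (auto simp: s_def mult_less_0_iff)
        then show ?thesis by (rule collar_flips_eventually[OF col y(2) yW])
      qed
    next
      fix y assume y: "y \<in> W'" "y \<in> P - D - \<Gamma>"
      then have yW: "y \<in> W" using W'W by blast
      have Q: "Q y $ 2 > 0" using y Eiff[OF y(1)] \<Gamma>iff[OF y(1)] by auto
      have "y \<notin> S" using y(2) S_Int_exterior by blast
      then have "T y \<noteq> 0" using Siff[OF y(1)] Q by simp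
      then consider "T y > 0" | "T y < 0" by linarith
      then show "\<exists>c. \<forall>\<^sub>F y' in nhds y. a \<bullet> y' \<noteq> b \<longrightarrow> s y' = (c = (b < a \<bullet> y'))"
      proof cases
        case 1
        from evQ(1)[OF yW Q] evT(1)[OF yW 1]
        have "\<forall>\<^sub>F y' in nhds y. a \<bullet> y' \<noteq> b \<longrightarrow> s y' = (False = (b < a \<bullet> y'))"
          by eventually_elim (auto simp: s_def mult_less_0_iff)
        then show ?thesis by (rule exI)
      next
        case 2
        from evQ(1)[OF yW Q] evT(2)[OF yW 2]
        have "\<forall>\<^sub>F y' in nhds y. a \<bullet> y' \<noteq> b \<longrightarrow> s y' = (True = (b < a \<bullet> y'))"
          by eventually_elim (auto simp: s_def mult_less_0_iff)
        then show ?thesis by (rule exI)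
      qed
    qed
    then show ?thesis by (intro exI[of _ s])
  qed
  moreover obtain r where "r > 0" "ball (\<phi> q0) r \<subseteq> W'" using \<open>open W'\<close> xW' openE by blast
  ultimately show ?thesis using side_fun_subset by blast
qed

lemma side_fun_exists:
  "\<exists>r>0. \<exists>s. side_fun (ball x r) s"
proof (cases "x \<in> \<Gamma>")
  case True
  then obtain V \<phi> q where "local_parametrization S V \<phi>" "q \<in> V" "q $ 2 = 0" "\<phi> q = x"
    using boundary_chart[OF True] by blast
  then show ?thesis using side_fun_transversal side_fun_tangential by blast
next
  case False
  then show ?thesis by (rule side_fun_exists_off_\<Gamma>)
qed

end

section \<open>Gluing local side functions over a box\<close>

definition upd :: "real^3 \<Rightarrow> 3 \<Rightarrow> real \<Rightarrow> real^3" where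
  "upd \<alpha> k m = (\<chi> i. if i = k then m else \<alpha> $ i)"

lemma upd_nth [simp]: "upd \<alpha> k m $ i = (if i = k then m else \<alpha> $ i)"
  by (simp add: upd_def)

lemma upd_upd [simp]: "upd (upd \<alpha> k m) k n = upd \<alpha> k n"
  by (simp add: vec_eq_iff)

lemma upd_same [simp]: "upd \<alpha> k (\<alpha> $ k) = \<alpha>"
  by (simp add: vec_eq_iff)

text \<open>The margin makes even degenerate boxes, down to a single point, open and lets boxes with
  a common face overlap.\<close>

definition widened_box :: "real \<Rightarrow> real^3 \<Rightarrow> real^3 \<Rightarrow> (real^3) set" where
  "widened_box \<epsilon> \<alpha> \<beta> = {y. \<forall>i. \<alpha> $ i - \<epsilon> < y $ i \<and> y $ i < \<beta> $ i + \<epsilon>}"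

lemma widened_box_eq: "widened_box \<epsilon> \<alpha> \<beta> = box (\<chi> i. \<alpha> $ i - \<epsilon>) (\<chi> i. \<beta> $ i + \<epsilon>)"
  by (auto simp: widened_box_def mem_box_cart)

lemma open_widened_box: "open (widened_box \<epsilon> \<alpha> \<beta>)" and convex_widened_box: "convex (widened_box \<epsilon> \<alpha> \<beta>)"
  by (simp_all add: widened_box_eq open_box convex_box)

lemma widened_box_mono: "\<epsilon> \<le> \<epsilon>' \<Longrightarrow> widened_box \<epsilon> \<alpha> \<beta> \<subseteq> widened_box \<epsilon>' \<alpha> \<beta>"
  unfolding widened_box_def by (smt (verit) Collect_mono_iff)

context spanning_surface
begin

definition has_side_fun :: "real^3 \<Rightarrow> real^3 \<Rightarrow> bool" where
  "has_side_fun \<alpha> \<beta> \<longleftrightarrow> (\<exists>\<epsilon>>0. \<exists>s. side_fun (widened_box \<epsilon> \<alpha> \<beta>) s)"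

text \<open>The two widened boxes overlap in a convex slab around the face at height
  \<open>m\<close>. Off \<Gamma> this slab is connected, so the two functions differ by a global
  sign there, and the second one is corrected by it.\<close>

lemma has_side_fun_glue:
  assumes 1: "has_side_fun \<alpha> (upd \<beta> k m)" and 2: "has_side_fun (upd \<alpha> k m) \<beta>"
    and m: "\<alpha> $ k \<le> m" "m \<le> \<beta> $ k"
  shows "has_side_fun \<alpha> \<beta>"
proof -
  obtain \<epsilon>1 s1 where s1: "\<epsilon>1 > 0" "side_fun (widened_box \<epsilon>1 \<alpha> (upd \<beta> k m)) s1"
    using 1 unfolding has_side_fun_def by blast
  obtain \<epsilon>2 s2 where s2: "\<epsilon>2 > 0" "side_fun (widened_box \<epsilon>2 (upd \<alpha> k m) \<beta>) s2"
    using 2 unfolding has_side_fun_def by blast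
  define \<epsilon> where "\<epsilon> = min \<epsilon>1 \<epsilon>2"
  have \<epsilon>: "\<epsilon> > 0" "\<epsilon> \<le> \<epsilon>1" "\<epsilon> \<le> \<epsilon>2" using s1 s2 by (auto simp: \<epsilon>_def)
  define O1 where "O1 = widened_box \<epsilon> \<alpha> (upd \<beta> k m)"
  define O2 where "O2 = widened_box \<epsilon> (upd \<alpha> k m) \<beta>"
  have op: "open O1" "open O2" "convex O1" "convex O2"
    unfolding O1_def O2_def by (rule open_widened_box convex_widened_box)+
  have t1: "side_fun O1 s1" unfolding O1_def by (rule side_fun_subset[OF s1(2) widened_box_mono[OF \<epsilon>(2)]])
  have t2: "side_fun O2 s2" unfolding O2_def by (rule side_fun_subset[OF s2(2) widened_box_mono[OF \<epsilon>(3)]])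
  have "connected (O1 \<inter> O2 - \<Gamma>)"
    by (rule connected_minus_\<Gamma>) (use op in \<open>auto intro: convex_Int\<close>)
  then obtain c where c: "\<And>y. y \<in> O1 \<inter> O2 - X \<Longrightarrow> s1 y = (s2 y = c)"
    using side_fun_unique[OF _ side_fun_subset[OF t1] side_fun_subset[OF t2]] by blast
  define s where "s y = (if y \<in> O1 then s1 y else (s2 y = c))" for y
  have "side_fun O1 s"
    by (rule side_fun_cong[OF t1 op(1), where k = True]) (simp add: s_def)
  moreover have "side_fun O2 s"
    by (rule side_fun_cong[OF t2 op(2), where k = c]) (use c in \<open>auto simp: s_def\<close>)
  ultimately have "side_fun (O1 \<union> O2) s" by (rule side_fun_Un)
  moreover have "widened_box \<epsilon> \<alpha> \<beta> \<subseteq> O1 \<union> O2"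
  proof
    fix y assume y: "y \<in> widened_box \<epsilon> \<alpha> \<beta>"
    show "y \<in> O1 \<union> O2"
    proof (cases "y $ k < m + \<epsilon>")
      case True
      then show ?thesis using y by (simp add: O1_def widened_box_def)
    next
      case False
      then have "y $ k > m - \<epsilon>" using \<epsilon>(1) by simp
      then show ?thesis using y by (simp add: O2_def widened_box_def)
    qed
  qed
  ultimately have "side_fun (widened_box \<epsilon> \<alpha> \<beta>) s" using side_fun_subset by blast
  then show ?thesis using \<epsilon>(1) unfolding has_side_fun_def by blast
qed

text \<open>Bisection in one coordinate: the property is additive over adjacent intervals and, by
  the margin around each slice, holds for all short intervals containing a given point.\<close>

lemma has_side_fun_sweep:
  assumes le: "\<alpha> $ k \<le> \<beta> $ k"
    and slices: "\<And>c. \<alpha> $ k \<le> c \<Longrightarrow> c \<le> \<beta> $ k \<Longrightarrow> has_side_fun (upd \<alpha> k c) (upd \<beta> k c)"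
  shows "has_side_fun \<alpha> \<beta>"
proof -
  have "has_side_fun (upd \<alpha> k (\<alpha> $ k)) (upd \<beta> k (\<beta> $ k))"
    using le
  proof (induction rule: Bolzano)
    case (trans u m w)
    show ?case
      by (rule has_side_fun_glue[where k = k and m = m]) (use trans in simp_all)
  next
    case (local x)
    then obtain \<epsilon> s where s: "\<epsilon> > 0" "side_fun (widened_box \<epsilon> (upd \<alpha> k x) (upd \<beta> k x)) s"
      using slices unfolding has_side_fun_def by blast
    \<comment> \<open>Half of the margin absorbs the width of the interval, the other half remains
      as the new margin.\<close>
    show ?case
    proof (intro exI[of _ "\<epsilon>/2"] conjI allI impI)
      fix u w assume uw: "u \<le> x \<and> x \<le> w \<and> w - u < \<epsilon> / 2"
      have "widened_box (\<epsilon>/2) (upd \<alpha> k u) (upd \<beta> k w) \<subseteq> widened_box \<epsilon> (upd \<alpha> k x) (upd \<beta> k x)"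
      proof
        fix y assume y: "y \<in> widened_box (\<epsilon>/2) (upd \<alpha> k u) (upd \<beta> k w)"
        have "upd \<alpha> k x $ i - \<epsilon> < y $ i \<and> y $ i < upd \<beta> k x $ i + \<epsilon>" for i
        proof -
          have "upd \<alpha> k u $ i - \<epsilon>/2 < y $ i \<and> y $ i < upd \<beta> k w $ i + \<epsilon>/2"
            using y unfolding widened_box_def by blast
          then show ?thesis using uw s(1) by (auto split: if_splits)
        qed
        then show "y \<in> widened_box \<epsilon> (upd \<alpha> k x) (upd \<beta> k x)" unfolding widened_box_def by blast
      qed
      then show "has_side_fun (upd \<alpha> k u) (upd \<beta> k w)"
        using side_fun_subset[OF s(2)] s(1) half_gt_zero unfolding has_side_fun_def by blast
    qed (use s in simp)
  qed
  then show ?thesis by simp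
qed

lemma has_side_fun_point: "has_side_fun x x"
proof -
  obtain r s where r: "r > 0" "side_fun (ball x r) s" using side_fun_exists by blast
  have "widened_box (r/3) x x \<subseteq> ball x r"
  proof
    fix y assume y: "y \<in> widened_box (r/3) x x"
    have "norm (x - y) \<le> (\<Sum>i\<in>UNIV. \<bar>(x - y) $ i\<bar>)" by (rule norm_le_l1_cart)
    also have "\<dots> < (\<Sum>i\<in>(UNIV::3 set). r/3)"
    proof (rule sum_strict_mono)
      fix i :: 3
      have "x $ i - r/3 < y $ i \<and> y $ i < x $ i + r/3" using y unfolding widened_box_def by blast
      then show "\<bar>(x - y) $ i\<bar> < r/3" unfolding vector_minus_component by linarith
    qed auto
    also have "\<dots> = r" by simp
    finally show "y \<in> ball x r" by (simp add: dist_norm)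
  qed
  then have "side_fun (widened_box (r/3) x x) s" by (rule side_fun_subset[OF r(2)])
  then show ?thesis unfolding has_side_fun_def using r(1) by (intro exI[of _ "r/3"]) auto
qed

text \<open>Induction on the coordinates in which the corners differ: a slice has one such
  coordinate fewer, and the base case is a point.\<close>

lemma has_side_fun_box:
  assumes "\<And>i. \<alpha> $ i \<le> \<beta> $ i"
  shows "has_side_fun \<alpha> \<beta>"
proof -
  have "has_side_fun \<alpha> \<beta>" if "finite J" "{i. \<alpha> $ i \<noteq> \<beta> $ i} \<subseteq> J" "\<And>i. \<alpha> $ i \<le> \<beta> $ i" for J :: "3 set" and \<alpha> \<beta>
    using that
  proof (induction J arbitrary: \<alpha> \<beta> rule: finite_induct)
    case empty
    then have "\<alpha> = \<beta>" by (auto simp: vec_eq_iff)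
    then show ?case using has_side_fun_point by simp
  next
    case (insert k J)
    show ?case
    proof (rule has_side_fun_sweep)
      show "\<alpha> $ k \<le> \<beta> $ k" by (rule insert.prems)
      show "has_side_fun (upd \<alpha> k c) (upd \<beta> k c)" for c
        by (rule insert.IH) (use insert.prems in \<open>auto split: if_splits\<close>)
    qed
  qed
  from this[OF finite subset_UNIV assms] show ?thesis .
qed

lemma side_fun_bounded:
  assumes "bounded M"
  obtains U s where "open U" "convex U" "M \<subseteq> U" "side_fun U s"
proof -
  obtain L where L: "\<And>x. x \<in> M \<Longrightarrow> norm x \<le> L" using assms unfolding bounded_iff by blast
  have "has_side_fun (\<chi> i. - \<bar>L\<bar>) (\<chi> i. \<bar>L\<bar>)" by (rule has_side_fun_box) simp
  then obtain \<epsilon> s where s: "\<epsilon> > 0" "side_fun (widened_box \<epsilon> (\<chi> i. - \<bar>L\<bar>) (\<chi> i. \<bar>L\<bar>)) s"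
    unfolding has_side_fun_def by blast
  have "M \<subseteq> widened_box \<epsilon> (\<chi> i. - \<bar>L\<bar>) (\<chi> i. \<bar>L\<bar>)"
  proof
    fix x assume x: "x \<in> M"
    have "\<bar>x $ i\<bar> \<le> \<bar>L\<bar>" for i using component_le_norm_cart[of x i] L[OF x] by linarith
    then have "- \<bar>L\<bar> - \<epsilon> < x $ i \<and> x $ i < \<bar>L\<bar> + \<epsilon>" for i
      using s(1) by (smt (verit))
    then show "x \<in> widened_box \<epsilon> (\<chi> i. - \<bar>L\<bar>) (\<chi> i. \<bar>L\<bar>)" by (simp add: widened_box_def)
  qed
  then show thesis using that open_widened_box convex_widened_box s(2) by blast
qed

section \<open>Propagation of sides and comparison of the normals at the extrema\<close>

lemma side_fun_constant:
  assumes s: "side_fun U s" and C: "connected C" "C \<subseteq> U - X" and xy: "x \<in> C" "y \<in> C"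
  shows "s x = s y"
proof (rule ccontr)
  assume ne: "s x \<noteq> s y"
  define G where "G c = \<Union>{ball z r |z r. \<forall>w\<in>ball z r. s w = c}" for c
  have op: "open (G c)" for c unfolding G_def by blast
  have G: "w \<in> G c \<Longrightarrow> s w = c" for w c unfolding G_def by blast
  have cov: "w \<in> G (s w)" if w: "w \<in> C" for w
  proof -
    obtain r where "r > 0" "\<forall>y\<in>ball w r. s y = s w" using s C(2) w unfolding side_fun_def by blast
    then show ?thesis unfolding G_def using centre_in_ball[of w r] by blast
  qed
  have "G True \<inter> C = {} \<or> G False \<inter> C = {}"
  proof (rule connectedD[OF C(1) op op])
    show "G True \<inter> G False \<inter> C = {}" using G by blast
    show "C \<subseteq> G True \<union> G False" using cov by (metis (full_types) UnCI subsetI)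
  qed
  then show False using cov[OF xy(1)] cov[OF xy(2)] xy ne by (cases "s x"; cases "s y") auto
qed

text \<open>The value on the side of \<open>N\<close> is locally constant along
  \<open>S - \<Gamma>\<close>, thanks to the uniform radius in \<open>flips\<close>, and the
  interior of a connected surface is connected.\<close>

lemma flips_constant:
  assumes s: "side_fun U s" and SU: "S \<subseteq> U" and xy: "x \<in> S - \<Gamma>" "y \<in> S - \<Gamma>"
    and c: "flips s x c" "flips s y c'"
  shows "c = c'"
proof (rule ccontr)
  assume ne: "c \<noteq> c'"
  define G where "G c = \<Union>{ball z r |z r. \<forall>x'\<in>S. \<forall>t. dist x' z < r \<longrightarrow> 0 < t \<longrightarrow> t < r \<longrightarrow>
     s (x' + t *\<^sub>R N x') = c}" for c
  have op: "open (G c)" for c unfolding G_def by blast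
  have Gflips: "z \<in> G c" if "flips s z c" for z c
  proof -
    obtain r where r: "r > 0" "\<forall>x'\<in>S. \<forall>t. dist x' z < r \<longrightarrow> 0 < t \<longrightarrow> t < r \<longrightarrow> s (x' + t *\<^sub>R N x') = c"
      using \<open>flips s z c\<close> unfolding flips_def by blast
    then show ?thesis unfolding G_def using centre_in_ball[of z r] by blast
  qed
  have G: "\<exists>r>0. \<forall>t. 0 < t \<longrightarrow> t < r \<longrightarrow> s (w + t *\<^sub>R N w) = c" if wG: "w \<in> G c" and wS: "w \<in> S" for w c
  proof -
    obtain z r where zr: "w \<in> ball z r" "\<forall>x'\<in>S. \<forall>t. dist x' z < r \<longrightarrow> 0 < t \<longrightarrow> t < r \<longrightarrow> s (x' + t *\<^sub>R N x') = c"
      using wG unfolding G_def by blast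
    then have "dist w z < r" by (simp add: dist_commute)
    moreover from this have "r > 0" by (meson le_less_trans zero_le_dist)
    ultimately show ?thesis using zr(2) wS by blast
  qed
  have unique: "c = c'" if w: "w \<in> G c" "w \<in> G c'" "w \<in> S" for w c c'
  proof -
    obtain r where r: "r > 0" "\<forall>t. 0 < t \<longrightarrow> t < r \<longrightarrow> s (w + t *\<^sub>R N w) = c" using G[OF w(1,3)] by blast
    obtain r' where r': "r' > 0" "\<forall>t. 0 < t \<longrightarrow> t < r' \<longrightarrow> s (w + t *\<^sub>R N w) = c'" using G[OF w(2,3)] by blast
    define t where "t = min r r' / 2"
    have "0 < t" "t < r" "t < r'" using r(1) r'(1) by (auto simp: t_def)
    then show ?thesis using r(2) r'(2) by blast
  qed
  have "connected (S - \<Gamma>)"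
    using surface_interior_connected[OF embedded S_connected] by (simp add: interior_eq)
  then have "G True \<inter> (S - \<Gamma>) = {} \<or> G False \<inter> (S - \<Gamma>) = {}"
  proof (rule connectedD[OF _ op op])
    show "G True \<inter> G False \<inter> (S - \<Gamma>) = {}" using unique by blast
    show "S - \<Gamma> \<subseteq> G True \<union> G False"
    proof
      fix w assume w: "w \<in> S - \<Gamma>"
      then obtain c where "flips s w c" using s SU unfolding side_fun_def by blast
      then show "w \<in> G True \<union> G False" using Gflips by (metis (full_types) UnCI)
    qed
  qed
  moreover have "x \<in> G c" "y \<in> G c'" using c Gflips by blast+
  ultimately show False using ne xy by (cases c; cases c') auto
qed

text \<open>Everything above \<open>q\<close> carries one value and everything below
  \<open>p\<close> the other, as a vertical segment through a far exterior point crosses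
  \<open>X\<close> once. If \<open>N q\<close> points up, its side has the upper value; if
  \<open>N p\<close> points up, then \<open>- N p\<close> leads to the lower value, so again the
  side of \<open>N p\<close> has the upper one. Since this value is the same at \<open>p\<close> and
  \<open>q\<close>, so is the direction.\<close>

lemma normals_at_extrema_agree:
  assumes p: "p \<in> S - \<Gamma>" "\<And>x. x \<in> S \<Longrightarrow> a \<bullet> p \<le> a \<bullet> x" "a \<bullet> p \<le> b"
    and q: "q \<in> S - \<Gamma>" "\<And>x. x \<in> S \<Longrightarrow> a \<bullet> x \<le> a \<bullet> q" "b \<le> a \<bullet> q"
    and Np: "N p = sgn a \<or> N p = - sgn a" and Nq: "N q = sgn a \<or> N q = - sgn a"
  shows "N p = N q"
proof -
  define \<eta> where "\<eta> = a \<bullet> a"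
  have \<eta>: "\<eta> > 0" using a by (simp add: \<eta>_def)
  have asgn: "a \<bullet> sgn a > 0" using a by (simp add: sgn_div_norm)
  have sgn_ne: "sgn a \<noteq> - sgn a"
  proof
    assume "sgn a = - sgn a"
    then have "a \<bullet> sgn a = - (a \<bullet> sgn a)" by (metis inner_minus_right)
    then show False using asgn by simp
  qed
  obtain R where R: "\<And>x. x \<in> S \<Longrightarrow> norm x \<le> R" using compact_imp_bounded[OF S_compact] unfolding bounded_iff by blast
  obtain z where z: "z \<in> P - \<Gamma> - D" "\<And>t. norm (z + t *\<^sub>R a) > R" using far_exterior_point by blast
  have az: "a \<bullet> z = b" using z(1) by (simp add: P_def)
  \<comment> \<open>The added 1 takes the ends of the segment strictly above \<open>q\<close> and
    strictly below \<open>p\<close>.\<close>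
  define t1 where "t1 = (a \<bullet> q - b) / \<eta> + 1"
  define t2 where "t2 = (b - a \<bullet> p) / \<eta> + 1"
  have t12: "t1 > 0" "t2 > 0" "t1 * \<eta> > a \<bullet> q - b" "t2 * \<eta> > b - a \<bullet> p"
    using p(3) q(3) \<eta> by (auto simp: t1_def t2_def field_simps add_pos_nonneg)
  have "bounded (S \<union> {z, z + t1 *\<^sub>R a, z - t2 *\<^sub>R a})"
    using compact_imp_bounded[OF S_compact] by simp
  then obtain U s where U: "open U" "convex U" "S \<union> {z, z + t1 *\<^sub>R a, z - t2 *\<^sub>R a} \<subseteq> U" and s: "side_fun U s"
    using side_fun_bounded by blast
  have XI: "y \<notin> X" if "a \<bullet> y > a \<bullet> q \<or> a \<bullet> y < a \<bullet> p" for y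
    using that p(2)[of y] q(2)[of y] p(3) q(3) unfolding X_def by (auto simp: P_def)
  define Top where "Top = U \<inter> {y. a \<bullet> y > a \<bullet> q}"
  define Bot where "Bot = U \<inter> {y. a \<bullet> y < a \<bullet> p}"
  have Top: "connected Top" "Top \<subseteq> U - X" and Bot: "connected Bot" "Bot \<subseteq> U - X"
    unfolding Top_def Bot_def using U(2) XI
    by (auto intro!: convex_connected convex_Int convex_halfspace_gt convex_halfspace_lt)
  \<comment> \<open>The line is too far out to meet \<open>S\<close>, and it meets \<open>P\<close>
    in \<open>z\<close> only.\<close>
  have line: "z + t *\<^sub>R a \<notin> X" if "t \<noteq> 0" for t
    using z(2)[of t] R[of "z + t *\<^sub>R a"] that \<eta> az unfolding X_def by (auto simp: P_def inner_add_right \<eta>_def)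
  have "z \<in> U \<inter> (P - D - \<Gamma>)" using z(1) U(3) by blast
  then obtain r c where r: "r > 0" "\<forall>y\<in>ball z r. a \<bullet> y \<noteq> b \<longrightarrow> s y = (c = (a \<bullet> y > b))"
    using s unfolding side_fun_def by blast
  \<comment> \<open>Close enough to \<open>z\<close> for the local description at
    \<open>P - D\<close>, and not beyond either end of the segment.\<close>
  define \<tau> where "\<tau> = min (r / norm a / 2) (min t1 t2)"
  have \<tau>: "\<tau> > 0" "\<tau> * norm a < r" "\<tau> \<le> t1" "\<tau> \<le> t2"
  proof -
    have "\<tau> \<le> r / norm a / 2" by (simp add: \<tau>_def)
    then show "\<tau> * norm a < r" using r(1) a by (simp add: field_simps)
  qed (use r(1) a t12 in \<open>auto simp: \<tau>_def\<close>)
  have seg: "s (z + (\<sigma> * \<tau>) *\<^sub>R a) = s (z + (\<sigma> * t) *\<^sub>R a)"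
    if "\<tau> \<le> t" "\<sigma> = 1 \<or> \<sigma> = -1" "z + (\<sigma> * t) *\<^sub>R a \<in> U" for \<sigma> t
  proof (rule side_fun_constant[OF s])
    let ?C = "closed_segment (z + (\<sigma> * \<tau>) *\<^sub>R a) (z + (\<sigma> * t) *\<^sub>R a)"
    show "connected ?C" by simp
    have param: "\<exists>u\<ge>\<tau>. u \<le> t \<and> y = z + (\<sigma> * u) *\<^sub>R a" if y: "y \<in> ?C" for y
    proof -
      obtain u where u: "0 \<le> u" "u \<le> 1" "y = (1 - u) *\<^sub>R (z + (\<sigma> * \<tau>) *\<^sub>R a) + u *\<^sub>R (z + (\<sigma> * t) *\<^sub>R a)"
        using y unfolding in_segment by blast
      define w where "w = \<tau> + u * (t - \<tau>)"
      have "y = z + (\<sigma> * w) *\<^sub>R a" unfolding u(3) w_def by (simp add: algebra_simps)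
      moreover have "u * (t - \<tau>) \<le> 1 * (t - \<tau>)" using u \<open>\<tau> \<le> t\<close> by (intro mult_right_mono) auto
      moreover have "u * (t - \<tau>) \<ge> 0" using u \<open>\<tau> \<le> t\<close> by simp
      ultimately show ?thesis by (intro exI[of _ w]) (simp add: w_def)
    qed
    have "y \<in> U" if y: "y \<in> ?C" for y
    proof -
      obtain u where u: "\<tau> \<le> u" "u \<le> t" "y = z + (\<sigma> * u) *\<^sub>R a" using param[OF y] by blast
      have "t > 0" using \<open>\<tau> \<le> t\<close> \<tau>(1) by simp
      then have "y = (1 - u/t) *\<^sub>R z + (u/t) *\<^sub>R (z + (\<sigma> * t) *\<^sub>R a)" unfolding u(3) by (simp add: algebra_simps)
      moreover have "0 \<le> u/t" "u/t \<le> 1" using u \<tau>(1) \<open>t > 0\<close> by auto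
      moreover have "z \<in> U" using U(3) by blast
      ultimately show ?thesis using U(2) \<open>z + (\<sigma> * t) *\<^sub>R a \<in> U\<close> unfolding convex_alt by auto
    qed
    moreover have "y \<notin> X" if y: "y \<in> ?C" for y
    proof -
      obtain u where u: "\<tau> \<le> u" "y = z + (\<sigma> * u) *\<^sub>R a" using param[OF y] by blast
      then show ?thesis using line[of "\<sigma> * u"] \<tau>(1) \<open>\<sigma> = 1 \<or> \<sigma> = -1\<close> by auto
    qed
    ultimately show "?C \<subseteq> U - X" by blast
  qed auto
  have nearz: "s (z + (\<sigma> * \<tau>) *\<^sub>R a) = (c = (\<sigma> > 0))" if "\<sigma> = 1 \<or> \<sigma> = -1" for \<sigma>
  proof -
    have "z + (\<sigma> * \<tau>) *\<^sub>R a \<in> ball z r" using \<tau> that by (auto simp: dist_norm)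
    moreover have eq: "a \<bullet> (z + (\<sigma> * \<tau>) *\<^sub>R a) = b + \<sigma> * (\<tau> * \<eta>)" using az by (simp add: inner_add_right \<eta>_def)
    moreover have pos: "\<tau> * \<eta> > 0" using \<tau> \<eta> by simp
    ultimately have "s (z + (\<sigma> * \<tau>) *\<^sub>R a) = (c = (b + \<sigma> * (\<tau> * \<eta>) > b))"
      using r(2) that by force
    then show ?thesis using pos that by (auto simp: zero_less_mult_iff)
  qed
  have "z + t1 *\<^sub>R a \<in> Top"
    using U(3) az t12 by (simp add: Top_def inner_add_right \<eta>_def[symmetric])
  moreover have "s (z + t1 *\<^sub>R a) = c"
    using seg[of t1 1] nearz[of 1] U(3) \<tau> by simp
  ultimately have sTop: "s y = c" if "y \<in> Top" for y using side_fun_constant[OF s Top that] by metis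
  have "z - t2 *\<^sub>R a \<in> Bot"
    using U(3) az t12 by (simp add: Bot_def inner_diff_right \<eta>_def[symmetric])
  moreover have "s (z - t2 *\<^sub>R a) = (\<not> c)"
    using seg[of t2 "-1"] nearz[of "-1"] U(3) \<tau> by auto
  ultimately have sBot: "s y = (\<not> c)" if "y \<in> Bot" for y using side_fun_constant[OF s Bot that] by metis
  have "p \<in> U" "q \<in> U" using p(1) q(1) U(3) by blast+
  then obtain cp cq where cp: "flips s p cp" and cq: "flips s q cq"
    using s p(1) q(1) unfolding side_fun_def by blast
  have nearU: "\<exists>t. 0 < t \<and> t < r \<and> x + t *\<^sub>R u \<in> U \<and> x - t *\<^sub>R u \<in> U" if x: "x \<in> U" and u: "norm u = 1" and r: "r > 0" for x u r
  proof -
    obtain e where e: "e > 0" "ball x e \<subseteq> U" using U(1) x openE by blast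
    have "x + (min e r / 2) *\<^sub>R u \<in> ball x e" "x - (min e r / 2) *\<^sub>R u \<in> ball x e"
      using e(1) u r by (auto simp: dist_norm)
    then show ?thesis using e r by (intro exI[of _ "min e r / 2"]) auto
  qed
  have "cq = (c = (N q = sgn a))"
  proof -
    obtain r where r: "r > 0" "\<And>t. 0 < t \<Longrightarrow> t < r \<Longrightarrow> s (q + t *\<^sub>R N q) = cq \<and> s (q - t *\<^sub>R N q) = (\<not> cq)"
      using cq q(1) unfolding flips_def by (metis DiffD1 dist_self)
    obtain t where t: "0 < t" "t < r" "q + t *\<^sub>R N q \<in> U" "q - t *\<^sub>R N q \<in> U"
      using nearU[OF \<open>q \<in> U\<close> norm_N r(1)] q(1) by blast
    have ta: "t * (a \<bullet> sgn a) > 0" using t(1) asgn by simp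
    show ?thesis
    proof (cases "N q = sgn a")
      case True
      then have "q + t *\<^sub>R N q \<in> Top" using t ta by (simp add: Top_def inner_add_right)
      then show ?thesis using sTop r(2)[OF t(1,2)] True by auto
    next
      case False
      then have "q - t *\<^sub>R N q \<in> Top" using t ta Nq by (auto simp: Top_def inner_add_right)
      then show ?thesis using sTop r(2)[OF t(1,2)] False by auto
    qed
  qed
  moreover have "cp = (c = (N p = sgn a))"
  proof -
    obtain r where r: "r > 0" "\<And>t. 0 < t \<Longrightarrow> t < r \<Longrightarrow> s (p + t *\<^sub>R N p) = cp \<and> s (p - t *\<^sub>R N p) = (\<not> cp)"
      using cp p(1) unfolding flips_def by (metis DiffD1 dist_self)
    obtain t where t: "0 < t" "t < r" "p + t *\<^sub>R N p \<in> U" "p - t *\<^sub>R N p \<in> U"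
      using nearU[OF \<open>p \<in> U\<close> norm_N r(1)] p(1) by blast
    have ta: "t * (a \<bullet> sgn a) > 0" using t(1) asgn by simp
    show ?thesis
    proof (cases "N p = sgn a")
      case True
      then have "p - t *\<^sub>R N p \<in> Bot" using t ta by (simp add: Bot_def inner_diff_right)
      then show ?thesis using sBot r(2)[OF t(1,2)] True by auto
    next
      case False
      then have "p + t *\<^sub>R N p \<in> Bot" using t ta Np by (auto simp: Bot_def inner_diff_right)
      then show ?thesis using sBot r(2)[OF t(1,2)] False by auto
    qed
  qed
  moreover have "cp = cq"
    by (rule flips_constant[OF s _ p(1) q(1) cp cq]) (use U(3) in blast)
  ultimately have "(N p = sgn a) = (N q = sgn a)" by auto
  then show ?thesis using Np Nq by auto
qed

end

section \<open>Comparison with the tangent plane\<close>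

lemma orthonormal_expansion:
  fixes u :: "real^3"
  assumes e: "norm e1 = 1" "norm e2 = 1" "norm n = 1" "e1 \<bullet> e2 = 0" "n \<bullet> e1 = 0" "n \<bullet> e2 = 0"
  shows "u = (u \<bullet> e1) *\<^sub>R e1 + (u \<bullet> e2) *\<^sub>R e2 + (u \<bullet> n) *\<^sub>R n"
proof -
  have sq: "e1 \<bullet> e1 = 1" "e2 \<bullet> e2 = 1" "n \<bullet> n = 1" using e(1-3) by (simp_all add: dot_square_norm)
  have ne: "e1 \<noteq> e2" "n \<noteq> e1" "n \<noteq> e2" using sq e by auto
  have "independent {e1, e2, n}"
    by (rule pairwise_orthogonal_independent)
      (use e in \<open>auto simp: pairwise_def orthogonal_def inner_commute\<close>)
  then have "dim {e1, e2, n} = 3"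
    using dim_eq_card_independent ne by fastforce
  then have span: "span {e1, e2, n} = UNIV" using dim_eq_full[of "{e1, e2, n}"] by simp
  define w where "w = u - ((u \<bullet> e1) *\<^sub>R e1 + (u \<bullet> e2) *\<^sub>R e2 + (u \<bullet> n) *\<^sub>R n)"
  have "orthogonal w y" if "y \<in> {e1, e2, n}" for y
    using that sq e by (auto simp: orthogonal_def w_def inner_diff_left inner_add_left inner_diff_right inner_add_right inner_commute)
  then have "orthogonal w w" using orthogonal_to_span[of w "{e1, e2, n}" w] span by blast
  then have "w = 0" by (simp add: orthogonal_def)
  then show ?thesis by (simp add: w_def)
qed

text \<open>At a critical point of the height, \<open>a = c *\<^sub>R N x\<close> with
  \<open>c = a \<bullet> N x\<close>. The Hessian of the height is then \<open>c\<close> times the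
  second fundamental form, and its trace over the principal directions, \<open>2 * c * H\<close>, is
  nonnegative at a minimum.\<close>

lemma curvature_at_minimum:
  assumes gm: "gauss_map S N" and es: "embedded_surface S" and x: "x \<in> surface_interior S"
    and a: "a \<noteq> 0" and min: "\<And>y. y \<in> S \<Longrightarrow> a \<bullet> x \<le> a \<bullet> y"
  shows "N x = sgn a \<or> N x = - sgn a" "has_mean_curvature S N x H \<Longrightarrow> 0 \<le> H * (a \<bullet> N x)"
proof -
  obtain V \<phi> q where lp: "local_parametrization S V \<phi>" and q: "q \<in> V" "q $ 2 > 0" "\<phi> q = x"
    using interior_chart[OF es x] .
  note sm = local_parametrizationD(2)[OF lp]
  have qH: "q \<in> half_plane" using q by (simp add: half_plane_def)
  define n where "n = N x"
  have xS: "x \<in> S" using x by (simp add: surface_interior_def)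
  have n1: "norm n = 1" using gm xS unfolding gauss_map_def n_def by blast
  define B where "B = V \<inter> {x. x $ 2 > 0}"
  have B: "open B" "q \<in> B" unfolding B_def
    using q local_parametrizationD(1)[OF lp] by (auto intro!: open_Int open_halfspace_component_gt_cart)
  have dh: "((\<lambda>y. a \<bullet> \<phi> y) has_derivative (\<lambda>w. a \<bullet> fderiv \<phi> y w)) (at y)" if "y \<in> B" for y
    using smooth_on_has_derivative[OF sm] that by (intro has_derivative_inner_right) (auto simp: B_def)
  have dh2: "((\<lambda>y. a \<bullet> fderiv \<phi> y w) has_derivative (\<lambda>u. a \<bullet> fderiv (\<lambda>x. fderiv \<phi> x w) q u)) (at q)" for w
    by (intro has_derivative_inner_right smooth_on_has_derivative[OF smooth_on_fderiv[OF sm] q(1)])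
  have minB: "a \<bullet> \<phi> q \<le> a \<bullet> \<phi> y" if "y \<in> B" for y
    using min local_parametrizationD(4)[OF lp] that q(3) by (auto simp: B_def half_plane_def)
  have test: "a \<bullet> fderiv \<phi> q w = 0" "a \<bullet> fderiv (\<lambda>x. fderiv \<phi> x w) q w \<ge> 0" for w
    using second_derivative_test[OF B dh dh2 minB] by blast+
  have "n \<noteq> 0" using n1 by auto
  then have rng: "range (fderiv \<phi> q) = {u. n \<bullet> u = 0}"
    using range_fderiv_eq_normal_complement[OF sm q(1) local_parametrizationD(3)[OF lp q(1)]]
      gauss_map_orthogonal[OF gm lp q(1) qH] q(3) by (simp add: n_def)
  define c where "c = a \<bullet> n"
  have nn: "n \<bullet> n = 1" using n1 by (simp add: dot_square_norm)
  have nz: "n \<bullet> (a - c *\<^sub>R n) = 0" using nn by (simp add: c_def inner_diff_right inner_commute)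
  then obtain w where w: "a - c *\<^sub>R n = fderiv \<phi> q w" using rng by blast
  have "(a - c *\<^sub>R n) \<bullet> (a - c *\<^sub>R n) = a \<bullet> (a - c *\<^sub>R n) - c * (n \<bullet> (a - c *\<^sub>R n))"
    by (simp add: inner_diff_left)
  also have "\<dots> = 0" using nz test(1)[of w] w by simp
  finally have ac: "a = c *\<^sub>R n" by simp
  have "c \<noteq> 0" using a ac by auto
  have "sgn a = sgn c *\<^sub>R n" using n1 unfolding ac by (simp add: sgn_scaleR sgn_div_norm)
  then show "N x = sgn a \<or> N x = - sgn a"
    using \<open>c \<noteq> 0\<close> by (auto simp: n_def sgn_if split: if_splits)
  show "0 \<le> H * (a \<bullet> N x)" if H: "has_mean_curvature S N x H"
  proof -
    have H': "has_mean_curvature S N (\<phi> q) H" using H q(3) by simp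
    obtain w1 w2 where w: "N (\<phi> q) \<bullet> fderiv (\<lambda>x. fderiv \<phi> x w1) q w1 + N (\<phi> q) \<bullet> fderiv (\<lambda>x. fderiv \<phi> x w2) q w2 = 2 * H"
      using principal_curvature_sum[OF gm lp q(1,2) H'] by blast
    have "a \<bullet> fderiv (\<lambda>x. fderiv \<phi> x w) q w = c * (N (\<phi> q) \<bullet> fderiv (\<lambda>x. fderiv \<phi> x w) q w)" for w
      unfolding q(3) n_def[symmetric] by (subst ac) simp
    then have "c * (2 * H) \<ge> 0" unfolding w[symmetric] using test(2)[of w1] test(2)[of w2]
      by (simp add: distrib_left)
    then show ?thesis by (simp add: c_def n_def mult.commute)
  qed
qed

lemma curvature_at_maximum:
  assumes "gauss_map S N" "embedded_surface S" "x \<in> surface_interior S"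
    and "a \<noteq> 0" "\<And>y. y \<in> S \<Longrightarrow> a \<bullet> y \<le> a \<bullet> x"
  shows "N x = sgn a \<or> N x = - sgn a" "has_mean_curvature S N x H \<Longrightarrow> H * (a \<bullet> N x) \<le> 0"
  using curvature_at_minimum(1)[OF assms(1-3), of "- a"] curvature_at_minimum(2)[OF assms(1-3), of "- a" H]
    assms(4,5) by (auto simp: sgn_minus)

text \<open>Writes the second derivative through finitely many coefficient functions of the point,
  which makes its joint continuity in point and direction and its quadratic scaling visible.\<close>

lemma second_fderiv_expand:
  fixes \<phi> :: "real^2 \<Rightarrow> real^3"
  assumes sm: "smooth_on V \<phi>" and V: "open V" "x \<in> V"
  shows "fderiv (\<lambda>y. fderiv \<phi> y w) x u =
     w$1 *\<^sub>R (u$1 *\<^sub>R fderiv (\<lambda>y. fderiv \<phi> y (axis 1 1)) x (axis 1 1) + u$2 *\<^sub>R fderiv (\<lambda>y. fderiv \<phi> y (axis 1 1)) x (axis 2 1))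
     + w$2 *\<^sub>R (u$1 *\<^sub>R fderiv (\<lambda>y. fderiv \<phi> y (axis 2 1)) x (axis 1 1) + u$2 *\<^sub>R fderiv (\<lambda>y. fderiv \<phi> y (axis 2 1)) x (axis 2 1))"
proof -
  have d: "((\<lambda>y. fderiv \<phi> y v) has_derivative fderiv (\<lambda>y. fderiv \<phi> y v) x) (at x)" for v
    by (rule smooth_on_has_derivative[OF smooth_on_fderiv[OF sm] V(2)])
  have lin: "linear (fderiv (\<lambda>y. fderiv \<phi> y v) x)" for v
    by (rule smooth_on_linear[OF smooth_on_fderiv[OF sm] V(2)])
  have "((\<lambda>y. w$1 *\<^sub>R fderiv \<phi> y (axis 1 1) + w$2 *\<^sub>R fderiv \<phi> y (axis 2 1)) has_derivative
     (\<lambda>u. w$1 *\<^sub>R fderiv (\<lambda>y. fderiv \<phi> y (axis 1 1)) x u + w$2 *\<^sub>R fderiv (\<lambda>y. fderiv \<phi> y (axis 2 1)) x u)) (at x)"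
    by (intro has_derivative_add has_derivative_scaleR_right d)
  then have "((\<lambda>y. fderiv \<phi> y w) has_derivative
     (\<lambda>u. w$1 *\<^sub>R fderiv (\<lambda>y. fderiv \<phi> y (axis 1 1)) x u + w$2 *\<^sub>R fderiv (\<lambda>y. fderiv \<phi> y (axis 2 1)) x u)) (at x)"
    by (rule has_derivative_transform_within_open[OF _ V]) (simp add: linear_axis2[OF smooth_on_linear[OF sm], of _ w])
  then have "fderiv (\<lambda>y. fderiv \<phi> y w) x =
     (\<lambda>u. w$1 *\<^sub>R fderiv (\<lambda>y. fderiv \<phi> y (axis 1 1)) x u + w$2 *\<^sub>R fderiv (\<lambda>y. fderiv \<phi> y (axis 2 1)) x u)"
    using d[of w] has_derivative_unique by blast
  then show ?thesis
    by (simp only: linear_axis2[OF lin, of _ u])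
qed

text \<open>Extrema over the compact product of \<open>K\<close> with the unit circle, extended to
  all directions by homogeneity. The lower bound is positive because \<phi> is an immersion.\<close>

lemma chart_bounds:
  fixes \<phi> :: "real^2 \<Rightarrow> real^3"
  assumes sm: "smooth_on V \<phi>" and V: "open V" "compact K" "K \<subseteq> V" "K \<noteq> {}" and inj: "\<And>x. x \<in> V \<Longrightarrow> inj (fderiv \<phi> x)"
  obtains \<mu> L K2 where "\<mu> > 0" "L > 0" "K2 \<ge> 0"
    "\<And>x w. x \<in> K \<Longrightarrow> \<mu> * norm w \<le> norm (fderiv \<phi> x w)" "\<And>x w. x \<in> K \<Longrightarrow> norm (fderiv \<phi> x w) \<le> L * norm w"
    "\<And>x w. x \<in> K \<Longrightarrow> norm (fderiv (\<lambda>y. fderiv \<phi> y w) x w) \<le> K2 * (norm w)\<^sup>2"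
proof -
  let ?C = "K \<times> sphere (0::real^2) 1"
  have "compact ?C" using V(2) by (intro compact_Times) auto
  have "axis 1 1 \<in> sphere (0::real^2) 1" by (simp add: norm_axis_1)
  then have ne: "?C \<noteq> {}" using V(4) by blast
  have c1: "continuous_on ?C (\<lambda>p. fderiv \<phi> (fst p) v)" for v
    by (rule continuous_on_compose2[OF smooth_on_continuous[OF smooth_on_fderiv[OF sm]], of _ fst])
      (use V(3) in \<open>auto intro: continuous_intros\<close>)
  have c2: "continuous_on ?C (\<lambda>p. fderiv (\<lambda>y. fderiv \<phi> y v) (fst p) u)" for v u
    by (rule continuous_on_compose2[OF smooth_on_continuous[OF smooth_on_fderiv[OF smooth_on_fderiv[OF sm]]], of _ fst])
      (use V(3) in \<open>auto intro: continuous_intros\<close>)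
  have "continuous_on ?C (\<lambda>p. norm ((snd p)$1 *\<^sub>R fderiv \<phi> (fst p) (axis 1 1) + (snd p)$2 *\<^sub>R fderiv \<phi> (fst p) (axis 2 1)))"
    by (intro continuous_intros c1)
  then have cn: "continuous_on ?C (\<lambda>p. norm (fderiv \<phi> (fst p) (snd p)))"
  proof (rule continuous_on_eq)
    fix p assume "p \<in> ?C"
    then have "fst p \<in> V" using V(3) by auto
    from linear_axis2[OF smooth_on_linear[OF sm this], of "snd p"]
    show "norm ((snd p)$1 *\<^sub>R fderiv \<phi> (fst p) (axis 1 1) + (snd p)$2 *\<^sub>R fderiv \<phi> (fst p) (axis 2 1))
       = norm (fderiv \<phi> (fst p) (snd p))" by simp
  qed
  define Q where "Q p = (snd p)$1 *\<^sub>R ((snd p)$1 *\<^sub>R fderiv (\<lambda>y. fderiv \<phi> y (axis 1 1)) (fst p) (axis 1 1) + (snd p)$2 *\<^sub>R fderiv (\<lambda>y. fderiv \<phi> y (axis 1 1)) (fst p) (axis 2 1))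
     + (snd p)$2 *\<^sub>R ((snd p)$1 *\<^sub>R fderiv (\<lambda>y. fderiv \<phi> y (axis 2 1)) (fst p) (axis 1 1) + (snd p)$2 *\<^sub>R fderiv (\<lambda>y. fderiv \<phi> y (axis 2 1)) (fst p) (axis 2 1))"
    for p :: "(real^2) \<times> (real^2)"
  have Q: "fderiv (\<lambda>y. fderiv \<phi> y w) x w = Q (x, w)" if "x \<in> V" for x w
    using second_fderiv_expand[OF sm V(1) that, of w w] unfolding Q_def by simp
  have "continuous_on ?C (\<lambda>p. norm (Q p))"
    unfolding Q_def by (intro continuous_intros c2)
  then have cs: "continuous_on ?C (\<lambda>p. norm (fderiv (\<lambda>y. fderiv \<phi> y (snd p)) (fst p) (snd p)))"
  proof (rule continuous_on_eq)
    fix p assume "p \<in> ?C"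
    then have "fst p \<in> V" using V(3) by auto
    from Q[OF this, of "snd p"] show "norm (Q p) = norm (fderiv (\<lambda>y. fderiv \<phi> y (snd p)) (fst p) (snd p))"
      by simp
  qed
  obtain p1 where p1: "p1 \<in> ?C" "\<And>p. p \<in> ?C \<Longrightarrow> norm (fderiv \<phi> (fst p1) (snd p1)) \<le> norm (fderiv \<phi> (fst p) (snd p))"
    using continuous_attains_inf[OF \<open>compact ?C\<close> ne cn] by blast
  obtain p2 where p2: "p2 \<in> ?C" "\<And>p. p \<in> ?C \<Longrightarrow> norm (fderiv \<phi> (fst p) (snd p)) \<le> norm (fderiv \<phi> (fst p2) (snd p2))"
    using continuous_attains_sup[OF \<open>compact ?C\<close> ne cn] by blast
  obtain p3 where p3: "p3 \<in> ?C" "\<And>p. p \<in> ?C \<Longrightarrow> norm (fderiv (\<lambda>y. fderiv \<phi> y (snd p)) (fst p) (snd p)) \<le> norm (fderiv (\<lambda>y. fderiv \<phi> y (snd p3)) (fst p3) (snd p3))"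
    using continuous_attains_sup[OF \<open>compact ?C\<close> ne cs] by blast
  define \<mu> where "\<mu> = norm (fderiv \<phi> (fst p1) (snd p1))"
  define L where "L = norm (fderiv \<phi> (fst p2) (snd p2))"
  define K2 where "K2 = norm (fderiv (\<lambda>y. fderiv \<phi> y (snd p3)) (fst p3) (snd p3))"
  have "\<mu> > 0"
  proof -
    have "fst p1 \<in> V" "snd p1 \<noteq> 0" using p1(1) V(3) by auto
    then have "fderiv \<phi> (fst p1) (snd p1) \<noteq> 0"
      using inj smooth_on_linear[OF sm] linear_injective_0 by blast
    then show ?thesis by (simp add: \<mu>_def)
  qed
  have "\<mu> \<le> L" using p2(2)[OF p1(1)] by (simp add: \<mu>_def L_def)
  have lin: "fderiv \<phi> x w = norm w *\<^sub>R fderiv \<phi> x (sgn w)" if "x \<in> K" for x w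
  proof -
    have "norm w *\<^sub>R sgn w = w" by (cases "w = 0") (simp_all add: sgn_div_norm)
    then show ?thesis using linear_scale[OF smooth_on_linear[OF sm], of x "norm w" "sgn w"] that V(3) by auto
  qed
  have inC: "(x, sgn w) \<in> ?C" if "x \<in> K" "w \<noteq> 0" for x and w :: "real^2"
    using that by (simp add: norm_sgn)
  show thesis
  proof (rule that[of \<mu> L K2])
    show "\<mu> > 0" by fact
    show "L > 0" using \<open>\<mu> > 0\<close> \<open>\<mu> \<le> L\<close> by simp
    show "K2 \<ge> 0" by (simp add: K2_def)
    fix x w assume x: "x \<in> K"
    have lin0: "linear (fderiv \<phi> x)" using smooth_on_linear[OF sm] x V(3) by blast
    show "\<mu> * norm w \<le> norm (fderiv \<phi> x w)"
    proof (cases "w = 0")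
      case False
      have "\<mu> \<le> norm (fderiv \<phi> x (sgn w))" using p1(2)[OF inC[OF x False]] by (simp add: \<mu>_def)
      then have "norm w * \<mu> \<le> norm w * norm (fderiv \<phi> x (sgn w))" by (rule mult_left_mono) simp
      then show ?thesis unfolding lin[OF x, of w] by (simp add: mult.commute)
    qed (simp add: linear_0[OF lin0])
    show "norm (fderiv \<phi> x w) \<le> L * norm w"
    proof (cases "w = 0")
      case False
      have "norm (fderiv \<phi> x (sgn w)) \<le> L" using p2(2)[OF inC[OF x False]] by (simp add: L_def)
      then have "norm w * norm (fderiv \<phi> x (sgn w)) \<le> norm w * L" by (rule mult_left_mono) simp
      then show ?thesis unfolding lin[OF x, of w] by (simp add: mult.commute)
    qed (simp add: linear_0[OF lin0])
    show "norm (fderiv (\<lambda>y. fderiv \<phi> y w) x w) \<le> K2 * (norm w)\<^sup>2"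
    proof (cases "w = 0")
      case True
      have "x \<in> V" using x V(3) by blast
      then show ?thesis using True Q[of x 0] by (simp add: Q_def)
    next
      case False
      have xV: "x \<in> V" using x V(3) by blast
      have w: "w = norm w *\<^sub>R sgn w" using False by (simp add: sgn_div_norm)
      have "Q (x, c *\<^sub>R u) = c\<^sup>2 *\<^sub>R Q (x, u)" for c u
        by (simp add: Q_def scaleR_add_right power2_eq_square mult.assoc mult.left_commute)
      from this[of "norm w" "sgn w"] have "fderiv (\<lambda>y. fderiv \<phi> y w) x w = (norm w)\<^sup>2 *\<^sub>R fderiv (\<lambda>y. fderiv \<phi> y (sgn w)) x (sgn w)"
        unfolding Q[OF xV] w[symmetric] .
      moreover have "norm (fderiv (\<lambda>y. fderiv \<phi> y (sgn w)) x (sgn w)) \<le> K2"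
        using p3(2)[OF inC[OF x False]] by (simp add: K2_def)
      then have "(norm w)\<^sup>2 * norm (fderiv (\<lambda>y. fderiv \<phi> y (sgn w)) x (sgn w)) \<le> (norm w)\<^sup>2 * K2"
        by (rule mult_left_mono) simp
      ultimately show ?thesis by (simp add: mult.commute[of K2])
    qed
  qed
qed

text \<open>Subtracting the soliton equation of the plane with normal \<open>n0\<close> from that of
  \<open>S\<close> leaves only terms containing \<open>n - n0\<close>. This difference is controlled
  by the tangential components of \<open>n0\<close>, that is, by the gradient of the height, so the
  height satisfies the inequality of \<open>strong_minimum_principle\<close> with the principal
  directions as \<open>w1\<close> and \<open>w2\<close>.\<close>

lemma local_rigidity:
  assumes gm: "gauss_map S N" and es: "embedded_surface S" and lp: "local_parametrization S V \<phi>"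
    and q: "q \<in> V" "q $ 2 > 0" and v: "norm v = 1" and a: "a \<noteq> 0"
    and soliton: "\<And>p. p \<in> S \<Longrightarrow> has_mean_curvature S N p (lam + (N p \<bullet> v) / 2)"
    and min: "\<And>y. y \<in> S \<Longrightarrow> m \<le> a \<bullet> y" and aq: "a \<bullet> \<phi> q = m"
    and n0: "N (\<phi> q) = n0" "lam + (n0 \<bullet> v) / 2 = 0"
  obtains r where "r > 0" "ball q r \<subseteq> V" "\<And>y. y \<in> ball q r \<Longrightarrow> y $ 2 > 0 \<and> a \<bullet> \<phi> y = m \<and> N (\<phi> y) = n0"
proof -
  note sm = local_parametrizationD(2)[OF lp]
  note opV = local_parametrizationD(1)[OF lp]
  note inj = local_parametrizationD(3)[OF lp]
  define B where "B = V \<inter> {x. x $ 2 > 0}"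
  have B: "open B" "q \<in> B" unfolding B_def
    using q opV by (auto intro!: open_Int open_halfspace_component_gt_cart)
  have BV: "B \<subseteq> V" by (auto simp: B_def)
  have BS: "\<phi> y \<in> S" if "y \<in> B" for y
    using that local_parametrizationD(4)[OF lp] by (auto simp: B_def half_plane_def)
  have Bint: "\<phi> y \<in> surface_interior S" if "y \<in> B" for y
    using that chart_interior[OF lp] by (auto simp: B_def)
  have norm1: "norm (N y) = 1" if "y \<in> S" for y using gm that unfolding gauss_map_def by blast
  have contN: "continuous_on B (\<lambda>y. N (\<phi> y) \<bullet> n0)"
  proof (intro continuous_intros continuous_on_compose2[of S N B \<phi>])
    show "continuous_on S N" using gm unfolding gauss_map_def by blast
    show "continuous_on B \<phi>" using smooth_on_continuous[OF sm] BV continuous_on_subset by blast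
    show "\<phi> ` B \<subseteq> S" using BS by blast
  qed
  have n01: "norm n0 = 1" using norm1[OF BS[OF B(2)]] n0 by simp
  \<comment> \<open>Keeping the normals in the hemisphere of \<open>n0\<close> excludes the opposite
    orientation, for which the plane would not solve the equation.\<close>
  have "N (\<phi> q) \<bullet> n0 > 0" using n0 n01 by (simp add: dot_square_norm)
  then have "\<forall>\<^sub>F y in nhds q. N (\<phi> y) \<bullet> n0 > 0 \<and> y \<in> B"
    using eventually_pos(1)[OF B(1) contN B(2)] eventually_nhds_in_open[OF B] eventually_conj by blast
  then obtain e where e: "e > 0" "\<And>y. dist y q < e \<Longrightarrow> N (\<phi> y) \<bullet> n0 > 0 \<and> y \<in> B"
    unfolding eventually_nhds_metric by blast
  define R where "R = e / 2"
  have R: "R > 0" using e by (simp add: R_def)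
  have near: "N (\<phi> y) \<bullet> n0 > 0" "y \<in> B" if "y \<in> cball q R" for y
    using e(2)[of y] e(1) that by (simp_all add: R_def dist_commute)
  have "cball q R \<subseteq> V" using near BV by blast
  moreover have "cball q R \<noteq> {}" using R by simp
  ultimately obtain \<mu> L K2 where bd: "\<mu> > 0" "L > 0" "K2 \<ge> 0"
    "\<And>x w. x \<in> cball q R \<Longrightarrow> \<mu> * norm w \<le> norm (fderiv \<phi> x w)"
    "\<And>x w. x \<in> cball q R \<Longrightarrow> norm (fderiv \<phi> x w) \<le> L * norm w"
    "\<And>x w. x \<in> cball q R \<Longrightarrow> norm (fderiv (\<lambda>y. fderiv \<phi> y w) x w) \<le> K2 * (norm w)\<^sup>2"
    using chart_bounds[OF sm opV compact_cball _ _ inj] by metis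
  have n0a: "n0 = sgn a \<or> n0 = - sgn a"
    using curvature_at_minimum(1)[OF gm es Bint[OF B(2)] a] min aq n0 by auto
  define \<kappa> where "\<kappa> = a \<bullet> n0"
  have a\<kappa>: "a = \<kappa> *\<^sub>R n0"
  proof -
    have "a \<bullet> sgn a = norm a" using a by (simp add: sgn_div_norm dot_square_norm power2_eq_square)
    moreover have "norm a *\<^sub>R sgn a = a" using a by (simp add: sgn_div_norm)
    ultimately show ?thesis using n0a by (auto simp: \<kappa>_def)
  qed
  \<comment> \<open>The 2 comes from the bound on \<open>n - n0\<close>, the 1 from
    \<open>norm v\<close>, and \<open>2 * K2 / \<mu>\<^sup>2\<close> from the second derivatives in
    the two unit tangent directions.\<close>
  define C where "C = 2 * (1 + 2 * K2 / \<mu>\<^sup>2)"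
  have C: "C \<ge> 0" using bd by (simp add: C_def)
  define h where "h y = a \<bullet> \<phi> y - m" for y
  have h0: "h y = 0" if y: "y \<in> ball q (R/4)" for y
  proof (rule strong_minimum_principle[OF R _ C, of "1 / L\<^sup>2" q h "\<lambda>x w. a \<bullet> fderiv \<phi> x w"
        "\<lambda>x w u. a \<bullet> fderiv (\<lambda>y. fderiv \<phi> y w) x u" "2 / \<mu>\<^sup>2" y])
    show "1 / L\<^sup>2 > 0" using bd by simp
    show "h q = 0" using aq by (simp add: h_def)
    show "y \<in> ball q (R/4)" by fact
    fix x assume xR: "x \<in> ball q R"
    then have xc: "x \<in> cball q R" by simp
    then have xB: "x \<in> B" and xV: "x \<in> V" and xpos: "x $ 2 > 0" and Npos: "N (\<phi> x) \<bullet> n0 > 0"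
      using near[of x] by (auto simp: B_def)
    show "h x \<ge> 0" using min[OF BS[OF xB]] by (simp add: h_def)
    show "(h has_derivative (\<lambda>w. a \<bullet> fderiv \<phi> x w)) (at x)"
      unfolding h_def using has_derivative_diff[OF has_derivative_inner_right[OF smooth_on_has_derivative[OF sm xV]] has_derivative_const]
      by simp
    show "((\<lambda>y. a \<bullet> fderiv \<phi> y w) has_derivative (\<lambda>u. a \<bullet> fderiv (\<lambda>y. fderiv \<phi> y w) x u)) (at x)" for w
      by (intro has_derivative_inner_right smooth_on_has_derivative[OF smooth_on_fderiv[OF sm] xV])
    define n where "n = N (\<phi> x)"
    have n1: "norm n = 1" using norm1[OF BS[OF xB]] by (simp add: n_def)
    have xH: "x \<in> half_plane" using xpos by (simp add: half_plane_def)
    have orth: "n \<bullet> fderiv \<phi> x w = 0" for w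
      using gauss_map_orthogonal[OF gm lp xV xH] by (simp add: n_def)
    obtain w1 w2 where w: "norm (fderiv \<phi> x w1) = 1" "norm (fderiv \<phi> x w2) = 1" "fderiv \<phi> x w1 \<bullet> fderiv \<phi> x w2 = 0"
      and H: "n \<bullet> fderiv (\<lambda>y. fderiv \<phi> y w1) x w1 + n \<bullet> fderiv (\<lambda>y. fderiv \<phi> y w2) x w2 = 2 * (lam + (n \<bullet> v) / 2)"
      using principal_curvature_sum[OF gm lp xV xpos soliton[OF BS[OF xB]]] unfolding n_def by metis
    define e1 e2 where "e1 = fderiv \<phi> x w1" and "e2 = fderiv \<phi> x w2"
    have e: "norm e1 = 1" "norm e2 = 1" "e1 \<bullet> e2 = 0" "n \<bullet> e1 = 0" "n \<bullet> e2 = 0"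
      using w orth by (simp_all add: e1_def e2_def)
    have ee: "e1 \<bullet> e1 = 1" "e2 \<bullet> e2 = 1" "n \<bullet> n = 1" using e n1 by (simp_all add: dot_square_norm)
    note expand = orthonormal_expansion[OF e(1,2) n1 e(3-5)]
    have len: "(norm w)\<^sup>2 \<le> 1 / \<mu>\<^sup>2" if "norm (fderiv \<phi> x w) = 1" for w
    proof -
      have "\<mu> * norm w \<le> 1" using bd(4)[OF xc, of w] that by simp
      then have "(\<mu> * norm w)\<^sup>2 \<le> 1" using bd(1) by (simp add: power_le_one)
      then show ?thesis using bd(1) by (simp add: power_mult_distrib field_simps)
    qed
    have len2: "(norm w1)\<^sup>2 + (norm w2)\<^sup>2 \<le> 2 / \<mu>\<^sup>2" using len[OF w(1)] len[OF w(2)] by simp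
    have ell: "1 / L\<^sup>2 * (norm r)\<^sup>2 \<le> (r \<bullet> w1)\<^sup>2 + (r \<bullet> w2)\<^sup>2" for r
    proof -
      have lin: "linear (fderiv \<phi> x)" using smooth_on_linear[OF sm xV] .
      define u where "u = fderiv \<phi> x r"
      define \<alpha> \<beta> where "\<alpha> = u \<bullet> e1" and "\<beta> = u \<bullet> e2"
      have "u \<bullet> n = 0" using orth by (simp add: u_def inner_commute)
      then have u: "u = \<alpha> *\<^sub>R e1 + \<beta> *\<^sub>R e2" using expand[of u] by (simp add: \<alpha>_def \<beta>_def)
      then have "fderiv \<phi> x (r - (\<alpha> *\<^sub>R w1 + \<beta> *\<^sub>R w2)) = 0"
        using lin by (simp add: u_def e1_def e2_def linear_diff linear_add linear_scale)
      then have r: "r = \<alpha> *\<^sub>R w1 + \<beta> *\<^sub>R w2"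
        using inj[OF xV] lin linear_injective_0 by (metis eq_iff_diff_eq_0)
      define A where "A = (r \<bullet> w1)\<^sup>2 + (r \<bullet> w2)\<^sup>2"
      have "(norm r)\<^sup>2 = r \<bullet> r" by (simp add: power2_norm_eq_inner)
      also have "\<dots> = \<alpha> * (r \<bullet> w1) + \<beta> * (r \<bullet> w2)"
        by (subst (2) r) (simp add: inner_add_right)
      finally have nr: "(norm r)\<^sup>2 = \<alpha> * (r \<bullet> w1) + \<beta> * (r \<bullet> w2)" .
      have "(norm u)\<^sup>2 = \<alpha>\<^sup>2 + \<beta>\<^sup>2"
        unfolding power2_norm_eq_inner u using e(3) ee
        by (simp add: inner_add_left inner_add_right power2_eq_square inner_commute)
      moreover have "(norm u)\<^sup>2 \<le> (L * norm r)\<^sup>2"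
        using bd(5)[OF xc, of r] by (intro power_mono) (simp_all add: u_def)
      ultimately have ab: "\<alpha>\<^sup>2 + \<beta>\<^sup>2 \<le> L\<^sup>2 * (norm r)\<^sup>2" by (simp add: power_mult_distrib)
      \<comment> \<open>Lagrange's identity; dropping the square on the left gives Cauchy-Schwarz
        for the coefficients of \<open>r\<close> in the frame \<open>w1\<close>, \<open>w2\<close>,
        and thus the ellipticity constant \<open>1 / L\<^sup>2\<close>.\<close>
      have "((norm r)\<^sup>2)\<^sup>2 + (\<alpha> * (r \<bullet> w2) - \<beta> * (r \<bullet> w1))\<^sup>2 = (\<alpha>\<^sup>2 + \<beta>\<^sup>2) * A"
        unfolding nr A_def by algebra
      then have "((norm r)\<^sup>2)\<^sup>2 \<le> (\<alpha>\<^sup>2 + \<beta>\<^sup>2) * A" by (smt (verit) zero_le_power2)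
      also have "\<dots> \<le> (L\<^sup>2 * (norm r)\<^sup>2) * A" using ab by (rule mult_right_mono) (simp add: A_def)
      finally have "(norm r)\<^sup>2 * (norm r)\<^sup>2 \<le> (norm r)\<^sup>2 * (L\<^sup>2 * A)" by (simp add: power2_eq_square algebra_simps)
      then have "(norm r)\<^sup>2 \<le> L\<^sup>2 * A"
        by (cases "r = 0") (auto simp: A_def intro: mult_left_le_imp_le[of "(norm r)\<^sup>2"])
      then show ?thesis using bd(2) unfolding A_def[symmetric] by (simp add: field_simps)
    qed
    define x1 x2 t where "x1 = n0 \<bullet> e1" and "x2 = n0 \<bullet> e2" and "t = n0 \<bullet> n"
    have n0e: "n0 = x1 *\<^sub>R e1 + x2 *\<^sub>R e2 + t *\<^sub>R n" using expand[of n0] by (simp add: x1_def x2_def t_def)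
    have n0sq: "n0 \<bullet> n0 = 1" using n01 by (simp add: dot_square_norm)
    have sq: "1 = x1\<^sup>2 + x2\<^sup>2 + t\<^sup>2"
    proof -
      have "n0 \<bullet> n0 = x1 * (n0 \<bullet> e1) + x2 * (n0 \<bullet> e2) + t * (n0 \<bullet> n)"
        by (subst (2) n0e) (simp add: inner_add_right)
      then show ?thesis using n0sq by (simp add: x1_def x2_def t_def power2_eq_square)
    qed
    have t0: "t \<ge> 0" using Npos by (simp add: t_def n_def inner_commute)
    have t1: "t \<le> 1"
    proof -
      have "t\<^sup>2 \<le> 1\<^sup>2" using sq zero_le_power2[of x1] zero_le_power2[of x2] unfolding one_power2 by linarith
      then show ?thesis by (rule power2_le_imp_le) simp
    qed
    \<comment> \<open>Two unit vectors with \<open>0 \<le> t \<le> 1\<close> satisfy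
      \<open>2 - 2 * t \<le> 2 * (1 - t\<^sup>2)\<close>, and \<open>1 - t\<^sup>2\<close> is the
      squared length of the tangential part of \<open>n0\<close>.\<close>
    have dn: "norm (n - n0) \<le> 2 * (\<bar>x1\<bar> + \<bar>x2\<bar>)"
    proof (rule power2_le_imp_le)
      have "(norm (n - n0))\<^sup>2 = 2 - 2 * t"
        unfolding power2_norm_eq_inner using ee n0sq
        by (simp add: inner_diff_left inner_diff_right t_def inner_commute)
      also have "\<dots> \<le> 2 * (1 - t\<^sup>2)"
        using mult_left_mono[OF t1 t0] by (simp add: power2_eq_square)
      also have "\<dots> = 2 * (x1\<^sup>2 + x2\<^sup>2)" using sq by simp
      also have "\<dots> \<le> (2 * (\<bar>x1\<bar> + \<bar>x2\<bar>))\<^sup>2"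
      proof -
        have eq: "(2 * (\<bar>x1\<bar> + \<bar>x2\<bar>))\<^sup>2 = 4 * x1\<^sup>2 + 4 * x2\<^sup>2 + 8 * (\<bar>x1\<bar> * \<bar>x2\<bar>)"
          by (simp add: power2_sum power_mult_distrib)
        have "2 * (u + w) \<le> 4 * u + 4 * w + 8 * z" if "0 \<le> u" "0 \<le> w" "0 \<le> z" for u w z :: real
          using that by simp
        then show ?thesis unfolding eq by simp
      qed
      finally show "(norm (n - n0))\<^sup>2 \<le> (2 * (\<bar>x1\<bar> + \<bar>x2\<bar>))\<^sup>2" .
    qed simp
    define D1 D2 where "D1 = fderiv (\<lambda>y. fderiv \<phi> y w1) x w1" and "D2 = fderiv (\<lambda>y. fderiv \<phi> y w2) x w2"
    have "norm D1 \<le> K2 * (1 / \<mu>\<^sup>2)" "norm D2 \<le> K2 * (1 / \<mu>\<^sup>2)"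
      unfolding D1_def D2_def
      using order_trans[OF bd(6)[OF xc] mult_left_mono[OF len[OF w(1)] bd(3)]]
        order_trans[OF bd(6)[OF xc] mult_left_mono[OF len[OF w(2)] bd(3)]] by auto
    then have nD: "norm (D1 + D2) \<le> 2 * K2 / \<mu>\<^sup>2"
      using norm_triangle_ineq[of D1 D2] by simp
    \<comment> \<open>The equation at \<open>x\<close> reads
      \<open>n \<bullet> (D1 + D2) = 2 * lam + n \<bullet> v\<close>; by
      \<open>2 * lam = - (n0 \<bullet> v)\<close> its right side is
      \<open>(n - n0) \<bullet> v\<close>.\<close>
    have "n0 \<bullet> D1 + n0 \<bullet> D2 = (n - n0) \<bullet> v - (n - n0) \<bullet> (D1 + D2)"
      using H n0(2) by (simp add: D1_def[symmetric] D2_def[symmetric] inner_diff_left inner_add_right)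
    also have "\<dots> = (n - n0) \<bullet> (v - (D1 + D2))" by (simp add: inner_diff_right)
    finally have "\<bar>n0 \<bullet> D1 + n0 \<bullet> D2\<bar> \<le> norm (n - n0) * norm (v - (D1 + D2))"
      by (simp add: Cauchy_Schwarz_ineq2)
    also have "\<dots> \<le> (2 * (\<bar>x1\<bar> + \<bar>x2\<bar>)) * (1 + 2 * K2 / \<mu>\<^sup>2)"
      using dn nD v norm_triangle_ineq4[of v "D1 + D2"] by (intro mult_mono) auto
    also have "\<dots> = C * (\<bar>x1\<bar> + \<bar>x2\<bar>)" by (simp only: C_def mult_ac)
    finally have bound: "\<bar>n0 \<bullet> D1 + n0 \<bullet> D2\<bar> \<le> C * (\<bar>x1\<bar> + \<bar>x2\<bar>)" .
    have "a \<bullet> D1 + a \<bullet> D2 = \<kappa> * (n0 \<bullet> D1 + n0 \<bullet> D2)" by (subst (1 2) a\<kappa>) (simp add: distrib_left)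
    also have "\<dots> \<le> \<bar>\<kappa>\<bar> * \<bar>n0 \<bullet> D1 + n0 \<bullet> D2\<bar>" by (metis abs_ge_self abs_mult)
    also have "\<dots> \<le> \<bar>\<kappa>\<bar> * (C * (\<bar>x1\<bar> + \<bar>x2\<bar>))" using bound by (rule mult_left_mono) simp
    also have "\<dots> = C * (\<bar>a \<bullet> e1\<bar> + \<bar>a \<bullet> e2\<bar>)"
      by (subst (1 2) a\<kappa>) (simp add: x1_def x2_def abs_mult algebra_simps)
    finally show "\<exists>w1 w2. (norm w1)\<^sup>2 + (norm w2)\<^sup>2 \<le> 2 / \<mu>\<^sup>2 \<and>
        (\<forall>r. 1 / L\<^sup>2 * (norm r)\<^sup>2 \<le> (r \<bullet> w1)\<^sup>2 + (r \<bullet> w2)\<^sup>2) \<and>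
        a \<bullet> fderiv (\<lambda>y. fderiv \<phi> y w1) x w1 + a \<bullet> fderiv (\<lambda>y. fderiv \<phi> y w2) x w2
        \<le> C * (\<bar>a \<bullet> fderiv \<phi> x w1\<bar> + \<bar>a \<bullet> fderiv \<phi> x w2\<bar>)"
      using len2 ell unfolding D1_def D2_def e1_def e2_def by blast
  qed
  show thesis
  proof (rule that[of "R/4"])
    show "R/4 > 0" using R by simp
    have sub: "y \<in> cball q R" if "y \<in> ball q (R/4)" for y using that R by simp
    show "ball q (R/4) \<subseteq> V" using sub near(2) BV by blast
    fix y assume y: "y \<in> ball q (R/4)"
    have yB: "y \<in> B" using near(2)[OF sub[OF y]] .
    have ay: "a \<bullet> \<phi> y = m" using h0[OF y] by (simp add: h_def)
    have "N (\<phi> y) = sgn a \<or> N (\<phi> y) = - sgn a"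
      using curvature_at_minimum(1)[OF gm es Bint[OF yB] a] min ay by auto
    then have "N (\<phi> y) = n0 \<or> N (\<phi> y) = - n0" using n0a by auto
    moreover have "N (\<phi> y) \<noteq> - n0"
      using near(1)[OF sub[OF y]] n01 by (auto simp: dot_square_norm)
    ultimately show "y $ 2 > 0 \<and> a \<bullet> \<phi> y = m \<and> N (\<phi> y) = n0" using ay yB by (auto simp: B_def)
  qed
qed

text \<open>Open-closed argument in the connected interior, with \<open>local_rigidity\<close>
  giving openness; boundary points follow by density.\<close>

lemma soliton_in_plane:
  assumes sol: "translating_soliton lam v S N" and v: "norm v = 1" and a: "a \<noteq> 0"
    and p: "p \<in> surface_interior S" and min: "\<And>y. y \<in> S \<Longrightarrow> a \<bullet> p \<le> a \<bullet> y"
    and n0: "lam + (N p \<bullet> v) / 2 = 0" and y: "y \<in> S"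
  shows "a \<bullet> y = a \<bullet> p"
proof -
  have es: "embedded_surface S" and conn: "connected S" and gm: "gauss_map S N"
    and H: "\<And>p. p \<in> S \<Longrightarrow> has_mean_curvature S N p (lam + (N p \<bullet> v) / 2)"
    using sol unfolding translating_soliton_def by blast+
  define T where "T = surface_interior S"
  have TS: "T \<subseteq> S" by (auto simp: T_def surface_interior_def)
  \<comment> \<open>The normal is part of the condition, because rigidity at the next point again
    needs the orientation for which the plane solves the equation.\<close>
  define A where "A = {x \<in> T. a \<bullet> x = a \<bullet> p} \<inter> {x \<in> T. N x = N p}"
  have "connected T" unfolding T_def by (rule surface_interior_connected[OF es conn])
  have contN: "continuous_on T N" using gm TS continuous_on_subset unfolding gauss_map_def by blast
  have "closedin (top_of_set T) A"
    unfolding A_def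
    by (intro closedin_Int continuous_closedin_preimage_constant continuous_intros contN)
  moreover have "openin (top_of_set T) A"
  proof (subst openin_subopen, intro ballI)
    fix x assume x: "x \<in> A"
    then have "x \<in> surface_interior S" by (auto simp: A_def T_def)
    then obtain V \<phi> q where lp: "local_parametrization S V \<phi>" and q: "q \<in> V" "q $ 2 > 0" "\<phi> q = x"
      using interior_chart[OF es] by blast
    have aq: "a \<bullet> \<phi> q = a \<bullet> p" "N (\<phi> q) = N p" using x q(3) by (auto simp: A_def)
    obtain r where r: "r > 0" "ball q r \<subseteq> V" "\<And>y. y \<in> ball q r \<Longrightarrow> y $ 2 > 0 \<and> a \<bullet> \<phi> y = a \<bullet> p \<and> N (\<phi> y) = N p"
      using local_rigidity[OF gm es lp q(1,2) v a H min aq n0] by blast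
    obtain W where W: "open W" "S \<inter> W = \<phi> ` (ball q r \<inter> half_plane)"
      using chart_image_open[OF lp open_ball r(2)] by blast
    have "x \<in> W"
    proof -
      have "\<phi> q \<in> \<phi> ` (ball q r \<inter> half_plane)" using r(1) q(2) by (simp add: half_plane_def)
      then show ?thesis using W(2) q(3) by blast
    qed
    moreover have "T \<inter> W \<subseteq> A"
    proof
      fix z assume z: "z \<in> T \<inter> W"
      then have "z \<in> \<phi> ` (ball q r \<inter> half_plane)" using W(2) TS by blast
      then show "z \<in> A" using r(3) z by (auto simp: A_def)
    qed
    moreover have "x \<in> T" using x by (simp add: A_def)
    ultimately show "\<exists>U. openin (top_of_set T) U \<and> x \<in> U \<and> U \<subseteq> A"
      using openin_open_Int[OF W(1), of T] by blast
  qed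
  ultimately have "A = {} \<or> A = T" using \<open>connected T\<close> unfolding connected_clopen by blast
  moreover have "p \<in> A" using p by (simp add: A_def T_def)
  ultimately have AT: "A = T" by blast
  have "y \<in> closure T"
  proof -
    obtain V \<phi> q where "local_parametrization S V \<phi>" "q \<in> V" "q \<in> half_plane" "\<phi> q = y"
      using es y unfolding embedded_surface_def by (metis IntE imageE)
    then show ?thesis unfolding T_def using interior_nhd_chart(2) by blast
  qed
  moreover have "closure T \<subseteq> {x. a \<bullet> x = a \<bullet> p}"
    by (rule closure_minimal) (use AT closed_hyperplane in \<open>auto simp: A_def\<close>)
  ultimately show ?thesis by blast
qed

theorem theorem3p2:
  fixes v a :: "real^3" and lam b :: real
    and P \<Gamma> D S :: "(real^3) set" and N :: "real^3 \<Rightarrow> real^3"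
  assumes "norm v = 1"
    and "a \<noteq> 0" and "P = {x. a \<bullet> x = b}"
    and "jordan_curve \<Gamma>" and "\<Gamma> \<subseteq> P"
    and "domain_bounded_by P \<Gamma> D"
    and "translating_soliton lam v S N" and "compact S"
    and "surface_boundary S = \<Gamma>"
    and "S \<inter> (P - closure D) = {}"
  shows "surface_interior S \<subseteq> {x. a \<bullet> x < b} \<or>
         surface_interior S \<subseteq> {x. a \<bullet> x > b} \<or>
         S \<subseteq> P"
proof (rule ccontr)
  assume neg: "\<not> ?thesis"
  have es: "embedded_surface S" and conn: "connected S" and gm: "gauss_map S N"
    and H: "\<And>p. p \<in> S \<Longrightarrow> has_mean_curvature S N p (lam + (N p \<bullet> v) / 2)"
    using assms(7) unfolding translating_soliton_def by blast+
  interpret spanning_surface a b P \<Gamma> D S N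
    by unfold_locales (use assms es conn gm in auto)
  \<comment> \<open>The first two alternatives of the conclusion fail, and their inequalities are
    strict, so \<open>x1\<close> or \<open>x2\<close> may have height exactly
    \<open>b\<close>.\<close>
  obtain x1 where x1: "x1 \<in> S - \<Gamma>" "a \<bullet> x1 \<ge> b" using neg interior_eq by force
  obtain x2 where x2: "x2 \<in> S - \<Gamma>" "a \<bullet> x2 \<le> b" using neg interior_eq by force
  have "S \<noteq> {}" using x1 by blast
  have cont: "continuous_on S (\<lambda>x. a \<bullet> x)" by (intro continuous_intros)
  have on\<Gamma>: "a \<bullet> x = b" if "x \<in> \<Gamma>" for x using that \<Gamma>P assms(3) by auto
  \<comment> \<open>If the maximum is attained on \<Gamma>, it equals \<open>b\<close>, and the
    interior point \<open>x1\<close> attains it as well.\<close>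
  obtain q where q: "q \<in> S - \<Gamma>" "\<And>x. x \<in> S \<Longrightarrow> a \<bullet> x \<le> a \<bullet> q" "b \<le> a \<bullet> q"
  proof -
    obtain q' where q': "q' \<in> S" "\<And>x. x \<in> S \<Longrightarrow> a \<bullet> x \<le> a \<bullet> q'"
      using continuous_attains_sup[OF S_compact \<open>S \<noteq> {}\<close> cont] by blast
    show thesis
    proof (cases "q' \<in> \<Gamma>")
      case True
      then show thesis using that[of x1] x1 q'(2) on\<Gamma>[OF True] by force
    next
      case False
      then show thesis using that[of q'] q' x1 by force
    qed
  qed
  obtain p where p: "p \<in> S - \<Gamma>" "\<And>x. x \<in> S \<Longrightarrow> a \<bullet> p \<le> a \<bullet> x" "a \<bullet> p \<le> b"
  proof -
    obtain p' where p': "p' \<in> S" "\<And>x. x \<in> S \<Longrightarrow> a \<bullet> p' \<le> a \<bullet> x"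
      using continuous_attains_inf[OF S_compact \<open>S \<noteq> {}\<close> cont] by blast
    show thesis
    proof (cases "p' \<in> \<Gamma>")
      case True
      then show thesis using that[of x2] x2 p'(2) on\<Gamma>[OF True] by force
    next
      case False
      then show thesis using that[of p'] p' x2 by force
    qed
  qed
  have pi: "p \<in> surface_interior S" and qi: "q \<in> surface_interior S" using p(1) q(1) interior_eq by simp_all
  have pS: "p \<in> S" and qS: "q \<in> S" using p(1) q(1) by blast+
  note at_p = curvature_at_minimum(1)[OF gm es pi assms(2) p(2)]
    curvature_at_minimum(2)[OF gm es pi assms(2) p(2) H[OF pS]]
  note at_q = curvature_at_maximum(1)[OF gm es qi assms(2) q(2)]
    curvature_at_maximum(2)[OF gm es qi assms(2) q(2) H[OF qS]]
  have Npq: "N p = N q" by (rule normals_at_extrema_agree[OF p q at_p(1) at_q(1)])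
  have "a \<bullet> N p \<noteq> 0" using at_p(1) assms(2) by (auto simp: sgn_div_norm)
  \<comment> \<open>With a common normal this product is nonnegative by the test at the minimum and
    nonpositive by the test at the maximum.\<close>
  moreover have "(lam + (N p \<bullet> v) / 2) * (a \<bullet> N p) = 0"
    using at_p(2) at_q(2) Npq by simp
  ultimately have "lam + (N p \<bullet> v) / 2 = 0" by simp
  note flat = soliton_in_plane[OF assms(7,1,2) pi p(2) this]
  \<comment> \<open>\<open>S\<close> lies in a plane parallel to \<open>P\<close>; a single point of
    \<Gamma> identifies it as \<open>P\<close>.\<close>
  obtain g where "g \<in> \<Gamma>" using \<Gamma>_nonempty by blast
  then have "a \<bullet> p = b" using flat[of g] on\<Gamma> \<Gamma>_subset_S by auto
  then have "S \<subseteq> P" using flat assms(3) by auto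
  then show False using neg by blast
qed

end
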